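(* Let $(M,\bar g,J)$ be a rotational hypersurface of type II in $\mathbb C^n\times\mathbb R$ ($\dim M=2n\ge4$) generated by the meridian $$\gamma:\ \mathbf z(s)=t(s)\mathbf n+q(s)\mathbf e,\qquad s\in I,$$ in the hyperbolic plane $O\mathbf{ne}$, with $t(s)>0$, $t'(s)\ge1$ for $s\in I$. Then the metric $$g=\bar g+(t'-1)(\bar\eta\otimes\bar\eta+\tilde{\bar\eta}\otimes\tilde{\bar\eta})$$ is Bochner-Kähler if and only if $$s(t)=\int\frac{dt}{c_1t^4+c_2t^2+1},$$ where $c_1=\mathrm{const}$, $c_2=\mathrm{const}$ (i.e. there are real constants $c_1,c_2$ such that the inverse function $s(t)$ of $t(s)$ is an antiderivative of $1/(c_1t^4+c_2t^2+1)$).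
   Context: Rotational hypersurfaces of type II: let $(\mathbb C^n,g',J_0)$ be the complex Euclidean space with standard complex structure $J_0$, and let $\mathbb R$ be spanned by $\mathbf e$ with $\mathbf e^2=-1$; the product metric on $\mathbb C^n\times\mathbb R$ has signature $(2n,1)$. For smooth functions $t(s)>0$, $q(s)$ on an interval $I$, the rotational hypersurface $M$ generated by the meridian $\gamma$ consists of the points $\mathbf Z=t(s)\mathbf n+q(s)\mathbf e$, $s\in I$, $\mathbf n\in S^{2n-1}(1)\subset\mathbb C^n$ (for the meridian, $\mathbf n$ is fixed). $M$ is of type II if its normals are time-like; $s$ is a natural parameter, $t'^2-q'^2=1$. Structures on $M$: $\bar g$ is the induced metric; $\bar\xi=\partial\mathbf Z/\partial s$; $\tilde{\bar\xi}=J_0\mathbf n$; $\bar\eta=\bar g(\bar\xi,\cdot)$, $\tilde{\bar\eta}=\bar g(\tilde{\bar\xi},\cdot)$; $D$ is the $\bar g$-orthogonal complement of $\mathrm{span}\{\bar\xi,\tilde{\bar\xi}\}$ in $TM$; $J|_D=J_0$, $J\bar\xi=\tilde{\bar\xi}$, $J\tilde{\bar\xi}=-\bar\xi$. The metric $g$ is Kähler with respect to $J$. A Kähler metric $g$ is Bochner-Kähler if its Bochner tensor vanishes: in local holomorphic coordinates, with curvature tensor $R$, Ricci tensor $\rho$ and scalar curvature $\tau$, where $R(X,Y)Z=\nabla_X\nabla_YZ-\nabla_Y\nabla_XZ-\nabla_{[X,Y]}Z$, $R(X,Y,Z,U)=g(R(X,Y)Z,U)$, $\rho(Y,Z)=\sum_iR(e_i,Y,Z,e_i)$,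 $\tau=\sum_i\rho(e_i,e_i)$, $$R_{\alpha\bar\beta\gamma\bar\delta}-\tfrac1{n+2}(g_{\alpha\bar\beta}\rho_{\gamma\bar\delta}+g_{\gamma\bar\beta}\rho_{\alpha\bar\delta}+g_{\gamma\bar\delta}\rho_{\alpha\bar\beta}+g_{\alpha\bar\delta}\rho_{\gamma\bar\beta})+\tfrac{\tau}{2(n+1)(n+2)}(g_{\alpha\bar\beta}g_{\gamma\bar\delta}+g_{\gamma\bar\beta}g_{\alpha\bar\delta})=0 .$$ *)

theory Defs
  imports "HOL-Analysis.Analysis"
begin

section \<open>Smooth maps\<close>

text \<open>Both notions are meant for open sets \<open>S\<close>.\<close>

fun higher_differentiable_on ::
  "'a::real_normed_vector set \<Rightarrow> ('a \<Rightarrow> 'b::real_normed_vector) \<Rightarrow> nat \<Rightarrow> bool" where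
  "higher_differentiable_on S f 0 \<longleftrightarrow> continuous_on S f"
| "higher_differentiable_on S f (Suc k) \<longleftrightarrow>
     (\<forall>x\<in>S. f differentiable (at x)) \<and>
     (\<forall>v. higher_differentiable_on S (\<lambda>x. frechet_derivative f (at x) v) k)"

definition smooth_on ::
  "'a::real_normed_vector set \<Rightarrow> ('a \<Rightarrow> 'b::real_normed_vector) \<Rightarrow> bool" where
  "smooth_on S f \<longleftrightarrow> (\<forall>k. higher_differentiable_on S f k)"


section \<open>Riemannian geometry in a coordinate domain\<close>

text \<open>A metric on an open subset of a Euclidean space \<open>'a\<close> is a map \<open>h\<close> sending a point to a
  bilinear form on \<open>'a\<close>; vector fields are maps \<open>'a \<Rightarrow> 'a\<close>.\<close>

type_synonym 'a metric_field = "'a \<Rightarrow> 'a \<Rightarrow> 'a \<Rightarrow> real"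

text \<open>The value at \<open>x\<close> of the Levi-Civita derivative \<open>\<nabla>\<^sub>u v\<close> of the constant fields \<open>u\<close>, \<open>v\<close>, given
  by the Koszul formula (all Lie brackets of constant fields vanish).\<close>

definition christoffel ::
  "'a::euclidean_space metric_field \<Rightarrow> 'a \<Rightarrow> 'a \<Rightarrow> 'a \<Rightarrow> 'a" where
  "christoffel h x u v =
     (THE w. \<forall>z. 2 * h x w z =
        frechet_derivative (\<lambda>y. h y v z) (at x) u
      + frechet_derivative (\<lambda>y. h y u z) (at x) v
      - frechet_derivative (\<lambda>y. h y u v) (at x) z)"

definition cov_deriv ::
  "'a::euclidean_space metric_field \<Rightarrow> ('a \<Rightarrow> 'a) \<Rightarrow> ('a \<Rightarrow> 'a) \<Rightarrow> 'a \<Rightarrow> 'a" where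
  "cov_deriv h X Y x = frechet_derivative Y (at x) (X x) + christoffel h x (X x) (Y x)"

definition lie_bracket ::
  "('a::euclidean_space \<Rightarrow> 'a) \<Rightarrow> ('a \<Rightarrow> 'a) \<Rightarrow> 'a \<Rightarrow> 'a" where
  "lie_bracket X Y x = frechet_derivative Y (at x) (X x) - frechet_derivative X (at x) (Y x)"

definition curvature_op ::
  "'a::euclidean_space metric_field \<Rightarrow> ('a \<Rightarrow> 'a) \<Rightarrow> ('a \<Rightarrow> 'a) \<Rightarrow> ('a \<Rightarrow> 'a) \<Rightarrow> 'a \<Rightarrow> 'a" where
  "curvature_op h X Y Z x =
     cov_deriv h X (cov_deriv h Y Z) x - cov_deriv h Y (cov_deriv h X Z) x
     - cov_deriv h (lie_bracket X Y) Z x"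

text \<open>Curvature is tensorial, so its value on tangent vectors is computed from their constant
  extensions.\<close>

definition curvature ::
  "'a::euclidean_space metric_field \<Rightarrow> 'a \<Rightarrow> 'a \<Rightarrow> 'a \<Rightarrow> 'a \<Rightarrow> 'a \<Rightarrow> real" where
  "curvature h x u v w z = h x (curvature_op h (\<lambda>_. u) (\<lambda>_. v) (\<lambda>_. w) x) z"

definition orthonormal_basis :: "('a::euclidean_space \<Rightarrow> 'a \<Rightarrow> real) \<Rightarrow> 'a set \<Rightarrow> bool" where
  "orthonormal_basis b E \<longleftrightarrow> finite E \<and> card E = DIM('a) \<and>
     (\<forall>e\<in>E. \<forall>e'\<in>E. b e e' = (if e = e' then 1 else 0))"

text \<open>Here \<open>b\<close> is an inner product. The trace does not depend on the orthonormal basis chosen.\<close>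

definition metric_trace ::
  "('a::euclidean_space \<Rightarrow> 'a \<Rightarrow> real) \<Rightarrow> ('a \<Rightarrow> 'a \<Rightarrow> real) \<Rightarrow> real" where
  "metric_trace b T = (\<Sum>e\<in>(SOME E. orthonormal_basis b E). T e e)"

definition ricci :: "'a::euclidean_space metric_field \<Rightarrow> 'a \<Rightarrow> 'a \<Rightarrow> 'a \<Rightarrow> real" where
  "ricci h x v w = metric_trace (h x) (\<lambda>e e'. curvature h x e v w e')"

definition scalar_curvature :: "'a::euclidean_space metric_field \<Rightarrow> 'a \<Rightarrow> real" where
  "scalar_curvature h x = metric_trace (h x) (ricci h x)"


section \<open>The Bochner tensor in holomorphic coordinates\<close>

text \<open>With \<open>z\<^sub>\<alpha> = x\<^sub>\<alpha> + \<i> y\<^sub>\<alpha>\<close> the coordinate fields are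
  \<open>\<partial>/\<partial>z\<^sub>\<alpha> = (\<Sum>a. hol_coeff a \<cdot> real_frame \<alpha> a) = (\<partial>/\<partial>x\<^sub>\<alpha> - \<i> \<partial>/\<partial>y\<^sub>\<alpha>) / 2\<close>, and the conjugate fields
  have the conjugate coefficients. Components are those of the complex multilinear extension.\<close>

definition real_frame :: "'n::finite \<Rightarrow> bool \<Rightarrow> complex ^ 'n" where
  "real_frame \<alpha> a = axis \<alpha> (if a then \<i> else 1)"

definition hol_coeff :: "bool \<Rightarrow> complex" where
  "hol_coeff a = (if a then - \<i> / 2 else 1 / 2)"

text \<open>\<open>B\<close> on the fields \<open>\<partial>\<^sub>\<alpha>\<close>, \<open>conj \<partial>\<^sub>\<beta>\<close>.\<close>

definition component2 ::
  "((complex ^ 'n::finite) \<Rightarrow> (complex ^ 'n) \<Rightarrow> real) \<Rightarrow> 'n \<Rightarrow> 'n \<Rightarrow> complex" where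
  "component2 B \<alpha> \<beta> =
     (\<Sum>a\<in>UNIV. \<Sum>b\<in>UNIV. hol_coeff a * cnj (hol_coeff b)
        * complex_of_real (B (real_frame \<alpha> a) (real_frame \<beta> b)))"

text \<open>\<open>T\<close> on the fields \<open>\<partial>\<^sub>\<alpha>\<close>, \<open>conj \<partial>\<^sub>\<beta>\<close>, \<open>\<partial>\<^sub>\<gamma>\<close>, \<open>conj \<partial>\<^sub>\<delta>\<close>.\<close>

definition component4 ::
  "((complex ^ 'n::finite) \<Rightarrow> (complex ^ 'n) \<Rightarrow> (complex ^ 'n) \<Rightarrow> (complex ^ 'n) \<Rightarrow> real)
     \<Rightarrow> 'n \<Rightarrow> 'n \<Rightarrow> 'n \<Rightarrow> 'n \<Rightarrow> complex" where
  "component4 T \<alpha> \<beta> \<gamma> \<delta> =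
     (\<Sum>a\<in>UNIV. \<Sum>b\<in>UNIV. \<Sum>c\<in>UNIV. \<Sum>d\<in>UNIV.
        hol_coeff a * cnj (hol_coeff b) * hol_coeff c * cnj (hol_coeff d)
        * complex_of_real
            (T (real_frame \<alpha> a) (real_frame \<beta> b) (real_frame \<gamma> c) (real_frame \<delta> d)))"

definition bochner_component ::
  "(complex ^ 'n::finite) metric_field \<Rightarrow> (complex ^ 'n) \<Rightarrow> 'n \<Rightarrow> 'n \<Rightarrow> 'n \<Rightarrow> 'n \<Rightarrow> complex" where
  "bochner_component h x \<alpha> \<beta> \<gamma> \<delta> =
     (let n = of_nat CARD('n);
          g = component2 (h x);
          \<rho> = component2 (ricci h x);
          \<tau> = complex_of_real (scalar_curvature h x)
      in component4 (curvature h x) \<alpha> \<beta> \<gamma> \<delta>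
         - 1 / (n + 2) * (g \<alpha> \<beta> * \<rho> \<gamma> \<delta> + g \<gamma> \<beta> * \<rho> \<alpha> \<delta> + g \<gamma> \<delta> * \<rho> \<alpha> \<beta> + g \<alpha> \<delta> * \<rho> \<gamma> \<beta>)
         + \<tau> / (2 * (n + 1) * (n + 2)) * (g \<alpha> \<beta> * g \<gamma> \<delta> + g \<gamma> \<beta> * g \<alpha> \<delta>))"


section \<open>Kaehler and Bochner-Kaehler metrics on submanifolds\<close>

text \<open>\<open>M\<close> is a real submanifold of a vector space \<open>'v\<close>. The metric \<open>g p\<close> and the almost complex
  structure \<open>J p\<close> are only relevant on tangent vectors at points \<open>p \<in> M\<close>. Local holomorphic
  coordinates are given by their inverses, the local parametrizations \<open>\<phi> : U \<rightarrow> M\<close>.\<close>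

definition hol_chart ::
  "'v::euclidean_space set \<Rightarrow> ('v \<Rightarrow> 'v \<Rightarrow> 'v) \<Rightarrow> (complex ^ 'n::finite) set
     \<Rightarrow> ((complex ^ 'n) \<Rightarrow> 'v) \<Rightarrow> bool" where
  "hol_chart M J U \<phi> \<longleftrightarrow>
     open U \<and> smooth_on U \<phi> \<and> openin (top_of_set M) (\<phi> ` U) \<and>
     (\<exists>\<psi>. homeomorphism U (\<phi> ` U) \<phi> \<psi>) \<and>
     (\<forall>x\<in>U. inj (frechet_derivative \<phi> (at x))) \<and>
     (\<forall>x\<in>U. \<forall>v. frechet_derivative \<phi> (at x) (\<i> *s v) = J (\<phi> x) (frechet_derivative \<phi> (at x) v))"

definition pullback_metric ::
  "((complex ^ 'n::finite) \<Rightarrow> 'v::euclidean_space) \<Rightarrow> ('v \<Rightarrow> 'v \<Rightarrow> 'v \<Rightarrow> real)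
     \<Rightarrow> (complex ^ 'n) metric_field" where
  "pullback_metric \<phi> g x u v =
     g (\<phi> x) (frechet_derivative \<phi> (at x) u) (frechet_derivative \<phi> (at x) v)"

text \<open>A Kaehler metric in holomorphic coordinates: a smooth positive definite Hermitian metric
  whose Levi-Civita connection satisfies \<open>\<nabla>J = 0\<close>. There \<open>J\<close> is multiplication by \<open>\<i>\<close>, and it
  suffices to test \<open>\<nabla>\<^sub>u (J v) = J (\<nabla>\<^sub>u v)\<close> on constant fields.\<close>

definition kaehler_in_coords ::
  "(complex ^ 'n::finite) set \<Rightarrow> (complex ^ 'n) metric_field \<Rightarrow> bool" where
  "kaehler_in_coords U h \<longleftrightarrow>
     (\<forall>u v. smooth_on U (\<lambda>x. h x u v)) \<and>
     (\<forall>x\<in>U. bilinear (h x) \<and> (\<forall>u v. h x u v = h x v u) \<and> (\<forall>u. u \<noteq> 0 \<longrightarrow> h x u u > 0) \<and>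
        (\<forall>u v. h x (\<i> *s u) (\<i> *s v) = h x u v) \<and>
        (\<forall>u v. cov_deriv h (\<lambda>_. u) (\<lambda>_. \<i> *s v) x = \<i> *s cov_deriv h (\<lambda>_. u) (\<lambda>_. v) x))"

text \<open>The first argument fixes the complex dimension. The first conjunct says that \<open>J\<close> is
  integrable.\<close>

definition kaehler ::
  "'n::finite itself \<Rightarrow> 'v::euclidean_space set \<Rightarrow> ('v \<Rightarrow> 'v \<Rightarrow> 'v \<Rightarrow> real)
     \<Rightarrow> ('v \<Rightarrow> 'v \<Rightarrow> 'v) \<Rightarrow> bool" where
  "kaehler N M g J \<longleftrightarrow>
     (\<forall>p\<in>M. \<exists>U (\<phi> :: (complex ^ 'n) \<Rightarrow> 'v). hol_chart M J U \<phi> \<and> p \<in> \<phi> ` U) \<and>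
     (\<forall>U (\<phi> :: (complex ^ 'n) \<Rightarrow> 'v). hol_chart M J U \<phi> \<longrightarrow>
        kaehler_in_coords U (pullback_metric \<phi> g))"

definition bochner_kaehler ::
  "'n::finite itself \<Rightarrow> 'v::euclidean_space set \<Rightarrow> ('v \<Rightarrow> 'v \<Rightarrow> 'v \<Rightarrow> real)
     \<Rightarrow> ('v \<Rightarrow> 'v \<Rightarrow> 'v) \<Rightarrow> bool" where
  "bochner_kaehler N M g J \<longleftrightarrow> kaehler N M g J \<and>
     (\<forall>U (\<phi> :: (complex ^ 'n) \<Rightarrow> 'v). hol_chart M J U \<phi> \<longrightarrow>
        (\<forall>x\<in>U. \<forall>\<alpha> \<beta> \<gamma> \<delta>. bochner_component (pullback_metric \<phi> g) x \<alpha> \<beta> \<gamma> \<delta> = 0))"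


section \<open>Rotational hypersurfaces in \<open>\<complex>\<^sup>n \<times> \<real>\<close>\<close>

text \<open>The point \<open>(z, a)\<close> stands for \<open>z + a e\<close> with \<open>e\<^sup>2 = -1\<close>. The inner product of
  \<open>complex ^ 'n\<close> is the real part of the Hermitian product.\<close>

type_synonym 'n ambient = "(complex ^ 'n) \<times> real"

definition ambient_metric :: "'n::finite ambient \<Rightarrow> 'n ambient \<Rightarrow> real" where
  "ambient_metric X Y = fst X \<bullet> fst Y - snd X * snd Y"

definition rot_point :: "(real \<Rightarrow> real) \<Rightarrow> (real \<Rightarrow> real) \<Rightarrow> real \<Rightarrow> complex ^ 'n::finite \<Rightarrow> 'n ambient"
  where "rot_point t q s n = (t s *\<^sub>R n, q s)"

definition rot_hypersurface ::
  "real set \<Rightarrow> (real \<Rightarrow> real) \<Rightarrow> (real \<Rightarrow> real) \<Rightarrow> 'n::finite ambient set" where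
  "rot_hypersurface I t q = {rot_point t q s n | s n. s \<in> I \<and> n \<in> sphere 0 1}"

text \<open>The parameters \<open>(s, n)\<close> of a point of the hypersurface; they are unique if \<open>t\<close> is positive
  and injective on \<open>I\<close>.\<close>

definition rot_params ::
  "real set \<Rightarrow> (real \<Rightarrow> real) \<Rightarrow> (real \<Rightarrow> real) \<Rightarrow> 'n::finite ambient \<Rightarrow> real \<times> (complex ^ 'n)" where
  "rot_params I t q = the_inv_into (I \<times> sphere 0 1) (\<lambda>(s, n). rot_point t q s n)"

definition rot_xi ::
  "real set \<Rightarrow> (real \<Rightarrow> real) \<Rightarrow> (real \<Rightarrow> real) \<Rightarrow> 'n::finite ambient \<Rightarrow> 'n ambient" where
  "rot_xi I t q Z =
     (case rot_params I t q Z of (s, n) \<Rightarrow> vector_derivative (\<lambda>\<sigma>. rot_point t q \<sigma> n) (at s))"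

definition rot_xi_tilde ::
  "real set \<Rightarrow> (real \<Rightarrow> real) \<Rightarrow> (real \<Rightarrow> real) \<Rightarrow> 'n::finite ambient \<Rightarrow> 'n ambient" where
  "rot_xi_tilde I t q Z = (case rot_params I t q Z of (s, n) \<Rightarrow> (\<i> *s n, 0))"

definition rot_eta ::
  "real set \<Rightarrow> (real \<Rightarrow> real) \<Rightarrow> (real \<Rightarrow> real) \<Rightarrow> 'n::finite ambient \<Rightarrow> 'n ambient \<Rightarrow> real" where
  "rot_eta I t q Z X = ambient_metric (rot_xi I t q Z) X"

definition rot_eta_tilde ::
  "real set \<Rightarrow> (real \<Rightarrow> real) \<Rightarrow> (real \<Rightarrow> real) \<Rightarrow> 'n::finite ambient \<Rightarrow> 'n ambient \<Rightarrow> real" where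
  "rot_eta_tilde I t q Z X = ambient_metric (rot_xi_tilde I t q Z) X"

text \<open>Varying \<open>n\<close> on the unit sphere gives the tangent vectors \<open>(w, 0)\<close> with \<open>w\<close> orthogonal
  to \<open>n\<close>.\<close>

definition rot_tangent_space ::
  "real set \<Rightarrow> (real \<Rightarrow> real) \<Rightarrow> (real \<Rightarrow> real) \<Rightarrow> 'n::finite ambient \<Rightarrow> 'n ambient set" where
  "rot_tangent_space I t q Z =
     {a *\<^sub>R rot_xi I t q Z + (w, 0) | a w. w \<bullet> snd (rot_params I t q Z) = 0}"

text \<open>The condition defining rotational hypersurfaces of type II.\<close>

definition timelike_normals ::
  "real set \<Rightarrow> (real \<Rightarrow> real) \<Rightarrow> (real \<Rightarrow> real) \<Rightarrow> 'n::finite ambient set \<Rightarrow> bool" where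
  "timelike_normals I t q M \<longleftrightarrow>
     (\<forall>Z\<in>M. \<forall>N. N \<noteq> 0 \<and> (\<forall>X\<in>rot_tangent_space I t q Z. ambient_metric N X = 0)
        \<longrightarrow> ambient_metric N N < 0)"

text \<open>In the natural parameter \<open>\<xi>\<close>, \<open>\<xi>'\<close> (for \<open>rot_xi\<close>, \<open>rot_xi_tilde\<close>) are orthonormal, so
  \<open>X - \<eta>(X) \<xi> - \<eta>'(X) \<xi>'\<close> is the component of a tangent vector \<open>X\<close> in \<open>D\<close>; as \<open>D\<close> lies in
  \<open>\<complex>\<^sup>n\<close>, \<open>J\<^sub>0\<close> acts on it by multiplication by \<open>\<i>\<close> of its first entry.\<close>

definition rot_proj_D ::
  "real set \<Rightarrow> (real \<Rightarrow> real) \<Rightarrow> (real \<Rightarrow> real) \<Rightarrow> 'n::finite ambient \<Rightarrow> 'n ambient \<Rightarrow> 'n ambient" where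
  "rot_proj_D I t q Z X =
     X - rot_eta I t q Z X *\<^sub>R rot_xi I t q Z - rot_eta_tilde I t q Z X *\<^sub>R rot_xi_tilde I t q Z"

definition rot_J ::
  "real set \<Rightarrow> (real \<Rightarrow> real) \<Rightarrow> (real \<Rightarrow> real) \<Rightarrow> 'n::finite ambient \<Rightarrow> 'n ambient \<Rightarrow> 'n ambient" where
  "rot_J I t q Z X =
     (\<i> *s fst (rot_proj_D I t q Z X), 0)
     + rot_eta I t q Z X *\<^sub>R rot_xi_tilde I t q Z - rot_eta_tilde I t q Z X *\<^sub>R rot_xi I t q Z"

definition rot_metric ::
  "real set \<Rightarrow> (real \<Rightarrow> real) \<Rightarrow> (real \<Rightarrow> real) \<Rightarrow> 'n::finite ambient \<Rightarrow> 'n ambient \<Rightarrow> 'n ambient \<Rightarrow> real"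
  where
  "rot_metric I t q Z X Y =
     ambient_metric X Y
     + (deriv t (fst (rot_params I t q Z)) - 1)
       * (rot_eta I t q Z X * rot_eta I t q Z Y + rot_eta_tilde I t q Z X * rot_eta_tilde I t q Z Y)"

end

(* In the holomorphic coordinate f(s) n, where f' = f/t, the metric g is U(n)-invariant with Kaehler
   potential depending only on rho = |f(s) n|^2; its momentum coordinate is x = t^2 and its momentum
   profile is rho dx/drho = x t'. Computing connection, curvature, Ricci tensor and scalar curvature
   in this chart, the Bochner tensor reduces to three radial coefficients, all of which vanish iff
   the profile y = t' as a function of x satisfies the Euler equation
   x^2 y'' - 2 x y' + 2 (y - 1) = 0, that is, y = c1 x^2 + c2 x + 1. An arbitrary holomorphic chart
   differs from this one by a map with complex linear invertible derivative, under which the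
   Levi-Civita connection, the curvature and its traces transform naturally. *)

theory Submission
  imports Defs
begin


section \<open>Smooth maps\<close>

text \<open>Curvature is defined on constant extensions of tangent vectors, and a nonlinear change
  of coordinates does not preserve constant fields. Naturality therefore has to be checked on
  formulas: the pulled back connection is the preimage under \<open>F'\<close> of F'' + \<Gamma>(F',
  F'), and the symmetry of the second and third derivatives of \<open>F\<close> removes every term
  that is not tensorial. As \<open>christoffel\<close> is a definite description, connections are
  handled as explicit maps that satisfy the Koszul identity. In the radial chart \<rho> d/d\<rho>
  acts as x y d/dx. With m = x y' and m2 = x y dm/dx all coefficients are rational functions of
  \<rho>, x, y, m, m2, and the Bochner condition becomes rational arithmetic. One of the three
  coefficients is a nonzero multiple of the defect in the Euler equation; a vector orthogonal to the
  point isolates it, and such a vector exists because n >= 2. The Euler exponents are 1 and 2, and y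
  = 1 is a particular solution.\<close>

lemma mvt_rectangle:
  fixes f :: "'a::real_normed_vector \<Rightarrow> real"
  assumes h: "h > 0"
    and S: "\<And>s t. 0 \<le> s \<Longrightarrow> s \<le> h \<Longrightarrow> 0 \<le> t \<Longrightarrow> t \<le> h \<Longrightarrow> x + s *\<^sub>R u + t *\<^sub>R v \<in> S"
    and f: "\<And>y. y \<in> S \<Longrightarrow> f differentiable (at y)"
    and f': "\<And>y. y \<in> S \<Longrightarrow> (\<lambda>y. frechet_derivative f (at y) u) differentiable (at y)"
  shows "\<exists>s t. 0 \<le> s \<and> s \<le> h \<and> 0 \<le> t \<and> t \<le> h \<and>
     f (x + h *\<^sub>R u + h *\<^sub>R v) - f (x + h *\<^sub>R u) - f (x + h *\<^sub>R v) + f x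
     = h\<^sup>2 * frechet_derivative (\<lambda>y. frechet_derivative f (at y) u) (at (x + s *\<^sub>R u + t *\<^sub>R v)) v"
proof -
  let ?P = "\<lambda>y. frechet_derivative f (at y) u"
  have df: "(f has_derivative frechet_derivative f (at y)) (at y)" if "y \<in> S" for y
    using f[OF that] by (simp add: frechet_derivative_works)
  have dP: "(?P has_derivative frechet_derivative ?P (at y)) (at y)" if "y \<in> S" for y
    using f'[OF that] frechet_derivative_works by blast
  have line: "((\<lambda>s. F (c + s *\<^sub>R w)) has_real_derivative F' w) (at s)"
    if "(F has_derivative F') (at (c + s *\<^sub>R w))" for F :: "'a \<Rightarrow> real" and F' c w s
  proof -
    interpret F': bounded_linear F' using that by (rule has_derivative_bounded_linear)
    have *: "((\<lambda>s. c + s *\<^sub>R w) has_derivative (\<lambda>r. r *\<^sub>R w)) (at s)"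
      by (auto intro!: derivative_eq_intros)
    show ?thesis
      using has_derivative_compose[OF * that]
      by (simp add: has_field_derivative_def F'.scaleR mult_commute_abs)
  qed
  \<comment> \<open>The second difference is the increment of \<open>?g\<close> over [0, h]; one
    mean value in the direction \<open>u\<close> and one in the direction \<open>v\<close> turn it
    into a mixed derivative.\<close>
  let ?g = "\<lambda>s. f (x + h *\<^sub>R v + s *\<^sub>R u) - f (x + s *\<^sub>R u)"
  have "(?g has_real_derivative (?P (x + h *\<^sub>R v + s *\<^sub>R u) - ?P (x + s *\<^sub>R u))) (at s)"
    if "0 \<le> s" "s \<le> h" for s
  proof -
    have "x + h *\<^sub>R v + s *\<^sub>R u \<in> S" using S[of s h] that h by (simp add: algebra_simps)
    moreover have "x + s *\<^sub>R u \<in> S" using S[of s 0] that h by simp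
    ultimately show ?thesis by (intro DERIV_diff line df)
  qed
  from MVT2[OF h this] obtain s where s: "0 < s" "s < h"
    and gs: "?g h - ?g 0 = (h - 0) * (?P (x + h *\<^sub>R v + s *\<^sub>R u) - ?P (x + s *\<^sub>R u))"
    by blast
  have "((\<lambda>t. ?P (x + s *\<^sub>R u + t *\<^sub>R v)) has_real_derivative
      frechet_derivative ?P (at (x + s *\<^sub>R u + t *\<^sub>R v)) v) (at t)"
    if "0 \<le> t" "t \<le> h" for t
    by (rule line, rule dP, rule S) (use s that in auto)
  from MVT2[OF h this] obtain t where t: "0 < t" "t < h"
    and ht: "?P (x + s *\<^sub>R u + h *\<^sub>R v) - ?P (x + s *\<^sub>R u + 0 *\<^sub>R v)
      = (h - 0) * frechet_derivative ?P (at (x + s *\<^sub>R u + t *\<^sub>R v)) v" by blast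
  have "?g h - ?g 0 = h\<^sup>2 * frechet_derivative ?P (at (x + s *\<^sub>R u + t *\<^sub>R v)) v"
    using gs ht by (simp add: add.commute add.left_commute power2_eq_square)
  then show ?thesis using s t
    by (intro exI[of _ s] exI[of _ t]) (simp add: algebra_simps)
qed

text \<open>The second difference over a small parallelogram does not depend on the order of
  \<open>u\<close> and \<open>v\<close>, yet it is h^2 times either mixed derivative at a nearby
  point. Continuity leaves no room for a gap.\<close>

lemma second_derivative_symmetric_real:
  fixes f :: "'a::real_normed_vector \<Rightarrow> real"
  assumes "open S" "x \<in> S"
    and f: "\<And>y. y \<in> S \<Longrightarrow> f differentiable (at y)"
    and f': "\<And>y w. y \<in> S \<Longrightarrow> (\<lambda>y. frechet_derivative f (at y) w) differentiable (at y)"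
    and f'': "\<And>w w'. continuous_on S (\<lambda>y. frechet_derivative (\<lambda>y. frechet_derivative f (at y) w) (at y) w')"
  shows "frechet_derivative (\<lambda>y. frechet_derivative f (at y) u) (at x) v
       = frechet_derivative (\<lambda>y. frechet_derivative f (at y) v) (at x) u"
proof (rule ccontr)
  let ?D = "\<lambda>u v y. frechet_derivative (\<lambda>y. frechet_derivative f (at y) u) (at y) v"
  assume ne: "?D u v x \<noteq> ?D v u x"
  \<comment> \<open>Each mixed derivative will move by less than half the gap, so the two values
    cannot meet.\<close>
  define e where "e = \<bar>?D u v x - ?D v u x\<bar> / 2"
  have e: "e > 0" using ne by (simp add: e_def)
  have c: "isCont (?D w w') x" for w w'
    using f''[of w w'] assms(1,2) by (simp add: continuous_on_eq_continuous_at)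
  obtain d1 where d1: "d1 > 0" "\<And>y. dist y x < d1 \<Longrightarrow> dist (?D u v y) (?D u v x) < e"
    using c[of u v] e unfolding continuous_at_eps_delta by blast
  obtain d2 where d2: "d2 > 0" "\<And>y. dist y x < d2 \<Longrightarrow> dist (?D v u y) (?D v u x) < e"
    using c[of v u] e unfolding continuous_at_eps_delta by blast
  obtain d3 where d3: "d3 > 0" "ball x d3 \<subseteq> S"
    using assms(1,2) open_contains_ball by blast
  define d where "d = min d1 (min d2 d3)"
  have d: "d > 0" using d1 d2 d3 by (simp add: d_def)
  \<comment> \<open>Keeps the parallelogram within d/2 of \<open>x\<close>; the summand 1 covers u =
    v = 0.\<close>
  define h where "h = d / (2 * (norm u + norm v + 1))"
  have h: "h > 0" using d by (simp add: h_def add_nonneg_pos)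
  have near: "dist (x + s *\<^sub>R u + t *\<^sub>R v) x < d" if "0 \<le> s" "s \<le> h" "0 \<le> t" "t \<le> h" for s t
  proof -
    have "dist (x + s *\<^sub>R u + t *\<^sub>R v) x \<le> norm (s *\<^sub>R u) + norm (t *\<^sub>R v)"
      by (simp add: dist_norm algebra_simps) (metis norm_triangle_ineq norm_scaleR)
    also have "\<dots> \<le> h * norm u + h * norm v"
      using that by (intro add_mono) (auto intro: mult_right_mono)
    also have "\<dots> \<le> h * (norm u + norm v + 1)" using h by (simp add: algebra_simps)
    also have "\<dots> = d / 2"
    proof -
      have "norm u + norm v + 1 \<noteq> 0" by (smt (verit) norm_ge_zero)
      then show ?thesis unfolding h_def by (simp add: field_simps)
    qed
    also have "\<dots> < d" using d by simp
    finally show ?thesis .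
  qed
  have inS: "x + s *\<^sub>R u + t *\<^sub>R v \<in> S" if "0 \<le> s" "s \<le> h" "0 \<le> t" "t \<le> h" for s t
    using near[OF that] d3 by (auto simp: d_def dist_commute subset_iff)
  obtain s t where st: "0 \<le> s" "s \<le> h" "0 \<le> t" "t \<le> h"
    "f (x + h *\<^sub>R u + h *\<^sub>R v) - f (x + h *\<^sub>R u) - f (x + h *\<^sub>R v) + f x = h\<^sup>2 * ?D u v (x + s *\<^sub>R u + t *\<^sub>R v)"
    using mvt_rectangle[of h x u v S f, OF h inS f f'] by blast
  obtain s' t' where st': "0 \<le> s'" "s' \<le> h" "0 \<le> t'" "t' \<le> h"
    "f (x + h *\<^sub>R v + h *\<^sub>R u) - f (x + h *\<^sub>R v) - f (x + h *\<^sub>R u) + f x = h\<^sup>2 * ?D v u (x + s' *\<^sub>R v + t' *\<^sub>R u)"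
  proof -
    have "x + s *\<^sub>R v + t *\<^sub>R u \<in> S" if "0 \<le> s" "s \<le> h" "0 \<le> t" "t \<le> h" for s t
      using inS[of t s] that by (simp add: algebra_simps)
    then show thesis using mvt_rectangle[of h x v u S f, OF h _ f f'] that by blast
  qed
  have "h\<^sup>2 * ?D u v (x + s *\<^sub>R u + t *\<^sub>R v) = h\<^sup>2 * ?D v u (x + t' *\<^sub>R u + s' *\<^sub>R v)"
    using st(5) st'(5) by (simp add: algebra_simps)
  then have eq: "?D u v (x + s *\<^sub>R u + t *\<^sub>R v) = ?D v u (x + t' *\<^sub>R u + s' *\<^sub>R v)"
    using h by simp
  have "dist (?D u v (x + s *\<^sub>R u + t *\<^sub>R v)) (?D u v x) < e"
    by (rule d1) (use near[OF st(1-4)] in \<open>simp add: d_def\<close>)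
  moreover have "dist (?D v u (x + t' *\<^sub>R u + s' *\<^sub>R v)) (?D v u x) < e"
    by (rule d2) (use near[OF st'(3,4,1,2)] in \<open>simp add: d_def\<close>)
  ultimately show False using eq unfolding e_def dist_real_def by (smt (verit) field_sum_of_halves)
qed

section \<open>Closure properties of differentiability of order k and of smoothness\<close>

lemma higher_differentiable_on_cong:
  assumes "open S" "\<And>x. x \<in> S \<Longrightarrow> f x = g x"
  shows "higher_differentiable_on S f k \<longleftrightarrow> higher_differentiable_on S g k"
  using assms(2)
proof (induction k arbitrary: f g)
  case 0
  then show ?case by (auto intro: continuous_on_eq)
next
  case (Suc k)
  have d: "f differentiable (at x) \<longleftrightarrow> g differentiable (at x)" if "x \<in> S" for x
    using has_derivative_transform_within_open[OF _ assms(1) that] Suc.prems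
    unfolding differentiable_def by (metis (no_types, lifting))
  show ?case
  \<comment> \<open>\<open>frechet_derivative\<close> is unspecified where \<open>f\<close> is not
    differentiable, but then both sides are false.\<close>
  proof (cases "\<forall>x\<in>S. f differentiable (at x)")
    case True
    have "frechet_derivative f (at x) v = frechet_derivative g (at x) v" if "x \<in> S" for x v
      using frechet_derivative_transform_within_open[of f x S g] True Suc.prems assms(1) that by metis
    then have "higher_differentiable_on S (\<lambda>x. frechet_derivative f (at x) v) k
      \<longleftrightarrow> higher_differentiable_on S (\<lambda>x. frechet_derivative g (at x) v) k" for v
      by (intro Suc.IH) auto
    then show ?thesis using d by simp
  next
    case False
    then show ?thesis using d by auto
  qed
qed

text \<open>Way into the recursive definition with a derivative in closed form, so that the closure
  properties can apply their induction hypotheses to that form.\<close>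

lemma higher_differentiable_on_SucI:
  assumes "open S" "\<And>x. x \<in> S \<Longrightarrow> (f has_derivative f' x) (at x)"
    and "\<And>v. higher_differentiable_on S (\<lambda>x. f' x v) k"
  shows "higher_differentiable_on S f (Suc k)"
proof -
  have "frechet_derivative f (at x) v = f' x v" if "x \<in> S" for x v
    using frechet_derivative_at[OF assms(2)[OF that]] by simp
  then have "higher_differentiable_on S (\<lambda>x. frechet_derivative f (at x) v) k" for v
    by (subst higher_differentiable_on_cong[OF assms(1), where g = "\<lambda>x. f' x v"]) (simp_all add: assms(3))
  then show ?thesis using assms(2) by (auto simp: differentiable_def)
qed

text \<open>Product and chain rules leave one factor undifferentiated; its order has to be lowered
  by one in the inductions below.\<close>

lemma higher_differentiable_on_Suc_D:
  "higher_differentiable_on S f (Suc k) \<Longrightarrow> higher_differentiable_on S f k"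
proof (induction k arbitrary: f)
  case 0
  then show ?case
    by (auto intro!: continuous_at_imp_continuous_on differentiable_imp_continuous_within)
next
  case (Suc k)
  then show ?case by (metis higher_differentiable_on.simps(2))
qed

lemma higher_differentiable_on_has_derivative:
  assumes "higher_differentiable_on S f (Suc k)" "x \<in> S"
  shows "(f has_derivative frechet_derivative f (at x)) (at x)"
  using assms frechet_derivative_works by auto

lemma smooth_on_differentiable: "smooth_on S f \<Longrightarrow> x \<in> S \<Longrightarrow> f differentiable (at x)"
  unfolding smooth_on_def by (metis higher_differentiable_on.simps(2))

lemma smooth_on_has_derivative:
  "smooth_on S f \<Longrightarrow> x \<in> S \<Longrightarrow> (f has_derivative frechet_derivative f (at x)) (at x)"
  using smooth_on_differentiable frechet_derivative_works by blast

lemma smooth_on_frechet_derivative: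
  "smooth_on S f \<Longrightarrow> smooth_on S (\<lambda>x. frechet_derivative f (at x) v)"
  unfolding smooth_on_def by (metis higher_differentiable_on.simps(2))

lemma smooth_on_continuous_on: "smooth_on S f \<Longrightarrow> continuous_on S f"
  unfolding smooth_on_def by (metis higher_differentiable_on.simps(1))

lemma smooth_on_cong:
  assumes "open S" "\<And>x. x \<in> S \<Longrightarrow> f x = g x"
  shows "smooth_on S f \<longleftrightarrow> smooth_on S g"
  unfolding smooth_on_def by (intro iff_allI higher_differentiable_on_cong assms)

lemma higher_differentiable_on_const:
  "open S \<Longrightarrow> higher_differentiable_on S (\<lambda>_. c) k"
proof (induction k arbitrary: c)
  case (Suc k)
  then show ?case by (intro higher_differentiable_on_SucI[where f' = "\<lambda>_ _. 0"]) auto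
qed auto

lemma higher_differentiable_on_linear:
  assumes "open S" "bounded_linear L" "higher_differentiable_on S f k"
  shows "higher_differentiable_on S (\<lambda>x. L (f x)) k"
  using assms(3)
proof (induction k arbitrary: f)
  case 0
  then show ?case using assms(2) linear_continuous_on_compose bounded_linear.continuous_on by auto
next
  case (Suc k)
  show ?case
    by (rule higher_differentiable_on_SucI[where f' = "\<lambda>x v. L (frechet_derivative f (at x) v)", OF assms(1)])
      (use Suc in \<open>auto intro!: bounded_linear.has_derivative[OF assms(2)] higher_differentiable_on_has_derivative\<close>)
qed

lemma higher_differentiable_on_add:
  assumes "open S" "higher_differentiable_on S f k" "higher_differentiable_on S g k"
  shows "higher_differentiable_on S (\<lambda>x. f x + g x) k"
  using assms(2,3)
proof (induction k arbitrary: f g)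
  case 0
  then show ?case by (auto intro: continuous_intros)
next
  case (Suc k)
  show ?case
    by (rule higher_differentiable_on_SucI[where f' = "\<lambda>x v. frechet_derivative f (at x) v + frechet_derivative g (at x) v", OF assms(1)])
      (use Suc in \<open>auto intro!: has_derivative_add higher_differentiable_on_has_derivative\<close>)
qed

lemma higher_differentiable_on_bilinear:
  assumes "open S" "bounded_bilinear B" "higher_differentiable_on S f k" "higher_differentiable_on S g k"
  shows "higher_differentiable_on S (\<lambda>x. B (f x) (g x)) k"
  using assms(3,4)
proof (induction k arbitrary: f g)
  case 0
  then show ?case using bounded_bilinear.continuous_on[OF assms(2)] by auto
next
  case (Suc k)
  show ?case
  proof (rule higher_differentiable_on_SucI[where f' = "\<lambda>x v. B (f x) (frechet_derivative g (at x) v) + B (frechet_derivative f (at x) v) (g x)", OF assms(1)])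
    fix x assume "x \<in> S"
    then show "((\<lambda>x. B (f x) (g x)) has_derivative (\<lambda>v. B (f x) (frechet_derivative g (at x) v) + B (frechet_derivative f (at x) v) (g x))) (at x)"
      using Suc.prems by (intro bounded_bilinear.FDERIV[OF assms(2)] higher_differentiable_on_has_derivative)
  next
    fix v
    show "higher_differentiable_on S (\<lambda>x. B (f x) (frechet_derivative g (at x) v) + B (frechet_derivative f (at x) v) (g x)) k"
      by (intro higher_differentiable_on_add assms(1) Suc.IH)
        (use Suc.prems higher_differentiable_on_Suc_D in auto)
  qed
qed

text \<open>The inner map is scalar because the outer functions depend on \<open>s\<close>, on
  \<rho> or on a squared norm. The chain rule then yields a scalar multiple, to which the bilinear
  case applies.\<close>

lemma higher_differentiable_on_compose_real:
  fixes g :: "real \<Rightarrow> 'b::real_normed_vector" and f :: "'a::real_normed_vector \<Rightarrow> real"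
  assumes "open S" "higher_differentiable_on T g k" "higher_differentiable_on S f k" "f ` S \<subseteq> T"
  shows "higher_differentiable_on S (\<lambda>x. g (f x)) k"
  using assms(2,3)
proof (induction k arbitrary: g)
  case 0
  then show ?case using assms(4) by (auto intro: continuous_on_compose2)
next
  case (Suc k)
  show ?case
  proof (rule higher_differentiable_on_SucI[where f' = "\<lambda>x v. frechet_derivative f (at x) v *\<^sub>R frechet_derivative g (at (f x)) 1", OF assms(1)])
    fix x assume x: "x \<in> S"
    then have g: "(g has_derivative frechet_derivative g (at (f x))) (at (f x))"
      using Suc.prems assms(4) by (intro higher_differentiable_on_has_derivative) auto
    \<comment> \<open>A linear map on the reals is determined by its value at 1.\<close>
    have eq: "frechet_derivative g (at (f x)) c = c *\<^sub>R frechet_derivative g (at (f x)) 1" for c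
      using linear_scale[OF has_derivative_linear[OF g], of c 1] by simp
    show "((\<lambda>x. g (f x)) has_derivative (\<lambda>v. frechet_derivative f (at x) v *\<^sub>R frechet_derivative g (at (f x)) 1)) (at x)"
      using has_derivative_compose[OF higher_differentiable_on_has_derivative[OF Suc.prems(2) x] g]
      by (subst (asm) eq)
  next
    fix v
    show "higher_differentiable_on S (\<lambda>x. frechet_derivative f (at x) v *\<^sub>R frechet_derivative g (at (f x)) 1) k"
      by (intro higher_differentiable_on_bilinear[OF assms(1) bounded_bilinear_scaleR] Suc.IH)
        (use Suc.prems higher_differentiable_on_Suc_D in auto)
  qed
qed

lemma smooth_on_const: "open S \<Longrightarrow> smooth_on S (\<lambda>_. c)"
  by (simp add: smooth_on_def higher_differentiable_on_const)

lemma smooth_on_linear: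
  "open S \<Longrightarrow> bounded_linear L \<Longrightarrow> smooth_on S f \<Longrightarrow> smooth_on S (\<lambda>x. L (f x))"
  by (simp add: smooth_on_def higher_differentiable_on_linear)

lemma smooth_on_id: 
  assumes "open S" shows "smooth_on S (\<lambda>x. x)"
  unfolding smooth_on_def
proof
  show "higher_differentiable_on S (\<lambda>x. x) k" for k
  proof (cases k)
    case (Suc j)
    then show ?thesis
      using assms by (auto intro!: higher_differentiable_on_SucI[where f' = "\<lambda>_ v. v"] higher_differentiable_on_const)
  qed auto
qed

lemma smooth_on_add:
  "open S \<Longrightarrow> smooth_on S f \<Longrightarrow> smooth_on S g \<Longrightarrow> smooth_on S (\<lambda>x. f x + g x)"
  by (simp add: smooth_on_def higher_differentiable_on_add)

lemma smooth_on_uminus: "open S \<Longrightarrow> smooth_on S f \<Longrightarrow> smooth_on S (\<lambda>x. - f x)"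
  by (rule smooth_on_linear[OF _ bounded_linear_minus[OF bounded_linear_ident]])

lemma smooth_on_diff:
  "open S \<Longrightarrow> smooth_on S f \<Longrightarrow> smooth_on S g \<Longrightarrow> smooth_on S (\<lambda>x. f x - g x)"
  using smooth_on_add[of S f "\<lambda>x. - g x"] smooth_on_uminus by auto

lemma smooth_on_bilinear:
  "open S \<Longrightarrow> bounded_bilinear B \<Longrightarrow> smooth_on S f \<Longrightarrow> smooth_on S g
    \<Longrightarrow> smooth_on S (\<lambda>x. B (f x) (g x))"
  by (simp add: smooth_on_def higher_differentiable_on_bilinear)

lemmas smooth_on_scaleR = smooth_on_bilinear[OF _ bounded_bilinear_scaleR]
lemmas smooth_on_inner = smooth_on_bilinear[OF _ bounded_bilinear_inner]

lemma smooth_on_mult: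
  fixes f g :: "'a::real_normed_vector \<Rightarrow> 'b::real_normed_algebra"
  shows "open S \<Longrightarrow> smooth_on S f \<Longrightarrow> smooth_on S g \<Longrightarrow> smooth_on S (\<lambda>x. f x * g x)"
  by (rule smooth_on_bilinear[OF _ bounded_bilinear_mult])

lemma smooth_on_compose_real:
  fixes g :: "real \<Rightarrow> 'b::real_normed_vector" and f :: "'a::real_normed_vector \<Rightarrow> real"
  assumes "open S" "smooth_on T g" "smooth_on S f" "\<And>x. x \<in> S \<Longrightarrow> f x \<in> T"
  shows "smooth_on S (\<lambda>x. g (f x))"
  using assms higher_differentiable_on_compose_real[of S T g _ f]
  by (auto simp: smooth_on_def image_subset_iff)

section \<open>Smoothness of solutions of ordinary differential equations, quotients and
  pairs\<close>

lemma higher_differentiable_on_real_SucI: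
  fixes f :: "real \<Rightarrow> real"
  assumes "open S" "\<And>x. x \<in> S \<Longrightarrow> (f has_real_derivative f' x) (at x)"
    and "higher_differentiable_on S f' k"
  shows "higher_differentiable_on S f (Suc k)"
proof (rule higher_differentiable_on_SucI[where f' = "\<lambda>x v. f' x * v", OF assms(1)])
  show "(f has_derivative (*) (f' x)) (at x)" if "x \<in> S" for x
    using assms(2)[OF that] by (simp add: has_field_derivative_def)
  show "higher_differentiable_on S (\<lambda>x. f' x * v) k" for v
    by (intro higher_differentiable_on_bilinear[OF assms(1) bounded_bilinear_mult] higher_differentiable_on_const assms)
qed

lemma smooth_on_deriv:
  fixes f :: "real \<Rightarrow> real"
  assumes "open S" "smooth_on S f"
  shows "smooth_on S (deriv f)"
proof -
  have "frechet_derivative f (at x) 1 = deriv f x" if "x \<in> S" for x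
  proof -
    have "(f has_real_derivative deriv f x) (at x)"
      using smooth_on_differentiable[OF assms(2) that] DERIV_deriv_iff_real_differentiable by blast
    then have "(*) (deriv f x) = frechet_derivative f (at x)"
      unfolding has_field_derivative_def by (rule frechet_derivative_at)
    then show ?thesis by (metis mult.right_neutral)
  qed
  from smooth_on_cong[OF assms(1) this] show ?thesis
    using smooth_on_frechet_derivative[OF assms(2), of 1] by simp
qed

lemma smooth_on_has_deriv:
  fixes f :: "real \<Rightarrow> real"
  assumes "smooth_on S f" "x \<in> S"
  shows "(f has_real_derivative deriv f x) (at x)"
  using smooth_on_differentiable[OF assms] DERIV_deriv_iff_real_differentiable by blast

text \<open>Bootstrapping: each order of differentiability of \<open>\<sigma>\<close> is inherited by \<open>k \<circ> \<sigma>\<close>, hence by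
  \<open>\<sigma>'\<close>.\<close>

lemma smooth_on_autonomous_ode:
  fixes \<sigma> k :: "real \<Rightarrow> real"
  assumes "open S" "smooth_on T k" "\<And>x. x \<in> S \<Longrightarrow> \<sigma> x \<in> T"
    and "\<And>x. x \<in> S \<Longrightarrow> (\<sigma> has_real_derivative k (\<sigma> x)) (at x)"
  shows "smooth_on S \<sigma>"
  unfolding smooth_on_def
proof
  show "higher_differentiable_on S \<sigma> j" for j
  proof (induction j)
    case 0
    have "continuous_on S \<sigma>"
      using assms(4) by (intro continuous_at_imp_continuous_on) (auto intro: DERIV_isCont)
    then show ?case by simp
  next
    case (Suc j)
    show ?case
      by (intro higher_differentiable_on_real_SucI[OF assms(1,4)]
          higher_differentiable_on_compose_real[OF assms(1) _ Suc, of T])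
        (use assms in \<open>auto simp: smooth_on_def\<close>)
  qed
qed

text \<open>The product with \<open>k\<close> inherits the order of \<open>f\<close>, so the order
  of \<open>f\<close> grows by one at each step. The radius of a meridian is such a solution, with
  coefficient 1/t.\<close>

lemma smooth_on_linear_ode:
  fixes f k :: "real \<Rightarrow> real"
  assumes "open S" "smooth_on S k" "\<And>x. x \<in> S \<Longrightarrow> (f has_real_derivative k x * f x) (at x)"
  shows "smooth_on S f"
  unfolding smooth_on_def
proof
  show "higher_differentiable_on S f j" for j
  proof (induction j)
    case 0
    have "continuous_on S f"
      using assms(3) by (intro continuous_at_imp_continuous_on) (auto intro: DERIV_isCont)
    then show ?case by simp
  next
    case (Suc j)
    show ?case
      by (rule higher_differentiable_on_real_SucI[OF assms(1,3)], assumption)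
        (rule higher_differentiable_on_bilinear[OF assms(1) bounded_bilinear_mult _ Suc],
          use assms in \<open>auto simp: smooth_on_def\<close>)
  qed
qed

text \<open>The reciprocal solves y' = - y^2, which brings it under the bootstrapping for autonomous
  equations.\<close>

lemma smooth_on_inverse_real: "smooth_on ({x. x \<noteq> 0} :: real set) inverse"
proof (rule smooth_on_autonomous_ode[where T = UNIV and k = "\<lambda>y. - (y * y)"])
  show "open ({x. x \<noteq> 0} :: real set)" by (simp add: open_Collect_neq)
  show "smooth_on UNIV (\<lambda>y::real. - (y * y))"
    by (intro smooth_on_uminus smooth_on_mult smooth_on_id) auto
qed (auto intro!: derivative_eq_intros simp: divide_inverse)

lemma smooth_on_divide:
  fixes f g :: "'a::real_normed_vector \<Rightarrow> real"
  assumes "open S" "smooth_on S f" "smooth_on S g" "\<And>x. x \<in> S \<Longrightarrow> g x \<noteq> 0"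
  shows "smooth_on S (\<lambda>x. f x / g x)"
  unfolding divide_inverse
  by (intro smooth_on_mult smooth_on_compose_real[OF _ smooth_on_inverse_real]) (use assms in auto)

lemma smooth_on_Pair:
  assumes "open S" "smooth_on S f" "smooth_on S g"
  shows "smooth_on S (\<lambda>x. (f x, g x))"
proof -
  have "smooth_on S (\<lambda>x. (f x, 0) + (0, g x))"
    by (intro smooth_on_add smooth_on_linear[where f = f and L = "\<lambda>y. (y, 0)"]
        smooth_on_linear[where f = g and L = "\<lambda>y. (0, y)"] assms)
      (auto intro!: bounded_linear_Pair bounded_linear_zero bounded_linear_ident)
  then show ?thesis by simp
qed

text \<open>Pairing with a fixed vector commutes with differentiation, so the real-valued case
  applies to each pairing, and the pairings determine a vector.\<close>

lemma second_derivative_symmetric: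
  fixes f :: "'a::real_normed_vector \<Rightarrow> 'b::real_inner"
  assumes "open S" "x \<in> S" "smooth_on S f"
  shows "frechet_derivative (\<lambda>y. frechet_derivative f (at y) u) (at x) v
       = frechet_derivative (\<lambda>y. frechet_derivative f (at y) v) (at x) u"
    (is "?L = ?R")
proof -
  have "?L \<bullet> c = ?R \<bullet> c" for c
  proof -
    let ?f = "\<lambda>y. f y \<bullet> c"
    have lin: "bounded_linear (\<lambda>z. z \<bullet> c)" by (rule bounded_linear_inner_left)
    have sm: "smooth_on S ?f" by (rule smooth_on_linear[OF assms(1) lin assms(3)])
    have push: "frechet_derivative (\<lambda>y. g y \<bullet> c) (at y) w = frechet_derivative g (at y) w \<bullet> c"
      if "smooth_on S g" "y \<in> S" for g :: "'a \<Rightarrow> 'b" and y w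
      using frechet_derivative_at[OF bounded_linear.has_derivative[OF lin smooth_on_has_derivative[OF that]], symmetric]
      by simp
    have push2: "frechet_derivative (\<lambda>y. frechet_derivative ?f (at y) u) (at x) w
        = frechet_derivative (\<lambda>y. frechet_derivative f (at y) u) (at x) w \<bullet> c" for u w
    proof -
      have "frechet_derivative (\<lambda>y. frechet_derivative f (at y) u \<bullet> c) (at x)
        = frechet_derivative (\<lambda>y. frechet_derivative ?f (at y) u) (at x)"
        by (rule frechet_derivative_transform_within_open[OF _ assms(1,2)])
          (use push[OF assms(3)] smooth_on_differentiable[OF smooth_on_linear[OF assms(1) lin smooth_on_frechet_derivative[OF assms(3)]] assms(2)] in auto)
      then show ?thesis
        unfolding push[OF smooth_on_frechet_derivative[OF assms(3)] assms(2), symmetric] by (rule fun_cong[OF sym])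
    qed
    have "frechet_derivative (\<lambda>y. frechet_derivative ?f (at y) u) (at x) v
       = frechet_derivative (\<lambda>y. frechet_derivative ?f (at y) v) (at x) u"
      by (rule second_derivative_symmetric_real[OF assms(1,2)])
        (intro smooth_on_differentiable[where S = S] smooth_on_continuous_on smooth_on_frechet_derivative sm; assumption)+
    then show ?thesis unfolding push2 .
  qed
  then show ?thesis by (metis vector_eq_ldot inner_commute)
qed


section \<open>Levi-Civita connections and pullbacks\<close>

lemma bilinear_euclidean_expand:
  fixes B :: "'a::euclidean_space \<Rightarrow> 'b::euclidean_space \<Rightarrow> 'c::real_vector"
  assumes "bilinear B"
  shows "B v w = (\<Sum>i\<in>Basis. \<Sum>j\<in>Basis. ((v \<bullet> i) * (w \<bullet> j)) *\<^sub>R B i j)"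
proof -
  have l: "linear (\<lambda>v. B v w)" "linear (B v)" for v w
    using assms by (auto simp: bilinear_def)
  have "B v w = B (\<Sum>i\<in>Basis. (v \<bullet> i) *\<^sub>R i) w" by (simp add: euclidean_representation)
  also have "\<dots> = (\<Sum>i\<in>Basis. (v \<bullet> i) *\<^sub>R B i w)"
    by (simp only: linear_sum[OF l(1)] linear_scale[OF l(1)])
  also have "\<dots> = (\<Sum>i\<in>Basis. (v \<bullet> i) *\<^sub>R B i (\<Sum>j\<in>Basis. (w \<bullet> j) *\<^sub>R j))"
    by (simp add: euclidean_representation)
  also have "\<dots> = (\<Sum>i\<in>Basis. \<Sum>j\<in>Basis. ((v \<bullet> i) * (w \<bullet> j)) *\<^sub>R B i j)"
    by (simp only: linear_sum[OF l(2)] linear_scale[OF l(2)] scaleR_sum_right scaleR_scaleR)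
  finally show ?thesis .
qed

text \<open>Product rule with three moving entries. Expansion in a basis reduces it to the finitely
  many coefficients \<open>B y i j\<close>, so that differentiability is asked of single values only
  and no norm on bilinear maps enters.\<close>

lemma has_derivative_bilinear_field:
  fixes B :: "'a::real_normed_vector \<Rightarrow> 'b::euclidean_space \<Rightarrow> 'c::euclidean_space \<Rightarrow> 'd::real_normed_vector"
    and x :: "'e::real_normed_vector"
  assumes T: "open T" "F x \<in> T"
    and bil: "\<And>y. y \<in> T \<Longrightarrow> bilinear (B y)"
    and diff: "\<And>u v. (\<lambda>y. B y u v) differentiable (at (F x))"
    and F: "(F has_derivative F') (at x)"
    and v: "(v has_derivative v') (at x)"
    and w: "(w has_derivative w') (at x)"
  shows "((\<lambda>x. B (F x) (v x) (w x)) has_derivative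
    (\<lambda>d. frechet_derivative (\<lambda>y. B y (v x) (w x)) (at (F x)) (F' d) + B (F x) (v' d) (w x) + B (F x) (v x) (w' d))) (at x)"
proof -
  let ?D = "\<lambda>i j. frechet_derivative (\<lambda>y. B y i j) (at (F x))"
  have D: "((\<lambda>y. B y i j) has_derivative ?D i j) (at (F x))" for i j
    using diff frechet_derivative_works by blast
  note e = bilinear_euclidean_expand[OF bil]
  \<comment> \<open>Bilinearity holds only on \<open>T\<close>, hence the expansion only near
    \<open>x\<close>.\<close>
  have ev: "eventually (\<lambda>x. F x \<in> T) (at x)"
    using T has_derivative_continuous[OF F] by (auto simp: continuous_at intro: topological_tendstoD)
  have "((\<lambda>x. \<Sum>i\<in>Basis. \<Sum>j\<in>Basis. ((v x \<bullet> i) * (w x \<bullet> j)) *\<^sub>R B (F x) i j) has_derivative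
     (\<lambda>d. \<Sum>i\<in>Basis. \<Sum>j\<in>Basis. ((v x \<bullet> i) * (w x \<bullet> j)) *\<^sub>R ?D i j (F' d)
        + ((v x \<bullet> i) * (w' d \<bullet> j) + (v' d \<bullet> i) * (w x \<bullet> j)) *\<^sub>R B (F x) i j)) (at x)"
    by (intro has_derivative_sum has_derivative_scaleR has_derivative_mult
        has_derivative_inner_left v w has_derivative_compose[OF F D])
  then have "((\<lambda>x. B (F x) (v x) (w x)) has_derivative
     (\<lambda>d. \<Sum>i\<in>Basis. \<Sum>j\<in>Basis. ((v x \<bullet> i) * (w x \<bullet> j)) *\<^sub>R ?D i j (F' d)
        + ((v x \<bullet> i) * (w' d \<bullet> j) + (v' d \<bullet> i) * (w x \<bullet> j)) *\<^sub>R B (F x) i j)) (at x)"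
    by (rule has_derivative_transform_eventually) (use ev T in \<open>auto simp: e[symmetric] elim!: eventually_mono\<close>)
  moreover have "(\<Sum>i\<in>Basis. \<Sum>j\<in>Basis. ((v x \<bullet> i) * (w x \<bullet> j)) *\<^sub>R ?D i j (F' d)
        + ((v x \<bullet> i) * (w' d \<bullet> j) + (v' d \<bullet> i) * (w x \<bullet> j)) *\<^sub>R B (F x) i j)
     = frechet_derivative (\<lambda>y. B y (v x) (w x)) (at (F x)) (F' d) + B (F x) (v' d) (w x) + B (F x) (v x) (w' d)" for d
  proof -
    have "((\<lambda>y. \<Sum>i\<in>Basis. \<Sum>j\<in>Basis. ((v x \<bullet> i) * (w x \<bullet> j)) *\<^sub>R B y i j) has_derivative
      (\<lambda>d. \<Sum>i\<in>Basis. \<Sum>j\<in>Basis. ((v x \<bullet> i) * (w x \<bullet> j)) *\<^sub>R ?D i j d)) (at (F x))"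
      by (intro has_derivative_sum has_derivative_scaleR_right D)
    then have "((\<lambda>y. B y (v x) (w x)) has_derivative
      (\<lambda>d. \<Sum>i\<in>Basis. \<Sum>j\<in>Basis. ((v x \<bullet> i) * (w x \<bullet> j)) *\<^sub>R ?D i j d)) (at (F x))"
      by (rule has_derivative_transform_within_open[OF _ T]) (simp add: e[symmetric])
    from frechet_derivative_at[OF this, symmetric]
    show ?thesis
      by (simp only: e[OF T(2), of "v' d"] e[OF T(2), of "v x" "w' d"] scaleR_add_left sum.distrib)
        (simp add: add_ac)
  qed
  ultimately show ?thesis by simp
qed

text \<open>With \<open>k x = G x - L x (W x\<^sub>0)\<close> one has \<open>L x (W x - W x\<^sub>0) = k x\<close>, so the increment of \<open>W\<close> is
  \<open>L x\<^sub>0\<^sup>-\<^sup>1 (k x)\<close> up to a quadratic error.\<close>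

lemma differentiable_linear_solution:
  fixes L :: "'a::real_normed_vector \<Rightarrow> 'b::euclidean_space \<Rightarrow> 'c::euclidean_space"
  assumes S: "open S" "x\<^sub>0 \<in> S"
    and lin: "\<And>x. x \<in> S \<Longrightarrow> linear (L x)"
    and inj: "inj (L x\<^sub>0)"
    and diff: "\<And>v. (\<lambda>x. L x v) differentiable (at x\<^sub>0)"
    and G: "G differentiable (at x\<^sub>0)"
    and eq: "\<And>x. x \<in> S \<Longrightarrow> L x (W x) = G x"
  shows "W differentiable (at x\<^sub>0)"
proof -
  obtain g where g: "linear g" "g \<circ> L x\<^sub>0 = id"
    using linear_injective_left_inverse[OF lin[OF S(2)] inj] by blast
  then have bg: "bounded_linear g" by (simp add: linear_conv_bounded_linear)
  interpret g: bounded_linear g by (rule bg)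
  obtain B where B: "B > 0" "\<And>v. norm (g v) \<le> norm v * B" using g.pos_bounded by blast
  define k where "k x = G x - L x (W x\<^sub>0)" for x
  have k0: "k x\<^sub>0 = 0" using eq[OF S(2)] by (simp add: k_def)
  obtain k' where k': "(k has_derivative k') (at x\<^sub>0)"
    unfolding k_def using differentiable_diff[OF G diff] by (auto simp: differentiable_def)
  interpret k': bounded_linear k' using k' by (rule has_derivative_bounded_linear)
  obtain K where K: "K > 0" "\<And>v. norm (k' v) \<le> norm v * K" using k'.pos_bounded by blast
  \<comment> \<open>Bounds the operator norm of \<open>L x - L x\<^sub>0\<close>.\<close>
  define \<eta> where "\<eta> x = (\<Sum>i\<in>Basis. norm (L x i - L x\<^sub>0 i))" for x
  have \<eta>0: "\<eta> x \<ge> 0" for x by (simp add: \<eta>_def sum_nonneg)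
  have "isCont \<eta> x\<^sub>0"
    unfolding \<eta>_def by (intro continuous_intros differentiable_imp_continuous_within diff)
  then have \<eta>_lim: "(\<eta> \<longlongrightarrow> 0) (at x\<^sub>0)"
    by (simp add: isCont_def \<eta>_def)
  have \<eta>: "norm (L x v - L x\<^sub>0 v) \<le> \<eta> x * norm v" if "x \<in> S" for x v
  proof -
    have "L y v = (\<Sum>i\<in>Basis. (v \<bullet> i) *\<^sub>R L y i)" if "y \<in> S" for y
      using linear_sum[OF lin[OF that], of "\<lambda>i. (v \<bullet> i) *\<^sub>R i" Basis] linear_scale[OF lin[OF that]]
      by (simp add: euclidean_representation)
    then have "L x v - L x\<^sub>0 v = (\<Sum>i\<in>Basis. (v \<bullet> i) *\<^sub>R (L x i - L x\<^sub>0 i))"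
      using that S by (simp add: sum_subtractf scaleR_diff_right)
    also have "norm \<dots> \<le> (\<Sum>i\<in>Basis. norm v * norm (L x i - L x\<^sub>0 i))"
      by (intro sum_norm_le) (auto intro!: mult_right_mono Basis_le_norm)
    finally show ?thesis by (simp add: \<eta>_def sum_distrib_left mult.commute)
  qed
  have "(W has_derivative (\<lambda>v. g (k' v))) (at x\<^sub>0)"
    unfolding has_derivative_at_alt
  proof (intro conjI allI impI)
    show "bounded_linear (\<lambda>v. g (k' v))"
      by (rule bounded_linear_compose[OF bg k'.bounded_linear_axioms])
    fix e :: real assume e: "e > 0"
    \<comment> \<open>\<open>e1\<close> controls the remainder in the derivative of
      \<open>k\<close>. The first entry of \<open>e2\<close> makes the error \<open>g ?E\<close>
      below at most half the increment of \<open>W\<close>, so that it can be absorbed; the second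
      makes it at most e/2 times the distance.\<close>
    define e1 where "e1 = min 1 (e / (2 * B))"
    define e2 where "e2 = min (1 / (2 * B)) (e / (4 * B * B * (K + 1)))"
    have c: "2 * B * B * (K + 1) > 0" using B K by simp
    have e1: "e1 > 0" "e1 \<le> 1" using e B by (auto simp: e1_def)
    have "e1 * B \<le> e / (2 * B) * B" using B by (intro mult_right_mono) (auto simp: e1_def)
    then have e1B: "e1 * B \<le> e / 2" using B by simp
    have e2: "e2 > 0" using e B K by (auto simp: e2_def)
    have "e2 * B \<le> 1 / (2 * B) * B" using B by (intro mult_right_mono) (auto simp: e2_def)
    then have e2B: "e2 * B \<le> 1/2" using B by simp
    have "e2 * (2 * B * B * (K + 1)) \<le> e / (4 * B * B * (K + 1)) * (2 * B * B * (K + 1))"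
      using c by (intro mult_right_mono) (auto simp: e2_def)
    also have "\<dots> = e / 2"
    proof -
      have "e / (2 * c) * c = e / 2" if "c > 0" for c using that by simp
      from this[OF c] show ?thesis by (simp add: mult.assoc)
    qed
    finally have e2K: "e2 * (2 * B * B * (K + 1)) \<le> e / 2" .
    obtain d1 where d1: "d1 > 0" "\<And>y. norm (y - x\<^sub>0) < d1 \<Longrightarrow> norm (k y - k' (y - x\<^sub>0)) \<le> e1 * norm (y - x\<^sub>0)"
      using k' e1 unfolding has_derivative_at_alt k0 by auto
    obtain d2 where d2: "d2 > 0" "\<And>y. y \<noteq> x\<^sub>0 \<Longrightarrow> norm (y - x\<^sub>0) < d2 \<Longrightarrow> \<eta> y < e2"
      using tendstoD[OF \<eta>_lim e2] \<eta>0 unfolding eventually_at dist_norm by auto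
    obtain d3 where d3: "d3 > 0" "ball x\<^sub>0 d3 \<subseteq> S" using S open_contains_ball by blast
    have "norm (W y - W x\<^sub>0 - g (k' (y - x\<^sub>0))) \<le> e * norm (y - x\<^sub>0)"
      if y: "norm (y - x\<^sub>0) < min d1 (min d2 d3)" for y
    proof (cases "y = x\<^sub>0")
      case True
      then show ?thesis by (simp add: k'.zero g.zero)
    next
      case False
      have yS: "y \<in> S" using y d3 by (auto simp: dist_norm norm_minus_commute)
      have \<eta>y: "\<eta> y \<le> e2" using d2 y False by force
      let ?\<Delta> = "W y - W x\<^sub>0"
      let ?E = "L y ?\<Delta> - L x\<^sub>0 ?\<Delta>"
      have ky: "L y ?\<Delta> = k y"
        using eq[OF yS] linear_diff[OF lin[OF yS]] by (simp add: k_def)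
      have \<Delta>: "?\<Delta> = g (k y) - g ?E"
        using g(2) ky by (simp add: g.diff fun_eq_iff)
      have E: "norm ?E \<le> e2 * norm ?\<Delta>"
        using order_trans[OF \<eta>[OF yS] mult_right_mono[OF \<eta>y norm_ge_zero]] .
      have "norm (g ?E) \<le> (e2 * norm ?\<Delta>) * B"
        using order_trans[OF B(2) mult_right_mono[OF E]] B by simp
      also have "\<dots> \<le> 1/2 * norm ?\<Delta>"
        using mult_right_mono[OF e2B norm_ge_zero[of ?\<Delta>]] by (simp add: algebra_simps)
      \<comment> \<open>Absorbing half of the increment bounds it by \<open>k y\<close>
        alone.\<close>
      finally have "norm ?\<Delta> \<le> norm (k y) * B + 1/2 * norm ?\<Delta>"
        using norm_triangle_ineq4[of "g (k y)" "g ?E"] B(2)[of "k y"] by (subst \<Delta>) linarith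
      then have n\<Delta>: "norm ?\<Delta> \<le> 2 * (norm (k y) * B)" by simp
      have k1: "norm (k y - k' (y - x\<^sub>0)) \<le> e1 * norm (y - x\<^sub>0)" using d1 y by simp
      also have "\<dots> \<le> norm (y - x\<^sub>0)" using mult_right_mono[OF e1(2) norm_ge_zero] by simp
      finally have nk: "norm (k y) \<le> (K + 1) * norm (y - x\<^sub>0)"
        using K(2)[of "y - x\<^sub>0"] norm_triangle_sub[of "k y" "k' (y - x\<^sub>0)"] by (simp add: algebra_simps)
      have "norm ?E \<le> e2 * (2 * (((K + 1) * norm (y - x\<^sub>0)) * B))"
        by (rule order_trans[OF E], rule mult_left_mono, rule order_trans[OF n\<Delta>])
          (use nk B e2 in \<open>auto intro: mult_right_mono\<close>)
      then have "norm ?E * B \<le> (e2 * (2 * (((K + 1) * norm (y - x\<^sub>0)) * B))) * B"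
        by (rule mult_right_mono) (use B in auto)
      also have "\<dots> = e2 * (2 * B * B * (K + 1)) * norm (y - x\<^sub>0)" by (simp add: algebra_simps)
      also have "\<dots> \<le> e / 2 * norm (y - x\<^sub>0)" by (rule mult_right_mono[OF e2K norm_ge_zero])
      finally have gE: "norm (g ?E) \<le> e / 2 * norm (y - x\<^sub>0)"
        using B(2)[of ?E] by linarith
      have "norm (g (k y - k' (y - x\<^sub>0))) \<le> (e1 * norm (y - x\<^sub>0)) * B"
        by (rule order_trans[OF B(2) mult_right_mono[OF k1]]) (use B in auto)
      also have "\<dots> \<le> e / 2 * norm (y - x\<^sub>0)"
        using mult_right_mono[OF e1B norm_ge_zero[of "y - x\<^sub>0"]] by (simp add: algebra_simps)
      finally have gk: "norm (g (k y - k' (y - x\<^sub>0))) \<le> e / 2 * norm (y - x\<^sub>0)" .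
      have "W y - W x\<^sub>0 - g (k' (y - x\<^sub>0)) = g (k y - k' (y - x\<^sub>0)) - g ?E"
        using \<Delta> by (simp add: g.diff)
      then show ?thesis using gE gk norm_triangle_ineq4[of "g (k y - k' (y - x\<^sub>0))" "g ?E"] by simp
    qed
    then show "\<exists>d>0. \<forall>y. norm (y - x\<^sub>0) < d \<longrightarrow> norm (W y - W x\<^sub>0 - g (k' (y - x\<^sub>0))) \<le> e * norm (y - x\<^sub>0)"
      using d1 d2 d3 by (intro exI[of _ "min d1 (min d2 d3)"]) auto
  qed
  then show ?thesis by (auto simp: differentiable_def)
qed

section \<open>Levi-Civita connections given by explicit maps\<close>

locale levi_civita =
  fixes U :: "'a::euclidean_space set" and h :: "'a metric_field" and \<Gamma> :: "'a \<Rightarrow> 'a \<Rightarrow> 'a \<Rightarrow> 'a"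
  assumes open_U: "open U"
    and bilinear_metric: "x \<in> U \<Longrightarrow> bilinear (h x)"
    and metric_sym: "x \<in> U \<Longrightarrow> h x u v = h x v u"
    and metric_pos: "x \<in> U \<Longrightarrow> u \<noteq> 0 \<Longrightarrow> h x u u > 0"
    and metric_differentiable: "x \<in> U \<Longrightarrow> (\<lambda>y. h y u v) differentiable (at x)"
    and bilinear_\<Gamma>: "x \<in> U \<Longrightarrow> bilinear (\<Gamma> x)"
    and \<Gamma>_differentiable: "x \<in> U \<Longrightarrow> (\<lambda>y. \<Gamma> y u v) differentiable (at x)"
    and koszul: "x \<in> U \<Longrightarrow> 2 * h x (\<Gamma> x u v) z =
        frechet_derivative (\<lambda>y. h y v z) (at x) u
      + frechet_derivative (\<lambda>y. h y u z) (at x) v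
      - frechet_derivative (\<lambda>y. h y u v) (at x) z"
begin

lemma nondegenerate:
  assumes "x \<in> U" "\<And>z. h x w z = h x w' z"
  shows "w = w'"
proof (rule ccontr)
  assume "w \<noteq> w'"
  then have "h x (w - w') (w - w') > 0" using metric_pos[OF assms(1)] by simp
  then show False using assms(2) by (simp add: bilinear_lsub[OF bilinear_metric[OF assms(1)]])
qed

lemma christoffel_eq:
  assumes "x \<in> U"
  shows "christoffel h x u v = \<Gamma> x u v"
  unfolding christoffel_def
proof (rule the_equality)
  show "\<forall>z. 2 * h x (\<Gamma> x u v) z = frechet_derivative (\<lambda>y. h y v z) (at x) u
      + frechet_derivative (\<lambda>y. h y u z) (at x) v - frechet_derivative (\<lambda>y. h y u v) (at x) z"
    using koszul[OF assms] by blast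
next
  fix w assume "\<forall>z. 2 * h x w z = frechet_derivative (\<lambda>y. h y v z) (at x) u
      + frechet_derivative (\<lambda>y. h y u z) (at x) v - frechet_derivative (\<lambda>y. h y u v) (at x) z"
  then have "2 * h x w z = 2 * h x (\<Gamma> x u v) z" for z using koszul[OF assms] by simp
  then show "w = \<Gamma> x u v" using nondegenerate[OF assms] by simp
qed

lemma cov_deriv_const: "x \<in> U \<Longrightarrow> cov_deriv h (\<lambda>_. u) (\<lambda>_. v) x = \<Gamma> x u v"
  by (simp add: cov_deriv_def christoffel_eq)

definition second_cov_deriv :: "'a \<Rightarrow> 'a \<Rightarrow> 'a \<Rightarrow> 'a \<Rightarrow> 'a" where
  "second_cov_deriv x u v w = frechet_derivative (\<lambda>y. \<Gamma> y v w) (at x) u + \<Gamma> x u (\<Gamma> x v w)"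

lemma cov_deriv_cov_deriv_const:
  assumes "x \<in> U"
  shows "cov_deriv h (\<lambda>_. u) (cov_deriv h (\<lambda>_. v) (\<lambda>_. w)) x = second_cov_deriv x u v w"
proof -
  have "frechet_derivative (\<lambda>y. \<Gamma> y v w) (at x) = frechet_derivative (cov_deriv h (\<lambda>_. v) (\<lambda>_. w)) (at x)"
    by (rule frechet_derivative_transform_within_open[OF \<Gamma>_differentiable open_U])
      (use assms cov_deriv_const in auto)
  then show ?thesis
    using assms by (simp add: cov_deriv_def[of h "\<lambda>_. u" "cov_deriv h (\<lambda>_. v) (\<lambda>_. w)"]
      cov_deriv_const christoffel_eq second_cov_deriv_def)
qed

lemma curvature_op_const:
  assumes "x \<in> U"
  shows "curvature_op h (\<lambda>_. u) (\<lambda>_. v) (\<lambda>_. w) x = second_cov_deriv x u v w - second_cov_deriv x v u w"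
proof -
  have "cov_deriv h (lie_bracket (\<lambda>_. u) (\<lambda>_. v)) (\<lambda>_. w) x = 0"
    using assms by (simp add: cov_deriv_def lie_bracket_def christoffel_eq bilinear_lzero[OF bilinear_\<Gamma>])
  then show ?thesis using assms by (simp add: curvature_op_def cov_deriv_cov_deriv_const)
qed

text \<open>In \<open>v\<close> and \<open>w\<close> the arguments sit inside a differentiated
  function, so linear combinations have to be pulled through the derivative of \<Gamma>. This
  linearity is what turns the Ricci tensor and the scalar curvature into traces.\<close>

lemma linear_curvature_op:
  assumes "x \<in> U"
  shows "linear (\<lambda>u. curvature_op h (\<lambda>_. u) (\<lambda>_. v) (\<lambda>_. w) x)"
    "linear (\<lambda>v. curvature_op h (\<lambda>_. u) (\<lambda>_. v) (\<lambda>_. w) x)"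
    "linear (\<lambda>w. curvature_op h (\<lambda>_. u) (\<lambda>_. v) (\<lambda>_. w) x)"
proof -
  note bil = bilinear_\<Gamma>[OF assms]
  have L: "linear (\<lambda>u. second_cov_deriv x u v w)" for v w
    unfolding second_cov_deriv_def
    by (intro linear_compose_add linear_frechet_derivative \<Gamma>_differentiable assms)
      (use bil in \<open>auto simp: bilinear_def\<close>)
  have D: "((\<lambda>y. \<Gamma> y v w) has_derivative frechet_derivative (\<lambda>y. \<Gamma> y v w) (at x)) (at x)" for v w
    using \<Gamma>_differentiable[OF assms] frechet_derivative_works by blast
  have fd: "frechet_derivative (\<lambda>y. \<Gamma> y (a *\<^sub>R v + b *\<^sub>R v') w) (at x) u = a *\<^sub>R frechet_derivative (\<lambda>y. \<Gamma> y v w) (at x) u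
     + b *\<^sub>R frechet_derivative (\<lambda>y. \<Gamma> y v' w) (at x) u" for a b u v v' w
  proof -
    have "((\<lambda>y. a *\<^sub>R \<Gamma> y v w + b *\<^sub>R \<Gamma> y v' w) has_derivative (\<lambda>u. a *\<^sub>R frechet_derivative (\<lambda>y. \<Gamma> y v w) (at x) u
     + b *\<^sub>R frechet_derivative (\<lambda>y. \<Gamma> y v' w) (at x) u)) (at x)"
      by (intro has_derivative_add has_derivative_scaleR_right D)
    then have "((\<lambda>y. \<Gamma> y (a *\<^sub>R v + b *\<^sub>R v') w) has_derivative (\<lambda>u. a *\<^sub>R frechet_derivative (\<lambda>y. \<Gamma> y v w) (at x) u
     + b *\<^sub>R frechet_derivative (\<lambda>y. \<Gamma> y v' w) (at x) u)) (at x)"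
      by (rule has_derivative_transform_within_open[OF _ open_U assms])
        (simp add: bilinear_ladd[OF bilinear_\<Gamma>] bilinear_lmul[OF bilinear_\<Gamma>])
    from fun_cong[OF frechet_derivative_at[OF this], of u] show ?thesis by (rule sym)
  qed
  have fd': "frechet_derivative (\<lambda>y. \<Gamma> y w (a *\<^sub>R v + b *\<^sub>R v')) (at x) u = a *\<^sub>R frechet_derivative (\<lambda>y. \<Gamma> y w v) (at x) u
     + b *\<^sub>R frechet_derivative (\<lambda>y. \<Gamma> y w v') (at x) u" for a b u v v' w
  proof -
    have "((\<lambda>y. a *\<^sub>R \<Gamma> y w v + b *\<^sub>R \<Gamma> y w v') has_derivative (\<lambda>u. a *\<^sub>R frechet_derivative (\<lambda>y. \<Gamma> y w v) (at x) u
     + b *\<^sub>R frechet_derivative (\<lambda>y. \<Gamma> y w v') (at x) u)) (at x)"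
      by (intro has_derivative_add has_derivative_scaleR_right D)
    then have "((\<lambda>y. \<Gamma> y w (a *\<^sub>R v + b *\<^sub>R v')) has_derivative (\<lambda>u. a *\<^sub>R frechet_derivative (\<lambda>y. \<Gamma> y w v) (at x) u
     + b *\<^sub>R frechet_derivative (\<lambda>y. \<Gamma> y w v') (at x) u)) (at x)"
      by (rule has_derivative_transform_within_open[OF _ open_U assms])
        (simp add: bilinear_radd[OF bilinear_\<Gamma>] bilinear_rmul[OF bilinear_\<Gamma>])
    from fun_cong[OF frechet_derivative_at[OF this], of u] show ?thesis by (rule sym)
  qed
  have fd1: "frechet_derivative (\<lambda>y. \<Gamma> y (v + v') w) (at x) u = frechet_derivative (\<lambda>y. \<Gamma> y v w) (at x) u
     + frechet_derivative (\<lambda>y. \<Gamma> y v' w) (at x) u"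
    "frechet_derivative (\<lambda>y. \<Gamma> y (c *\<^sub>R v) w) (at x) u = c *\<^sub>R frechet_derivative (\<lambda>y. \<Gamma> y v w) (at x) u"
    "frechet_derivative (\<lambda>y. \<Gamma> y w (v + v')) (at x) u = frechet_derivative (\<lambda>y. \<Gamma> y w v) (at x) u
     + frechet_derivative (\<lambda>y. \<Gamma> y w v') (at x) u"
    "frechet_derivative (\<lambda>y. \<Gamma> y w (c *\<^sub>R v)) (at x) u = c *\<^sub>R frechet_derivative (\<lambda>y. \<Gamma> y w v) (at x) u"
    for u v v' w c
    using fd[of 1 v 1 v' w u] fd[of c v 0 0 w u] fd'[of w 1 v 1 v' u] fd'[of w c v 0 0 u] by simp_all
  have M: "linear (\<lambda>v. second_cov_deriv x u v w)" for u w
    unfolding second_cov_deriv_def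
    by (rule linearI) (simp_all add: fd1 bilinear_ladd[OF bil] bilinear_lmul[OF bil]
        bilinear_radd[OF bil] bilinear_rmul[OF bil] scaleR_add_right)
  have R: "linear (\<lambda>w. second_cov_deriv x u v w)" for u v
    unfolding second_cov_deriv_def
    by (rule linearI) (simp_all add: fd1 bilinear_radd[OF bil] bilinear_rmul[OF bil] scaleR_add_right)
  show "linear (\<lambda>u. curvature_op h (\<lambda>_. u) (\<lambda>_. v) (\<lambda>_. w) x)"
    "linear (\<lambda>v. curvature_op h (\<lambda>_. u) (\<lambda>_. v) (\<lambda>_. w) x)"
    "linear (\<lambda>w. curvature_op h (\<lambda>_. u) (\<lambda>_. v) (\<lambda>_. w) x)"
    unfolding curvature_op_const[OF assms]
    by (intro linear_compose_sub L M R)+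
qed

end

section \<open>Pullback by local diffeomorphisms\<close>

definition metric_pullback :: "('a::euclidean_space \<Rightarrow> 'a) \<Rightarrow> 'a metric_field \<Rightarrow> 'a metric_field" where
  "metric_pullback F h x u v =
     h (F x) (frechet_derivative F (at x) u) (frechet_derivative F (at x) v)"

locale levi_civita_pullback = levi_civita V h \<Gamma>
  for V :: "'a::euclidean_space set" and h \<Gamma> +
  fixes U and F :: "'a \<Rightarrow> 'a"
  assumes open_dom: "open U"
    and smooth_F: "smooth_on U F"
    and F_in: "x \<in> U \<Longrightarrow> F x \<in> V"
    and inj_F': "x \<in> U \<Longrightarrow> inj (frechet_derivative F (at x))"
begin

abbreviation F' :: "'a \<Rightarrow> 'a \<Rightarrow> 'a" where "F' x \<equiv> frechet_derivative F (at x)"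

definition F'' :: "'a \<Rightarrow> 'a \<Rightarrow> 'a \<Rightarrow> 'a" where
  "F'' x u v = frechet_derivative (\<lambda>y. F' y v) (at x) u"

text \<open>The covariant derivative along \<open>F\<close> of the image under \<open>F'\<close> of
  a constant field. The pulled back connection is its preimage.\<close>

definition \<Gamma>F :: "'a \<Rightarrow> 'a \<Rightarrow> 'a \<Rightarrow> 'a" where
  "\<Gamma>F x u v = F'' x u v + \<Gamma> (F x) (F' x u) (F' x v)"

abbreviation \<Gamma>_pull :: "'a \<Rightarrow> 'a \<Rightarrow> 'a \<Rightarrow> 'a" where
  "\<Gamma>_pull x u v \<equiv> inv (F' x) (\<Gamma>F x u v)"

lemma F_deriv: "x \<in> U \<Longrightarrow> (F has_derivative F' x) (at x)"
  by (rule smooth_on_has_derivative[OF smooth_F])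

lemma F'_deriv: "x \<in> U \<Longrightarrow> ((\<lambda>y. F' y v) has_derivative (\<lambda>u. F'' x u v)) (at x)"
  unfolding F''_def using smooth_on_has_derivative[OF smooth_on_frechet_derivative[OF smooth_F]] by simp

lemma linear_F': "x \<in> U \<Longrightarrow> linear (F' x)"
  using F_deriv has_derivative_linear by blast

lemma bij_F': "x \<in> U \<Longrightarrow> bij (F' x)"
  using linear_F'[of x] inj_F'[of x] linear_inj_imp_surj[of "F' x"] by (simp add: bij_def)

lemma F''_sym: "x \<in> U \<Longrightarrow> F'' x u v = F'' x v u"
  unfolding F''_def by (rule second_derivative_symmetric[OF open_dom _ smooth_F])

lemma bilinear_F'':
  assumes "x \<in> U" shows "bilinear (F'' x)"
proof -
  have "linear (\<lambda>u. F'' x u v)" for v using F'_deriv[OF assms] has_derivative_linear by blast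
  moreover from this have "linear (\<lambda>v. F'' x u v)" for u
    by (subst F''_sym[OF assms])
  ultimately show ?thesis by (simp add: bilinear_def)
qed

lemma F'_\<Gamma>_pull: "x \<in> U \<Longrightarrow> F' x (\<Gamma>_pull x u v) = \<Gamma>F x u v"
  using bij_F'[of x] by (simp add: bij_def surj_f_inv_f)

lemmas F'_\<Gamma>_pull_unfolded = F'_\<Gamma>_pull[unfolded \<Gamma>F_def]

lemma bilinear_comp_F':
  fixes B :: "'a \<Rightarrow> 'a \<Rightarrow> 'b::real_vector"
  assumes "x \<in> U" "bilinear B" shows "bilinear (\<lambda>u v. B (F' x u) (F' x v))"
  using linear_compose[OF linear_F'[OF assms(1)]] assms(2) by (auto simp: bilinear_def o_def)

lemma bilinear_\<Gamma>F:
  assumes "x \<in> U" shows "bilinear (\<Gamma>F x)"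
  using bilinear_F''[OF assms] bilinear_comp_F'[OF assms bilinear_\<Gamma>[OF F_in[OF assms]]]
  unfolding \<Gamma>F_def by (auto simp: bilinear_def intro: linear_compose_add)

lemma pull_deriv:
  assumes "x \<in> U"
  shows "((\<lambda>y. metric_pullback F h y u v) has_derivative
    (\<lambda>d. frechet_derivative (\<lambda>y. h y (F' x u) (F' x v)) (at (F x)) (F' x d)
       + h (F x) (F'' x d u) (F' x v) + h (F x) (F' x u) (F'' x d v))) (at x)"
  unfolding metric_pullback_def
  by (rule has_derivative_bilinear_field[OF open_U F_in[OF assms] bilinear_metric
        metric_differentiable[OF F_in[OF assms]] F_deriv[OF assms] F'_deriv[OF assms] F'_deriv[OF assms]])

lemma \<Gamma>F_comp_deriv:
  assumes "x \<in> U"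
  shows "((\<lambda>y. \<Gamma>F y v w) has_derivative
    (\<lambda>d. frechet_derivative (\<lambda>y. F'' y v w) (at x) d
       + (frechet_derivative (\<lambda>y. \<Gamma> y (F' x v) (F' x w)) (at (F x)) (F' x d)
       + \<Gamma> (F x) (F'' x d v) (F' x w) + \<Gamma> (F x) (F' x v) (F'' x d w)))) (at x)"
proof -
  have "smooth_on U (\<lambda>y. F'' y v w)"
    unfolding F''_def by (intro smooth_on_frechet_derivative smooth_F)
  then show ?thesis
    unfolding \<Gamma>F_def
    by (intro has_derivative_add has_derivative_bilinear_field[OF open_U F_in[OF assms] bilinear_\<Gamma>
        \<Gamma>_differentiable[OF F_in[OF assms]] F_deriv[OF assms] F'_deriv[OF assms] F'_deriv[OF assms]]
        smooth_on_has_derivative[OF _ assms])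
qed

text \<open>The inverse of \<open>F' y\<close> is never differentiated: \<open>\<Gamma>_pull\<close>
  solves a linear equation whose coefficients and right-hand side are differentiable.\<close>

lemma \<Gamma>_pull_differentiable:
  assumes "x \<in> U" shows "(\<lambda>y. \<Gamma>_pull y u v) differentiable (at x)"
  by (rule differentiable_linear_solution[where L = F' and G = "\<lambda>y. \<Gamma>F y u v", OF open_dom assms])
    (use linear_F' inj_F' differentiableI[OF F'_deriv] differentiableI[OF \<Gamma>F_comp_deriv] F'_\<Gamma>_pull assms in auto)

text \<open>In the Koszul identity the derivatives of the pulled back metric contribute six terms
  with \<open>F''\<close>. By the symmetry of \<open>F''\<close> and of the metric four of them
  cancel, and the other two give the \<open>F''\<close> part of \<open>\<Gamma>F\<close>,
  twice.\<close>

sublocale pull: levi_civita U "metric_pullback F h" \<Gamma>_pull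
proof
  show "open U" by (rule open_dom)
  fix x u v z assume x: "x \<in> U"
  note Fx = F_in[OF x]
  note bil = bilinear_metric[OF Fx]
  show "bilinear (metric_pullback F h x)"
    unfolding metric_pullback_def by (rule bilinear_comp_F'[OF x bil])
  show "metric_pullback F h x u v = metric_pullback F h x v u"
    unfolding metric_pullback_def by (rule metric_sym[OF Fx])
  show "metric_pullback F h x u u > 0" if "u \<noteq> 0"
    unfolding metric_pullback_def
    using metric_pos[OF Fx] inj_F'[OF x] that linear_0[OF linear_F'[OF x]] by (metis injD)
  show "(\<lambda>y. metric_pullback F h y u v) differentiable (at x)"
    using pull_deriv[OF x] by (auto simp: differentiable_def)
  have "linear (inv (F' x))"
    using inj_linear_imp_inv_linear[OF linear_F'[OF x] inj_F'[OF x]] .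
  then show "bilinear (\<Gamma>_pull x)"
    using bilinear_\<Gamma>F[OF x] linear_compose[of _ "inv (F' x)"] by (auto simp: bilinear_def o_def)
  show "(\<lambda>y. \<Gamma>_pull y u v) differentiable (at x)" by (rule \<Gamma>_pull_differentiable[OF x])
  have lhs: "metric_pullback F h x (\<Gamma>_pull x u v) z
      = h (F x) (F'' x u v) (F' x z) + h (F x) (\<Gamma> (F x) (F' x u) (F' x v)) (F' x z)"
    by (simp add: metric_pullback_def F'_\<Gamma>_pull_unfolded[OF x] \<Gamma>F_def bilinear_ladd[OF bil])
  show "2 * metric_pullback F h x (\<Gamma>_pull x u v) z =
        frechet_derivative (\<lambda>y. metric_pullback F h y v z) (at x) u
      + frechet_derivative (\<lambda>y. metric_pullback F h y u z) (at x) v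
      - frechet_derivative (\<lambda>y. metric_pullback F h y u v) (at x) z"
    unfolding lhs frechet_derivative_at[OF pull_deriv[OF x], symmetric]
    using koszul[OF Fx, of "F' x u" "F' x v" "F' x z"]
      F''_sym[OF x, of u v] F''_sym[OF x, of u z] F''_sym[OF x, of v z]
      metric_sym[OF Fx, of "F' x u" "F'' x z v"] metric_sym[OF Fx, of "F' x v" "F'' x u z"]
      metric_sym[OF Fx, of "F' x v" "F'' x z u"]
    by simp
qed

text \<open>Comes from differentiating the equation that defines \<open>\<Gamma>_pull\<close>. All
  terms on the right except \<open>second_cov_deriv\<close> are symmetric in \<open>u\<close> and
  \<open>v\<close>, so the curvature does not see them.\<close>

lemma F'_second_cov_deriv:
  assumes "x \<in> U"
  shows "F' x (pull.second_cov_deriv x u v w) =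
    frechet_derivative (\<lambda>y. F'' y v w) (at x) u + second_cov_deriv (F x) (F' x u) (F' x v) (F' x w)
      + \<Gamma> (F x) (F'' x u v) (F' x w) + (\<Gamma> (F x) (F' x v) (F'' x u w) + \<Gamma> (F x) (F' x u) (F'' x v w))"
proof -
  let ?W = "\<lambda>y. \<Gamma>_pull y v w"
  have W: "(?W has_derivative frechet_derivative ?W (at x)) (at x)"
    using \<Gamma>_pull_differentiable[OF assms] frechet_derivative_works by blast
  have "((\<lambda>y. F' y (?W y)) has_derivative
     (\<lambda>d. F'' x d (?W x) + F' x (frechet_derivative ?W (at x) d))) (at x)"
  proof -
    \<comment> \<open>A dummy scalar argument, set to 1, presents \<open>F' y\<close> as a field of
      bilinear maps.\<close>
    have "((\<lambda>y. (\<lambda>y (a::real) b. a *\<^sub>R F' y b) y 1 (?W y)) has_derivative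
      (\<lambda>d. frechet_derivative (\<lambda>y. 1 *\<^sub>R F' y (?W x)) (at x) d + 0 *\<^sub>R F' x (?W x)
         + 1 *\<^sub>R F' x (frechet_derivative ?W (at x) d))) (at x)"
    proof (rule has_derivative_bilinear_field[where F = "\<lambda>y. y" and B = "\<lambda>y (a::real) b. a *\<^sub>R F' y b" and w = ?W and T = U])
      show "bilinear (\<lambda>a b. a *\<^sub>R F' y b)" if "y \<in> U" for y
        using linear_F'[OF that]
        by (auto simp: bilinear_def linear_iff scaleR_add_left scaleR_add_right)
      show "(\<lambda>y. u *\<^sub>R F' y v) differentiable at x" for u v
        using F'_deriv[OF assms, of v] by (auto simp: differentiable_def intro!: exI has_derivative_scaleR_right)
    qed (use W assms open_dom in auto)
    then show ?thesis by (simp add: F''_def)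
  qed
  then have "((\<lambda>y. \<Gamma>F y v w) has_derivative
     (\<lambda>d. F'' x d (?W x) + F' x (frechet_derivative ?W (at x) d))) (at x)"
    by (rule has_derivative_transform_within_open[OF _ open_dom assms]) (simp add: F'_\<Gamma>_pull)
  from has_derivative_unique[OF this \<Gamma>F_comp_deriv[OF assms]]
  have eq: "F'' x u (?W x) + F' x (frechet_derivative ?W (at x) u)
    = frechet_derivative (\<lambda>y. F'' y v w) (at x) u
       + (frechet_derivative (\<lambda>y. \<Gamma> y (F' x v) (F' x w)) (at (F x)) (F' x u)
       + \<Gamma> (F x) (F'' x u v) (F' x w) + \<Gamma> (F x) (F' x v) (F'' x u w))"
    by (rule fun_cong)
  have "F' x (pull.second_cov_deriv x u v w)
    = F' x (frechet_derivative ?W (at x) u) + \<Gamma>F x u (?W x)"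
    unfolding pull.second_cov_deriv_def
    by (simp add: linear_add[OF linear_F'[OF assms]] F'_\<Gamma>_pull[OF assms])
  also have "\<Gamma>F x u (?W x) = F'' x u (?W x) + \<Gamma> (F x) (F' x u) (F'' x v w)
      + \<Gamma> (F x) (F' x u) (\<Gamma> (F x) (F' x v) (F' x w))"
    by (simp add: \<Gamma>F_def F'_\<Gamma>_pull_unfolded[OF assms] bilinear_radd[OF bilinear_\<Gamma>[OF F_in[OF assms]]])
  finally show ?thesis using eq unfolding second_cov_deriv_def by (simp add: algebra_simps)
qed

lemma F'_curvature_op:
  assumes "x \<in> U"
  shows "F' x (curvature_op (metric_pullback F h) (\<lambda>_. u) (\<lambda>_. v) (\<lambda>_. w) x) =
    curvature_op h (\<lambda>_. F' x u) (\<lambda>_. F' x v) (\<lambda>_. F' x w) (F x)"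
proof -
  have "frechet_derivative (\<lambda>y. F'' y v w) (at x) u = frechet_derivative (\<lambda>y. F'' y u w) (at x) v"
    unfolding F''_def
    by (rule second_derivative_symmetric[OF open_dom assms smooth_on_frechet_derivative[OF smooth_F]])
  then show ?thesis
    unfolding pull.curvature_op_const[OF assms] curvature_op_const[OF F_in[OF assms]]
      linear_diff[OF linear_F'[OF assms]] F'_second_cov_deriv[OF assms]
    using F''_sym[OF assms, of u v] by (simp add: algebra_simps)
qed

lemma curvature_pullback:
  assumes "x \<in> U"
  shows "curvature (metric_pullback F h) x u v w z = curvature h (F x) (F' x u) (F' x v) (F' x w) (F' x z)"
  using F'_curvature_op[OF assms, of u v w] by (simp add: curvature_def metric_pullback_def)

end


section \<open>Metric traces and the complexified Bochner tensor\<close>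

locale inner_form =
  fixes b :: "'a::euclidean_space \<Rightarrow> 'a \<Rightarrow> real"
  assumes bilinear_form: "bilinear b"
    and form_sym: "b u v = b v u"
    and form_pos: "u \<noteq> 0 \<Longrightarrow> b u u > 0"
begin

lemma form_sum_left: "b (\<Sum>i\<in>S. c i *\<^sub>R v i) w = (\<Sum>i\<in>S. c i * b (v i) w)"
proof -
  have l: "linear (\<lambda>v. b v w)" using bilinear_form by (auto simp: bilinear_def)
  show ?thesis by (simp add: linear_sum[OF l] linear_scale[OF l])
qed

lemma form_orthonormal_coeff:
  assumes "finite E" "\<forall>e\<in>E. \<forall>e'\<in>E. b e e' = (if e = e' then 1 else 0)" "e \<in> E"
  shows "b (\<Sum>e\<in>E. c e *\<^sub>R e) e = c e"
proof -
  have "(\<Sum>e'\<in>E. c e' * b e' e) = (\<Sum>e'\<in>E. if e' = e then c e' else 0)"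
    using assms by (intro sum.cong) auto
  then show ?thesis using assms by (simp add: form_sum_left)
qed

lemma orthonormal_independent:
  assumes "finite E" "\<forall>e\<in>E. \<forall>e'\<in>E. b e e' = (if e = e' then 1 else 0)"
  shows "independent E"
proof (rule independent_if_scalars_zero[OF assms(1)])
  fix c e assume "(\<Sum>x\<in>E. c x *\<^sub>R x) = 0" "e \<in> E"
  then show "c e = 0"
    using form_orthonormal_coeff[OF assms, of e c] bilinear_lzero[OF bilinear_form] by simp
qed

lemma orthonormal_expansion:
  assumes "orthonormal_basis b E"
  shows "v = (\<Sum>e\<in>E. b v e *\<^sub>R e)"
proof -
  have E: "finite E" "card E = DIM('a)" "\<forall>e\<in>E. \<forall>e'\<in>E. b e e' = (if e = e' then 1 else 0)"
    using assms by (auto simp: orthonormal_basis_def)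
  have "UNIV \<subseteq> span E"
    by (rule card_ge_dim_independent) (use orthonormal_independent[OF E(1,3)] E in auto)
  then obtain c where c: "v = (\<Sum>e\<in>E. c e *\<^sub>R e)"
    using span_finite[OF E(1)] by auto
  have "b v e = c e" if "e \<in> E" for e
    using form_orthonormal_coeff[OF E(1,3) that, of c] c by simp
  then show ?thesis using c by simp
qed

lemma exists_orthonormal_basis: "\<exists>E. orthonormal_basis b E"
proof -
  have "\<exists>E. finite E \<and> card E = k \<and> (\<forall>e\<in>E. \<forall>e'\<in>E. b e e' = (if e = e' then 1 else 0))"
    if "k \<le> DIM('a)" for k
    using that
  proof (induction k)
    case (Suc k)
    then obtain E where E: "finite E" "card E = k" "\<forall>e\<in>E. \<forall>e'\<in>E. b e e' = (if e = e' then 1 else 0)"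
      by auto
    have "span E \<noteq> UNIV"
    proof
      assume "span E = UNIV"
      then have "DIM('a) \<le> card E" using dim_le_card[of UNIV E] E(1) by simp
      then show False using Suc.prems E by simp
    qed
    then obtain v where v: "v \<notin> span E" by blast
    \<comment> \<open>Gram-Schmidt: the part of \<open>v\<close> orthogonal to \<open>E\<close>,
      nonzero because \<open>v\<close> lies outside the span.\<close>
    define w where "w = v - (\<Sum>e\<in>E. b v e *\<^sub>R e)"
    have "w \<noteq> 0" using v span_sum[of E "\<lambda>e. b v e *\<^sub>R e" E] by (auto simp: w_def span_base span_scale)
    then have ww: "b w w > 0" by (rule form_pos)
    have we: "b w e = 0" if "e \<in> E" for e
      unfolding w_def using form_orthonormal_coeff[OF E(1,3) that] by (simp add: bilinear_lsub[OF bilinear_form])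
    define n where "n = (1 / sqrt (b w w)) *\<^sub>R w"
    have "b n n = 1" using ww by (simp add: n_def bilinear_lmul[OF bilinear_form] bilinear_rmul[OF bilinear_form])
    moreover have ne: "b n e = 0" "b e n = 0" if "e \<in> E" for e
      using we[OF that] form_sym[of e] by (simp_all add: n_def bilinear_lmul[OF bilinear_form] bilinear_rmul[OF bilinear_form])
    moreover have "n \<notin> E" using ne \<open>b n n = 1\<close> by force
    ultimately show ?case using E
      by (intro exI[of _ "insert n E"]) auto
  qed auto
  then show ?thesis by (auto simp: orthonormal_basis_def)
qed

text \<open>Both sides are the trace of \<open>L\<close>, as the expansion of the Euclidean basis in
  \<open>E\<close> shows. This removes the choice made in \<open>metric_trace\<close>.\<close>

lemma sum_orthonormal_eq_trace:
  assumes "orthonormal_basis b E" "linear L"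
  shows "(\<Sum>e\<in>E. b (L e) e) = (\<Sum>i\<in>Basis. L i \<bullet> i)"
proof -
  note ex = orthonormal_expansion[OF assms(1)]
  have "(\<Sum>i\<in>Basis. L i \<bullet> i) = (\<Sum>i\<in>Basis. \<Sum>e\<in>E. b i e * (L e \<bullet> i))"
  proof (rule sum.cong[OF refl])
    fix i
    have "L i = (\<Sum>e\<in>E. b i e *\<^sub>R L e)"
      using arg_cong[OF ex[of i], of L] by (simp add: linear_sum[OF assms(2)] linear_scale[OF assms(2)])
    then show "L i \<bullet> i = (\<Sum>e\<in>E. b i e * (L e \<bullet> i))" by (simp add: inner_sum_left)
  qed
  also have "\<dots> = (\<Sum>e\<in>E. \<Sum>i\<in>Basis. (L e \<bullet> i) * b i e)"
    by (subst sum.swap) (simp add: mult.commute)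
  also have "\<dots> = (\<Sum>e\<in>E. b (L e) e)"
    by (simp add: form_sum_left[symmetric] euclidean_representation)
  finally show ?thesis by simp
qed

lemma metric_trace_linear:
  assumes "linear L"
  shows "metric_trace b (\<lambda>u v. b (L u) v) = (\<Sum>i\<in>Basis. L i \<bullet> i)"
  unfolding metric_trace_def
  by (rule sum_orthonormal_eq_trace[OF someI_ex[OF exists_orthonormal_basis] assms])

lemma metric_trace_eq:
  assumes "bilinear T" "orthonormal_basis b E"
  shows "metric_trace b T = (\<Sum>e\<in>E. T e e)"
proof -
  \<comment> \<open>The endomorphism that represents \<open>T\<close> with respect to
    \<open>b\<close>.\<close>
  define L where "L u = (\<Sum>e\<in>E. T u e *\<^sub>R e)" for u
  have L: "linear L"
    unfolding L_def using assms(1) by (intro linear_compose_sum ballI linear_compose_scale_right) (auto simp: bilinear_def linear_iff scaleR_add_left)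
  have T: "T = (\<lambda>u v. b (L u) v)"
  proof (intro ext)
    fix u v
    have l: "linear (T u)" using assms(1) by (auto simp: bilinear_def)
    have "b (L u) v = (\<Sum>e\<in>E. b v e * T u e)"
      unfolding L_def form_sum_left by (simp add: form_sym[of _ v] mult.commute)
    also have "\<dots> = T u (\<Sum>e\<in>E. b v e *\<^sub>R e)" by (simp add: linear_sum[OF l] linear_scale[OF l])
    finally show "T u v = b (L u) v" using orthonormal_expansion[OF assms(2)] by simp
  qed
  show ?thesis
    unfolding T metric_trace_linear[OF L] by (rule sum_orthonormal_eq_trace[OF assms(2) L, symmetric])
qed

text \<open>\<open>A\<close> maps orthonormal bases of the pulled back form to orthonormal bases of
  \<open>b\<close>.\<close>

lemma metric_trace_pullback:
  fixes A :: "'a \<Rightarrow> 'a"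
  assumes A: "linear A" "inj A" and T: "bilinear T"
  shows "metric_trace (\<lambda>u v. b (A u) (A v)) (\<lambda>u v. T (A u) (A v)) = metric_trace b T"
proof -
  have bil: "bilinear (\<lambda>u v. B (A u) (A v))" if "bilinear B" for B :: "'a \<Rightarrow> 'a \<Rightarrow> real"
    using that linear_compose[OF A(1)] by (auto simp: bilinear_def o_def)
  interpret A: inner_form "\<lambda>u v. b (A u) (A v)"
  proof
    show "bilinear (\<lambda>u v. b (A u) (A v))" by (rule bil[OF bilinear_form])
    show "b (A u) (A v) = b (A v) (A u)" for u v by (rule form_sym)
    show "b (A u) (A u) > 0" if "u \<noteq> 0" for u
      using form_pos A that linear_0[OF A(1)] by (metis injD)
  qed
  obtain E where E: "orthonormal_basis (\<lambda>u v. b (A u) (A v)) E"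
    using A.exists_orthonormal_basis by blast
  have inj: "inj_on A E" using A(2) inj_on_subset by blast
  have "orthonormal_basis b (A ` E)"
    using E card_image[OF inj] A(2) by (auto simp: orthonormal_basis_def inj_eq)
  from metric_trace_eq[OF T this] A.metric_trace_eq[OF bil[OF T] E]
  show ?thesis by (simp add: sum.reindex[OF inj])
qed

end

context levi_civita
begin

lemma inner_form_metric: "x \<in> U \<Longrightarrow> inner_form (h x)"
  by unfold_locales (use bilinear_metric metric_sym metric_pos in auto)

lemma bilinear_curvature:
  assumes "x \<in> U" shows "bilinear (\<lambda>e e'. curvature h x e v w e')"
  unfolding curvature_def
  using bilinear_metric[OF assms] linear_compose[OF linear_curvature_op(1)[OF assms, of v w]]
  by (auto simp: bilinear_def o_def)

text \<open>Being the trace of an endomorphism, the Ricci tensor can be computed in the Euclidean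
  basis, where the metric drops out.\<close>

lemma ricci_eq:
  assumes "x \<in> U"
  shows "ricci h x v w = (\<Sum>i\<in>Basis. curvature_op h (\<lambda>_. i) (\<lambda>_. v) (\<lambda>_. w) x \<bullet> i)"
  unfolding ricci_def curvature_def
  by (rule inner_form.metric_trace_linear[OF inner_form_metric[OF assms] linear_curvature_op(1)[OF assms]])

lemma bilinear_ricci:
  assumes "x \<in> U" shows "bilinear (ricci h x)"
  unfolding ricci_eq[OF assms] bilinear_def
  by (intro conjI allI linear_compose_sum ballI linear_compose[OF linear_curvature_op(2)[OF assms], unfolded o_def]
      linear_compose[OF linear_curvature_op(3)[OF assms], unfolded o_def] bounded_linear.linear bounded_linear_inner_left)

end

context levi_civita_pullback
begin

lemma ricci_pullback:
  assumes "x \<in> U"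
  shows "ricci (metric_pullback F h) x v w = ricci h (F x) (F' x v) (F' x w)"
  unfolding ricci_def curvature_pullback[OF assms]
  using inner_form.metric_trace_pullback[OF inner_form_metric[OF F_in[OF assms]] linear_F'[OF assms] inj_F'[OF assms]
    bilinear_curvature[OF F_in[OF assms]]]
  by (simp add: metric_pullback_def[abs_def])

lemma scalar_curvature_pullback:
  assumes "x \<in> U"
  shows "scalar_curvature (metric_pullback F h) x = scalar_curvature h (F x)"
  unfolding scalar_curvature_def ricci_pullback[OF assms, abs_def]
  using inner_form.metric_trace_pullback[OF inner_form_metric[OF F_in[OF assms]] linear_F'[OF assms] inj_F'[OF assms]
    bilinear_ricci[OF F_in[OF assms]]]
  by (simp add: metric_pullback_def[abs_def])

end

text \<open>\<open>form2 B u v\<close> and \<open>form4 T u v w z\<close> are the values of the complex multilinear extensions on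
  the \<open>(1,0)\<close>-parts of \<open>u\<close>, \<open>w\<close> and the \<open>(0,1)\<close>-parts of \<open>v\<close>, \<open>z\<close>.\<close>

definition rotate :: "bool \<Rightarrow> complex ^ 'n::finite \<Rightarrow> complex ^ 'n" where
  "rotate a u = (if a then \<i> *s u else u)"

definition form2 ::
  "((complex ^ 'n::finite) \<Rightarrow> (complex ^ 'n) \<Rightarrow> real) \<Rightarrow> complex ^ 'n \<Rightarrow> complex ^ 'n \<Rightarrow> complex" where
  "form2 B u v =
     (\<Sum>a\<in>UNIV. \<Sum>b\<in>UNIV. hol_coeff a * cnj (hol_coeff b) * complex_of_real (B (rotate a u) (rotate b v)))"

definition form4 ::
  "((complex ^ 'n::finite) \<Rightarrow> (complex ^ 'n) \<Rightarrow> (complex ^ 'n) \<Rightarrow> (complex ^ 'n) \<Rightarrow> real)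
     \<Rightarrow> complex ^ 'n \<Rightarrow> complex ^ 'n \<Rightarrow> complex ^ 'n \<Rightarrow> complex ^ 'n \<Rightarrow> complex" where
  "form4 T u v w z =
     (\<Sum>a\<in>UNIV. \<Sum>b\<in>UNIV. \<Sum>c\<in>UNIV. \<Sum>d\<in>UNIV.
        hol_coeff a * cnj (hol_coeff b) * hol_coeff c * cnj (hol_coeff d)
        * complex_of_real (T (rotate a u) (rotate b v) (rotate c w) (rotate d z)))"

text \<open>Taken on arbitrary vectors because a change of charts does not map coordinate frames to
  coordinate frames.\<close>

definition bochner_form ::
  "(complex ^ 'n::finite) metric_field \<Rightarrow> complex ^ 'n \<Rightarrow> complex ^ 'n \<Rightarrow> complex ^ 'n \<Rightarrow> complex ^ 'n \<Rightarrow> complex ^ 'n \<Rightarrow> complex" where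
  "bochner_form h x u v w z =
     (let n = of_nat CARD('n);
          g = form2 (h x);
          \<rho> = form2 (ricci h x);
          \<tau> = complex_of_real (scalar_curvature h x)
      in form4 (curvature h x) u v w z
         - 1 / (n + 2) * (g u v * \<rho> w z + g w v * \<rho> u z + g w z * \<rho> u v + g u z * \<rho> w v)
         + \<tau> / (2 * (n + 1) * (n + 2)) * (g u v * g w z + g w v * g u z))"

lemma real_frame_eq_rotate: "real_frame \<alpha> a = rotate a (axis \<alpha> 1)"
  by (simp add: real_frame_def rotate_def vec_eq_iff axis_def)

lemma bochner_component_eq:
  "bochner_component h x \<alpha> \<beta> \<gamma> \<delta> = bochner_form h x (axis \<alpha> 1) (axis \<beta> 1) (axis \<gamma> 1) (axis \<delta> 1)"
  by (simp add: bochner_component_def bochner_form_def component2_def component4_def form2_def form4_def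
      real_frame_eq_rotate)

text \<open>A complex linear derivative commutes with \<open>rotate\<close>, hence respects (1,0)-
  and (0,1)-parts; the rest is naturality of curvature and its traces.\<close>

lemma bochner_form_pullback:
  fixes V :: "(complex ^ 'n::finite) set"
  assumes "levi_civita_pullback V h \<Gamma> U F" "x \<in> U"
    and C: "\<And>u. frechet_derivative F (at x) (\<i> *s u) = \<i> *s frechet_derivative F (at x) u"
  shows "bochner_form (metric_pullback F h) x u v w z
    = bochner_form h (F x) (frechet_derivative F (at x) u) (frechet_derivative F (at x) v)
        (frechet_derivative F (at x) w) (frechet_derivative F (at x) z)"
proof -
  interpret levi_civita_pullback V h \<Gamma> U F by (rule assms(1))
  have rot: "F' x (rotate a u) = rotate a (F' x u)" for a u
    by (simp add: rotate_def C)
  show ?thesis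
    by (simp add: bochner_form_def form2_def form4_def curvature_pullback ricci_pullback
        scalar_curvature_pullback assms(2) rot metric_pullback_def)
qed


section \<open>The Hermitian product\<close>

definition hprod :: "complex ^ 'n::finite \<Rightarrow> complex ^ 'n \<Rightarrow> complex" where
  "hprod u v = (\<Sum>i\<in>UNIV. u $ i * cnj (v $ i))"

lemma hprod_simps [simp]:
  "hprod 0 v = 0" "hprod u 0 = 0"
  "hprod (c *s u) v = c * hprod u v" "hprod u (c *s v) = cnj c * hprod u v"
  "hprod (a *\<^sub>R u) v = of_real a * hprod u v" "hprod u (a *\<^sub>R v) = of_real a * hprod u v"
  by (simp_all add: hprod_def sum_distrib_left algebra_simps scaleR_conv_of_real[where 'a = complex])

lemma hprod_add:
  "hprod (u + u') v = hprod u v + hprod u' v" "hprod u (v + v') = hprod u v + hprod u v'"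
  "hprod (u - u') v = hprod u v - hprod u' v" "hprod (- u) v = - hprod u v"
  by (simp_all add: hprod_def sum.distrib sum_subtractf sum_negf algebra_simps)

lemma cnj_hprod: "cnj (hprod u v) = hprod v u"
  by (simp add: hprod_def mult.commute)

lemma inner_eq_Re_hprod: "u \<bullet> v = Re (hprod u v)"
  by (simp add: hprod_def inner_vec_def inner_complex_def)

lemma hprod_self: "hprod u u = of_real (u \<bullet> u)"
  by (simp add: complex_eq_iff inner_eq_Re_hprod) (metis cnj_hprod complex_cnj_cancel_iff complex_is_Real_iff Reals_cnj_iff)

lemma two_inner: "complex_of_real (2 * (u \<bullet> v)) = hprod u v + hprod v u"
  using complex_add_cnj[of "hprod u v"] by (simp add: inner_eq_Re_hprod cnj_hprod)

lemma bounded_bilinear_hprod: "bounded_bilinear (hprod :: complex ^ 'n::finite \<Rightarrow> _)"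
  by (subst bilinear_conv_bounded_bilinear[symmetric])
    (auto simp: bilinear_def linear_iff hprod_add scaleR_conv_of_real[where 'a = complex])

lemma bounded_bilinear_cvec_scale:
  "bounded_bilinear ((*s) :: complex \<Rightarrow> complex ^ 'n::finite \<Rightarrow> complex ^ 'n)"
  by (subst bilinear_conv_bounded_bilinear[symmetric])
    (auto simp: bilinear_def linear_iff vec_eq_iff scaleR_conv_of_real[where 'a = complex] algebra_simps)

lemma has_derivative_norm_square_compose:
  fixes y :: "'a::real_inner"
  assumes "(f has_real_derivative f') (at (y \<bullet> y))"
  shows "((\<lambda>y. f (y \<bullet> y)) has_derivative (\<lambda>d. f' * (2 * (y \<bullet> d)))) (at y)"
proof -
  have "((\<lambda>y. y \<bullet> y) has_derivative (\<lambda>d. 2 * (y \<bullet> d))) (at y)"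
    by (auto intro!: derivative_eq_intros simp: inner_commute)
  from has_derivative_compose[OF this assms[unfolded has_field_derivative_def]] show ?thesis .
qed

lemma sum_Basis_cvec:
  fixes L :: "complex ^ 'n::finite \<Rightarrow> complex ^ 'n"
  shows "(\<Sum>i\<in>Basis. L i \<bullet> i) = (\<Sum>k\<in>UNIV. Re (L (axis k 1) $ k) + Im (L (axis k \<i>) $ k))"
proof -
  have inj: "inj_on (\<lambda>(k, b). axis k b :: complex ^ 'n) (UNIV \<times> Basis)"
    by (auto simp: inj_on_def axis_eq_axis Basis_complex_def)
  have B: "(Basis :: (complex ^ 'n) set) = (\<lambda>(k, b). axis k b) ` (UNIV \<times> Basis)"
    by (auto simp: Basis_vec_def)
  have "(\<Sum>i\<in>Basis. L i \<bullet> i) = (\<Sum>k\<in>UNIV. \<Sum>b\<in>Basis. L (axis k b) \<bullet> axis k b)"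
    unfolding B sum.reindex[OF inj] by (simp add: sum.cartesian_product split_def)
  then show ?thesis by (simp add: Basis_complex_def inner_axis inner_complex_def)
qed

text \<open>The real trace of a complex linear map is twice the real part of its complex
  trace.\<close>

lemma trace_scale:
  "(\<Sum>i\<in>(Basis :: (complex ^ 'n::finite) set). (c *s i) \<bullet> i) = 2 * real CARD('n) * Re c"
  unfolding sum_Basis_cvec[of "(*s) c"] by (simp add: axis_def)

lemma trace_rank_one: "(\<Sum>i\<in>Basis. (hprod i y *s p) \<bullet> i) = 2 * Re (hprod p y)"
proof -
  have "hprod (axis k c) y = c * cnj (y $ k)" for k c
    by (simp add: hprod_def axis_def if_distrib if_distribR cong: if_cong)
  then show ?thesis
    unfolding sum_Basis_cvec[of "\<lambda>i. hprod i y *s p"]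
    by (simp add: hprod_def[of p] sum_distrib_left algebra_simps sum.distrib)
qed

text \<open>An antilinear map anticommutes with multiplication by i: the contributions of
  \<open>axis k 1\<close> and \<open>axis k \<i>\<close> cancel.\<close>

lemma trace_antilinear: "(\<Sum>i\<in>Basis. (hprod y i *s p) \<bullet> i) = 0"
proof -
  have "hprod y (axis k c) = cnj c * y $ k" for k c
    by (simp add: hprod_def axis_def if_distrib if_distribR cong: if_cong)
  then show ?thesis
    unfolding sum_Basis_cvec[of "\<lambda>i. hprod y i *s p"] by (simp add: algebra_simps)
qed

text \<open>\<open>Re G\<close> is half the sum of \<open>G\<close> and its conjugate. On the
  (1,0)-part of \<open>u\<close> and the (0,1)-part of \<open>v\<close> the extension of
  \<open>G\<close> has the value \<open>G u v\<close>, and that of the conjugate vanishes.\<close>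

lemma form2_Re:
  assumes "\<And>u v. G (\<i> *s u) v = \<i> * G u v" "\<And>u v. G u (\<i> *s v) = - \<i> * G u v"
  shows "form2 (\<lambda>u v. Re (G u v)) u v = G u v / 2"
  by (simp add: form2_def UNIV_bool rotate_def hol_coeff_def assms complex_eq_iff)

lemma form4_Re:
  assumes "\<And>u v w z. G (\<i> *s u) v w z = \<i> * G u v w z" "\<And>u v w z. G u (\<i> *s v) w z = - \<i> * G u v w z"
    and "\<And>u v w z. G u v (\<i> *s w) z = \<i> * G u v w z" "\<And>u v w z. G u v w (\<i> *s z) = - \<i> * G u v w z"
  shows "form4 (\<lambda>u v w z. Re (G u v w z)) u v w z = G u v w z / 2"
  by (simp add: form4_def UNIV_bool rotate_def hol_coeff_def assms complex_eq_iff)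

text \<open>The types of the first two slots are exchanged, so the (1,0)-part of \<open>u\<close>
  annihilates \<open>G\<close>; the conjugate of \<open>G\<close> is annihilated in the third
  slot.\<close>

lemma form4_Re_other_type:
  assumes "\<And>u v w z. G (\<i> *s u) v w z = - \<i> * G u v w z" "\<And>u v w z. G u (\<i> *s v) w z = \<i> * G u v w z"
    and "\<And>u v w z. G u v (\<i> *s w) z = \<i> * G u v w z" "\<And>u v w z. G u v w (\<i> *s z) = - \<i> * G u v w z"
  shows "form4 (\<lambda>u v w z. Re (G u v w z)) u v w z = 0"
  by (simp add: form4_def UNIV_bool rotate_def hol_coeff_def assms complex_eq_iff)

lemma form4_diff: "form4 (\<lambda>u v w z. S u v w z - T u v w z) u v w z = form4 S u v w z - form4 T u v w z"
  by (simp add: form4_def algebra_simps sum_subtractf)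


section \<open>Radial Kaehler metrics\<close>

text \<open>\<open>m\<close> is x dY/dx and \<open>m2\<close> is x Y dm/dx. With these the list of
  functions is closed under differentiation up to \<open>m2\<close>, the highest derivative that the
  curvature contains.\<close>

locale radial_metric =
  fixes J :: "real set" and x Y m m2 :: "real \<Rightarrow> real"
  assumes open_J: "open J"
    and J_pos: "\<rho> \<in> J \<Longrightarrow> \<rho> > 0"
    and x_pos: "\<rho> \<in> J \<Longrightarrow> x \<rho> > 0"
    and Y_ge_1: "\<rho> \<in> J \<Longrightarrow> Y \<rho> \<ge> 1"
    and x_deriv: "\<rho> \<in> J \<Longrightarrow> (x has_real_derivative x \<rho> * Y \<rho> / \<rho>) (at \<rho>)"
    and Y_deriv: "\<rho> \<in> J \<Longrightarrow> (Y has_real_derivative m \<rho> * Y \<rho> / \<rho>) (at \<rho>)"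
    and m_deriv: "\<rho> \<in> J \<Longrightarrow> (m has_real_derivative m2 \<rho> / \<rho>) (at \<rho>)"
begin

text \<open>For a Kaehler potential \<phi>(\<rho>), \<open>a\<close> is \<phi>' and \<open>b\<close>
  is \<phi>''. \<open>A\<close> is the logarithmic derivative of \<open>a\<close>, and
  \<open>B\<close> solves (a + b \<rho>) B = b' - 2 b A, as the Koszul identity for
  \<open>conn\<close> demands.\<close>

definition a :: "real \<Rightarrow> real" where "a \<rho> = x \<rho> / \<rho>"
definition b :: "real \<Rightarrow> real" where "b \<rho> = x \<rho> * (Y \<rho> - 1) / \<rho>\<^sup>2"
definition b' :: "real \<Rightarrow> real" where
  "b' \<rho> = (x \<rho> * Y \<rho> * (Y \<rho> - 1) + x \<rho> * m \<rho> * Y \<rho> - 2 * x \<rho> * (Y \<rho> - 1)) / \<rho> ^ 3"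
definition A :: "real \<Rightarrow> real" where "A \<rho> = (Y \<rho> - 1) / \<rho>"
definition A' :: "real \<Rightarrow> real" where "A' \<rho> = (m \<rho> * Y \<rho> - Y \<rho> + 1) / \<rho>\<^sup>2"
definition B :: "real \<Rightarrow> real" where "B \<rho> = (m \<rho> - Y \<rho> + 1) / \<rho>\<^sup>2"
definition B' :: "real \<Rightarrow> real" where
  "B' \<rho> = (m2 \<rho> - m \<rho> * Y \<rho> - 2 * (m \<rho> - Y \<rho> + 1)) / \<rho> ^ 3"

lemma a_deriv: "\<rho> \<in> J \<Longrightarrow> (a has_real_derivative b \<rho>) (at \<rho>)"
  using J_pos[of \<rho>] unfolding a_def[abs_def] b_def
  by (auto intro!: derivative_eq_intros x_deriv simp: field_simps power2_eq_square)

lemma b_deriv: "\<rho> \<in> J \<Longrightarrow> (b has_real_derivative b' \<rho>) (at \<rho>)"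
  using J_pos[of \<rho>] unfolding b_def[abs_def] b'_def
  by (auto intro!: derivative_eq_intros x_deriv Y_deriv simp: divide_simps)
    (simp add: algebra_simps eval_nat_numeral)

lemma A_deriv: "\<rho> \<in> J \<Longrightarrow> (A has_real_derivative A' \<rho>) (at \<rho>)"
  using J_pos[of \<rho>] unfolding A_def[abs_def] A'_def
  by (auto intro!: derivative_eq_intros Y_deriv simp: field_simps power2_eq_square)

lemma B_deriv: "\<rho> \<in> J \<Longrightarrow> (B has_real_derivative B' \<rho>) (at \<rho>)"
  using J_pos[of \<rho>] unfolding B_def[abs_def] B'_def
  by (auto intro!: derivative_eq_intros Y_deriv m_deriv simp: divide_simps)
    (simp add: algebra_simps eval_nat_numeral)

text \<open>The first two make \<open>conn\<close> compatible with the metric; the third lets the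
  terms of the curvature that are complex linear in both directions cancel.\<close>

lemma coefficient_identities:
  assumes "\<rho> \<in> J"
  shows "a \<rho> * A \<rho> = b \<rho>"
    and "a \<rho> * B \<rho> + b \<rho> * B \<rho> * \<rho> + 2 * b \<rho> * A \<rho> = b' \<rho>"
    and "A' \<rho> = B \<rho> + (A \<rho>)\<^sup>2 + A \<rho> * B \<rho> * \<rho>"
  using J_pos[OF assms]
  by (simp_all add: a_def b_def b'_def A_def B_def A'_def field_simps power2_eq_square power3_eq_cube)

lemma a_pos: "\<rho> \<in> J \<Longrightarrow> a \<rho> > 0"
  using J_pos x_pos by (simp add: a_def)

lemma b_nonneg: "\<rho> \<in> J \<Longrightarrow> b \<rho> \<ge> 0"
  using J_pos[of \<rho>] x_pos[of \<rho>] Y_ge_1[of \<rho>] by (simp add: b_def)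

definition dom :: "(complex ^ 'n::finite) set" where
  "dom = {y. y \<bullet> y \<in> J}"

definition hC :: "complex ^ 'n::finite \<Rightarrow> complex ^ 'n \<Rightarrow> complex ^ 'n \<Rightarrow> complex" where
  "hC y u v = of_real (a (y \<bullet> y)) * hprod u v + of_real (b (y \<bullet> y)) * (hprod u y * hprod y v)"

definition metric :: "(complex ^ 'n::finite) metric_field" where
  "metric y u v = Re (hC y u v)"

text \<open>The complex bilinear connection h^-1 \<partial>h of the Hermitian form
  \<open>hC\<close>; for a Kaehler metric it is the Levi-Civita connection.\<close>

definition conn :: "complex ^ 'n::finite \<Rightarrow> complex ^ 'n \<Rightarrow> complex ^ 'n \<Rightarrow> complex ^ 'n" where
  "conn y u v = (of_real (A (y \<bullet> y)) * hprod u y) *s v + (of_real (A (y \<bullet> y)) * hprod v y) *s u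
     + (of_real (B (y \<bullet> y)) * (hprod u y * hprod v y)) *s y"

text \<open>The antilinear part in \<open>u\<close> of the derivative of \<open>conn y v w\<close> in the direction \<open>u\<close>. The linear
  part and the quadratic terms of the curvature cancel, so that this is all that enters.\<close>

definition half_curv :: "complex ^ 'n::finite \<Rightarrow> complex ^ 'n \<Rightarrow> complex ^ 'n \<Rightarrow> complex ^ 'n \<Rightarrow> complex ^ 'n" where
  "half_curv y u v w = (let r = y \<bullet> y in
     (of_real (A' r) * hprod y u * hprod v y + of_real (A r) * hprod v u) *s w
   + (of_real (A' r) * hprod y u * hprod w y + of_real (A r) * hprod w u) *s v
   + (of_real (B' r) * hprod y u * hprod v y * hprod w y
      + of_real (B r) * (hprod v u * hprod w y + hprod w u * hprod v y)) *s y)"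

lemma open_dom: "open dom"
proof -
  have "continuous_on UNIV (\<lambda>y. y \<bullet> y :: real)" by (intro continuous_intros)
  then show ?thesis using open_vimage[OF open_J] by (simp add: dom_def vimage_def)
qed

lemma has_derivative_radial:
  fixes y :: "complex ^ 'n::finite"
  assumes "(f has_real_derivative f') (at (y \<bullet> y))"
  shows "((\<lambda>y. complex_of_real (f (y \<bullet> y))) has_derivative (\<lambda>d. of_real f' * (hprod y d + hprod d y))) (at y)"
  using has_derivative_of_real[OF has_derivative_norm_square_compose[OF assms], where 'a = complex]
  by (simp only: of_real_mult[of f'] two_inner)

lemmas hprod_FDERIV = bounded_bilinear.FDERIV[OF bounded_bilinear_hprod has_derivative_const has_derivative_ident]
  bounded_bilinear.FDERIV[OF bounded_bilinear_hprod has_derivative_ident has_derivative_const]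

lemma metric_has_derivative:
  fixes y :: "complex ^ 'n::finite"
  assumes "y \<in> dom"
  shows "((\<lambda>y. metric y u v) has_derivative (\<lambda>d. Re (
     of_real (b (y \<bullet> y)) * (hprod y d + hprod d y) * hprod u v
     + of_real (b' (y \<bullet> y)) * (hprod y d + hprod d y) * (hprod u y * hprod y v)
     + of_real (b (y \<bullet> y)) * (hprod u d * hprod y v + hprod u y * hprod d v)))) (at y)"
proof -
  have J: "y \<bullet> y \<in> J" using assms by (simp add: dom_def)
  show ?thesis
    unfolding metric_def hC_def
    by (rule has_derivative_eq_rhs,
        (rule has_derivative_Re has_derivative_const hprod_FDERIV has_derivative_radial a_deriv b_deriv J
          has_derivative_add has_derivative_mult)+)
      (simp add: fun_eq_iff algebra_simps)
qed

lemma conn_has_derivative: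
  fixes y :: "complex ^ 'n::finite"
  assumes "y \<in> dom"
  shows "((\<lambda>y. conn y u v) has_derivative (\<lambda>d.
     (of_real (A' (y \<bullet> y)) * (hprod y d + hprod d y) * hprod u y + of_real (A (y \<bullet> y)) * hprod u d) *s v
     + (of_real (A' (y \<bullet> y)) * (hprod y d + hprod d y) * hprod v y + of_real (A (y \<bullet> y)) * hprod v d) *s u
     + (of_real (B' (y \<bullet> y)) * (hprod y d + hprod d y) * (hprod u y * hprod v y)
        + of_real (B (y \<bullet> y)) * (hprod u d * hprod v y + hprod u y * hprod v d)) *s y
     + (of_real (B (y \<bullet> y)) * (hprod u y * hprod v y)) *s d)) (at y)"
proof -
  have J: "y \<bullet> y \<in> J" using assms by (simp add: dom_def)
  show ?thesis
    unfolding conn_def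
    by (rule has_derivative_eq_rhs,
        (rule has_derivative_const has_derivative_ident hprod_FDERIV has_derivative_radial A_deriv B_deriv J
          has_derivative_add has_derivative_mult bounded_bilinear.FDERIV[OF bounded_bilinear_cvec_scale])+)
      (simp add: fun_eq_iff vec_eq_iff algebra_simps)
qed

text \<open>The Koszul identity with the Hermitian products replaced by free complex variables;
  \<open>p\<close>, \<open>q\<close>, \<open>r\<close> are the products of \<open>u\<close>,
  \<open>v\<close>, \<open>z\<close> with the point. This settles once which products appear
  conjugated.\<close>

lemma conn_koszul_algebra:
  fixes p q r uv uz vz :: complex and a b b' :: real
  shows "2 * Re (of_real b * (p * vz + q * uz) + of_real b' * (p * q * cnj r))
    = Re (of_real b * (cnj p + p) * vz + of_real b' * (cnj p + p) * (q * cnj r) + of_real b * (cnj uv * cnj r + q * uz))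
    + Re (of_real b * (cnj q + q) * uz + of_real b' * (cnj q + q) * (p * cnj r) + of_real b * (uv * cnj r + p * vz))
    - Re (of_real b * (cnj r + r) * uv + of_real b' * (cnj r + r) * (p * cnj q) + of_real b * (uz * cnj q + p * cnj vz))"
  by (simp add: algebra_simps)

text \<open>The right-hand side is the part of the derivative of \<open>hC y v z\<close> in the
  direction \<open>u\<close> that is complex linear in \<open>u\<close>.\<close>

lemma hC_conn:
  assumes "y \<in> dom"
  shows "hC y (conn y u v) z = of_real (b (y \<bullet> y)) * (hprod u y * hprod v z + hprod v y * hprod u z)
     + of_real (b' (y \<bullet> y)) * (hprod u y * hprod v y * hprod y z)"
proof -
  let ?r = "y \<bullet> y"
  have J: "?r \<in> J" using assms by (simp add: dom_def)
  have "hC y (conn y u v) z = of_real (a ?r * A ?r) * (hprod u y * hprod v z + hprod v y * hprod u z)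
     + of_real (a ?r * B ?r + b ?r * B ?r * ?r + 2 * b ?r * A ?r) * (hprod u y * hprod v y * hprod y z)"
    by (simp add: hC_def conn_def hprod_add hprod_self algebra_simps)
  then show ?thesis using coefficient_identities[OF J] by simp
qed

sublocale levi_civita dom metric conn
proof
  show "open dom" by (rule open_dom)
  fix y u v z :: "complex ^ 'n" assume y: "y \<in> dom"
  then have J: "y \<bullet> y \<in> J" by (simp add: dom_def)
  show "bilinear (metric y)"
    by (auto simp: bilinear_def linear_iff metric_def hC_def hprod_add algebra_simps)
  show "metric y u v = metric y v u"
    unfolding metric_def hC_def
    by (subst (1) cnj_hprod[symmetric], subst (2) cnj_hprod[symmetric], subst (3) cnj_hprod[symmetric])
      (simp add: algebra_simps)
  show "metric y u u > 0" if "u \<noteq> 0"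
  proof -
    \<comment> \<open>Positivity uses Y >= 1, through \<open>b_nonneg\<close>.\<close>
    have "metric y u u = a (y \<bullet> y) * (u \<bullet> u) + b (y \<bullet> y) * (cmod (hprod u y))\<^sup>2"
      unfolding metric_def hC_def cnj_hprod[of u y, symmetric] hprod_self complex_norm_square[symmetric] by simp
    then show ?thesis using a_pos[OF J] b_nonneg[OF J] that by (simp add: add_pos_nonneg)
  qed
  show "(\<lambda>y. metric y u v) differentiable (at y)"
    using metric_has_derivative[OF y] by (rule differentiableI)
  show "bilinear (conn y)"
    by (auto simp: bilinear_def linear_iff conn_def hprod_add vec_eq_iff scaleR_conv_of_real[where 'a = complex] algebra_simps)
  show "(\<lambda>y. conn y u v) differentiable (at y)"
    using conn_has_derivative[OF y] by (rule differentiableI)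
  show "2 * metric y (conn y u v) z = frechet_derivative (\<lambda>y. metric y v z) (at y) u
      + frechet_derivative (\<lambda>y. metric y u z) (at y) v
      - frechet_derivative (\<lambda>y. metric y u v) (at y) z"
    unfolding frechet_derivative_at[OF metric_has_derivative[OF y], symmetric]
    unfolding metric_def hC_conn[OF y]
    using conn_koszul_algebra[of "b (y \<bullet> y)" "hprod u y" "hprod v z" "hprod v y" "hprod u z" "b' (y \<bullet> y)" "hprod z y" "hprod u v"]
    by (simp only: cnj_hprod)
qed

lemma curvature_op_eq:
  fixes y :: "complex ^ 'n::finite"
  assumes "y \<in> dom"
  shows "curvature_op metric (\<lambda>_. u) (\<lambda>_. v) (\<lambda>_. w) y = half_curv y u v w - half_curv y v u w"
proof -
  let ?r = "y \<bullet> y"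
  have J: "?r \<in> J" using assms by (simp add: dom_def)
  \<comment> \<open>After this substitution the derivative terms that are linear in both directions
    cancel against the quadratic terms of the connection.\<close>
  have A': "complex_of_real (A' ?r) = of_real (B ?r) + (of_real (A ?r))\<^sup>2 + of_real (A ?r) * of_real (B ?r) * of_real ?r"
    by (subst coefficient_identities(3)[OF J]) simp
  show ?thesis
    unfolding curvature_op_const[OF assms] second_cov_deriv_def
      frechet_derivative_at[OF conn_has_derivative[OF assms], symmetric]
    by (simp add: vec_eq_iff conn_def half_curv_def Let_def hprod_add hprod_self A' power2_eq_square algebra_simps)
qed

text \<open>\<open>P\<close> is the derivative of the logarithm of the determinant of the metric in complex dimension
  \<open>N\<close>, and \<open>Q = P'\<close>.\<close>

definition P :: "real \<Rightarrow> real \<Rightarrow> real" where "P N \<rho> = (N * (Y \<rho> - 1) + m \<rho>) / \<rho>"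
definition Q :: "real \<Rightarrow> real \<Rightarrow> real" where
  "Q N \<rho> = (N * m \<rho> * Y \<rho> + m2 \<rho> - N * (Y \<rho> - 1) - m \<rho>) / \<rho>\<^sup>2"
text \<open>The complex trace of the endomorphism that represents \<open>rC\<close> with respect to
  \<open>hC\<close>; the scalar curvature is -4 times this.\<close>

definition \<sigma> :: "real \<Rightarrow> real \<Rightarrow> real" where
  "\<sigma> N \<rho> = ((N - 1) * (N * (Y \<rho> - 1) + m \<rho>) + N * m \<rho> + m2 \<rho> / Y \<rho>) / x \<rho>"

text \<open>The complex trace of \<open>conn y u\<close> is \<open>P\<close> times the product of
  \<open>u\<close> with \<open>y\<close>: the logarithmic derivative of a determinant is a trace.
  The second identity is the derivative of the first.\<close>

lemma P_Q_eq:
  assumes "\<rho> \<in> J"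
  shows "P N \<rho> = (N + 1) * A \<rho> + B \<rho> * \<rho>" "Q N \<rho> = (N + 1) * A' \<rho> + B' \<rho> * \<rho> + B \<rho>"
  using J_pos[OF assms]
  by (simp_all add: P_def Q_def A_def A'_def B_def B'_def field_simps eval_nat_numeral)

text \<open>The Hermitian form of mixed second derivatives of the logarithm of the determinant of
  the metric.\<close>

definition rC :: "complex ^ 'n::finite \<Rightarrow> complex ^ 'n \<Rightarrow> complex ^ 'n \<Rightarrow> complex" where
  "rC y u v = of_real (P (real CARD('n)) (y \<bullet> y)) * hprod u v
     + of_real (Q (real CARD('n)) (y \<bullet> y)) * (hprod u y * hprod y v)"

lemma Re_rC_sym: "Re (rC y u v) = Re (rC y v u)"
proof -
  have "cnj (rC y u v) = rC y v u" by (simp add: rC_def cnj_hprod mult.commute)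
  then show ?thesis by (metis complex_cnj(1) complex.sel(1) cnj.simps(1))
qed

lemma ricci_metric:
  fixes y :: "complex ^ 'n::finite"
  assumes "y \<in> dom"
  shows "ricci metric y v w = Re (- 2 * rC y v w)"
proof -
  let ?r = "y \<bullet> y"
  have J: "?r \<in> J" using assms by (simp add: dom_def)
  \<comment> \<open>Sorted by the traced argument \<open>i\<close>: one half of the curvature is
    antilinear in \<open>i\<close> and has trace zero, the other is a multiple of the identity plus
    two maps of rank one.\<close>
  define c where "c = of_real (A' ?r) * hprod y v * hprod w y + of_real (A ?r) * hprod w v"
  define q1 where "q1 = (of_real (A' ?r) * hprod y v) *s w
      + (of_real (B' ?r) * hprod y v * hprod w y + of_real (B ?r) * hprod w v) *s y"
  define q2 where "q2 = of_real (A ?r) *s w + (of_real (B ?r) * hprod w y) *s y"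
  define p1 where "p1 = (of_real (A' ?r) * hprod v y) *s w + (of_real (A' ?r) * hprod w y) *s v
      + (of_real (B' ?r) * hprod v y * hprod w y) *s y"
  define p3 where "p3 = of_real (A ?r) *s v + (of_real (B ?r) * hprod v y) *s y"
  have "half_curv y i v w = hprod y i *s p1 + hprod v i *s q2 + hprod w i *s p3" for i
    by (simp add: half_curv_def Let_def p1_def q2_def p3_def vec_eq_iff algebra_simps)
  moreover have "half_curv y v i w = c *s i + hprod i y *s q1 + hprod i v *s q2" for i
    by (simp add: half_curv_def Let_def c_def q1_def q2_def vec_eq_iff algebra_simps)
  ultimately have "ricci metric y v w
    = - (2 * real CARD('n) * Re c + 2 * Re (hprod q1 y) + 2 * Re (hprod q2 v))"
    unfolding ricci_eq[OF assms] curvature_op_eq[OF assms]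
    by (simp add: inner_diff_left inner_add_left sum_subtractf sum.distrib trace_scale trace_rank_one trace_antilinear)
  also have "\<dots> = Re (- 2 * (of_nat CARD('n) * c + hprod q1 y + hprod q2 v))" by simp
  also have "of_nat CARD('n) * c + hprod q1 y + hprod q2 v = rC y w v"
    unfolding rC_def P_Q_eq[OF J] c_def q1_def q2_def
    by (simp add: hprod_add hprod_self algebra_simps)
  finally show ?thesis using Re_rC_sym[of y w v] by simp
qed

lemma scalar_curvature_metric:
  fixes y :: "complex ^ 'n::finite"
  assumes "y \<in> dom"
  shows "scalar_curvature metric y = - 4 * \<sigma> (real CARD('n)) (y \<bullet> y)"
proof -
  let ?r = "y \<bullet> y" and ?N = "real CARD('n)"
  have J: "?r \<in> J" using assms by (simp add: dom_def)
  have ab: "a ?r > 0" "a ?r + b ?r * ?r > 0" using a_pos[OF J] b_nonneg[OF J] J_pos[OF J]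
    by (auto intro: add_pos_nonneg)
  \<comment> \<open>The Ricci endomorphism is -2 times a combination of the identity and the rank
    one map along \<open>y\<close>; its coefficients solve P = a \<alpha> and Q = b \<alpha> + (a +
    b \<rho>) \<beta>.\<close>
  define \<alpha> where "\<alpha> = P ?N ?r / a ?r"
  define \<beta> where "\<beta> = (Q ?N ?r - b ?r * \<alpha>) / (a ?r + b ?r * ?r)"
  have \<alpha>: "P ?N ?r = a ?r * \<alpha>" using ab by (simp add: \<alpha>_def)
  have "\<beta> * (a ?r + b ?r * ?r) = Q ?N ?r - b ?r * \<alpha>" using ab by (simp add: \<beta>_def)
  then have \<beta>: "Q ?N ?r = a ?r * \<beta> + b ?r * ?r * \<beta> + b ?r * \<alpha>" by (simp add: algebra_simps)
  define L where "L u = of_real (- 2 * \<alpha>) *s u + hprod u y *s (of_real (- 2 * \<beta>) *s y)" for u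
  have L: "linear L" by (auto simp: linear_iff L_def vec_eq_iff hprod_add scaleR_conv_of_real[where 'a = complex] algebra_simps)
  have "ricci metric y = (\<lambda>u v. metric y (L u) v)"
    unfolding ricci_metric[OF assms, abs_def] metric_def
    by (intro ext arg_cong[of _ _ Re]) (simp add: rC_def hC_def L_def \<alpha> \<beta> hprod_add hprod_self algebra_simps)
  then have "scalar_curvature metric y = (\<Sum>i\<in>Basis. L i \<bullet> i)"
    unfolding scalar_curvature_def
    by (simp add: inner_form.metric_trace_linear[OF inner_form_metric[OF assms] L])
  also have "\<dots> = - 4 * (?N * \<alpha> + \<beta> * ?r)"
    unfolding L_def inner_add_left sum.distrib trace_scale trace_rank_one by (simp add: hprod_self hprod_add)
  also have "?N * \<alpha> + \<beta> * ?r = \<sigma> ?N ?r"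
  proof -
    have r: "?r > 0" "x ?r > 0" "Y ?r > 0" using J_pos[OF J] x_pos[OF J] Y_ge_1[OF J] by auto
    have 1: "\<alpha> = (?N * (Y ?r - 1) + m ?r) / x ?r" using r by (simp add: \<alpha>_def P_def a_def)
    have 2: "a ?r + b ?r * ?r = x ?r * Y ?r / ?r" using r by (simp add: a_def b_def field_simps power2_eq_square)
    have "\<beta> * ?r = ((?N * m ?r * Y ?r + m2 ?r - ?N * (Y ?r - 1) - m ?r) - (Y ?r - 1) * (?N * (Y ?r - 1) + m ?r)) / (x ?r * Y ?r)"
      unfolding \<beta>_def 2 unfolding 1 Q_def b_def
      using r by (simp add: divide_simps) (simp add: algebra_simps eval_nat_numeral)
    then show ?thesis unfolding 1 \<sigma>_def using r by (simp add: divide_simps) (simp add: algebra_simps)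
  qed
  finally show ?thesis .
qed

lemma form2_metric: "form2 (metric y) u v = hC y u v / 2"
  unfolding metric_def[abs_def] by (rule form2_Re) (simp_all add: hC_def algebra_simps)

lemma form2_ricci:
  assumes "y \<in> dom" shows "form2 (ricci metric y) u v = - rC y u v"
proof -
  have "ricci metric y = (\<lambda>u v. Re (- 2 * rC y u v))" by (intro ext ricci_metric[OF assms])
  then have "form2 (ricci metric y) u v = - 2 * rC y u v / 2"
    by (simp only:) (rule form2_Re, simp_all add: rC_def algebra_simps)
  then show ?thesis by simp
qed

lemma hC_half_curv:
  fixes y :: "complex ^ 'n::finite"
  defines "r \<equiv> y \<bullet> y"
  shows "hC y (half_curv y v u w) z =
      of_real (a r * A r) * (hprod u v * hprod w z + hprod w v * hprod u z)
     + of_real (a r * A' r) * (hprod y v * (hprod u y * hprod w z + hprod w y * hprod u z))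
     + of_real (A r * b r + (a r + b r * r) * B r) * (hprod y z * (hprod u v * hprod w y + hprod w v * hprod u y))
     + of_real (2 * A' r * b r + (a r + b r * r) * B' r) * (hprod u y * hprod w y * hprod y v * hprod y z)"
  by (simp add: hC_def half_curv_def Let_def hprod_add hprod_self r_def algebra_simps)

text \<open>The two halves of the curvature have opposite type in the first two slots, and only the
  one that is complex linear in \<open>u\<close> survives.\<close>

lemma form4_curvature:
  assumes "y \<in> dom" shows "form4 (curvature metric y) u v w z = - hC y (half_curv y v u w) z / 2"
proof -
  have sub: "metric y (p - q) z = metric y p z - metric y q z" for p q z
    using bilinear_lsub[OF bilinear_metric[OF assms]] .
  have "curvature metric y = (\<lambda>u v w z. Re (hC y (half_curv y u v w) z) - Re (hC y (half_curv y v u w) z))"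
    by (intro ext) (simp add: curvature_def curvature_op_eq[OF assms] sub, simp add: metric_def)
  then have "form4 (curvature metric y) u v w z
    = form4 (\<lambda>u v w z. Re (hC y (half_curv y u v w) z)) u v w z - form4 (\<lambda>u v w z. Re (hC y (half_curv y v u w) z)) u v w z"
    by (simp only: form4_diff)
  also have "form4 (\<lambda>u v w z. Re (hC y (half_curv y u v w) z)) u v w z = 0"
    by (rule form4_Re_other_type) (simp_all add: hC_half_curv algebra_simps)
  also have "form4 (\<lambda>u v w z. Re (hC y (half_curv y v u w) z)) u v w z = hC y (half_curv y v u w) z / 2"
    by (rule form4_Re[where G = "\<lambda>u v w z. hC y (half_curv y v u w) z"]) (simp_all add: hC_half_curv algebra_simps)
  finally show ?thesis by simp
qed

text \<open>The Bochner coefficients of the products in which the base point occurs zero, two and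
  four times. The quotient with \<sigma> comes from the scalar curvature -4 \<sigma> and from the
  metric components, which are half of \<open>hC\<close>.\<close>

definition K0 :: "real \<Rightarrow> real \<Rightarrow> real" where
  "K0 N \<rho> = a \<rho> * A \<rho> - 2 * a \<rho> * P N \<rho> / (N + 2) + \<sigma> N \<rho> / ((N + 1) * (N + 2)) * (a \<rho>)\<^sup>2"
definition K1 :: "real \<Rightarrow> real \<Rightarrow> real" where
  "K1 N \<rho> = a \<rho> * A' \<rho> - (a \<rho> * Q N \<rho> + b \<rho> * P N \<rho>) / (N + 2) + \<sigma> N \<rho> / ((N + 1) * (N + 2)) * (a \<rho> * b \<rho>)"
definition K2 :: "real \<Rightarrow> real \<Rightarrow> real" where
  "K2 N \<rho> = 2 * A' \<rho> * b \<rho> + (a \<rho> + b \<rho> * \<rho>) * B' \<rho> - 4 * b \<rho> * Q N \<rho> / (N + 2)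
     + 2 * (\<sigma> N \<rho> / ((N + 1) * (N + 2))) * (b \<rho>)\<^sup>2"

lemma bochner_form_metric:
  fixes y u v w z :: "complex ^ 'n::finite"
  assumes "y \<in> dom"
  defines "N \<equiv> real CARD('n)" and "r \<equiv> y \<bullet> y"
  shows "bochner_form metric y u v w z = - 1 / 2 *
    (of_real (K0 N r) * (hprod u v * hprod w z + hprod w v * hprod u z)
     + of_real (K1 N r) * (hprod y v * (hprod u y * hprod w z + hprod w y * hprod u z)
         + hprod y z * (hprod u v * hprod w y + hprod w v * hprod u y))
     + of_real (K2 N r) * (hprod u y * hprod w y * hprod y v * hprod y z))"
proof -
  have J: "r \<in> J" using assms by (simp add: dom_def)
  define s where "s = \<sigma> N r / ((N + 1) * (N + 2))"
  define k where "k = 1 / (N + 2)"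
  \<comment> \<open>Identifies the two mixed coefficients in \<open>hC_half_curv\<close>, those at
    \<open>hprod y v\<close> and at \<open>hprod y z\<close>, so that a single \<open>K1\<close>
    remains.\<close>
  have id: "A r * b r + (a r + b r * r) * B r = a r * A' r"
    using coefficient_identities[OF J] J_pos[OF J] by (simp add: algebra_simps power2_eq_square)
  have K: "K0 N r = a r * A r - 2 * a r * P N r * k + s * (a r)\<^sup>2"
    "K1 N r = a r * A' r - (a r * Q N r + b r * P N r) * k + s * (a r * b r)"
    "K2 N r = 2 * A' r * b r + (a r + b r * r) * B' r - 4 * b r * Q N r * k + 2 * s * (b r)\<^sup>2"
    by (simp_all add: K0_def K1_def K2_def s_def k_def)
  have "N + 1 > 0" "N + 2 > 0" by (simp_all add: N_def add_nonneg_pos)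
  then have "- 4 * \<sigma> N r / (2 * (N + 1) * (N + 2)) = - 2 * s"
    unfolding s_def by (simp add: divide_simps)
  from arg_cong[OF this, of complex_of_real]
  have \<tau>: "complex_of_real (- 4 * \<sigma> N r) / (2 * (of_nat CARD('n) + 1) * (of_nat CARD('n) + 2)) = of_real (- 2 * s)"
    by (simp add: N_def)
  have k: "1 / (of_nat CARD('n) + 2) = complex_of_real k" unfolding k_def N_def by simp
  show ?thesis
    unfolding bochner_form_def Let_def form2_metric form2_ricci[OF assms(1)] form4_curvature[OF assms(1)]
      scalar_curvature_metric[OF assms(1)] N_def[symmetric] r_def[symmetric] \<tau> k hC_half_curv id K
    by (simp add: hC_def rC_def N_def[symmetric] r_def[symmetric] field_simps power2_eq_square)
qed

text \<open>The Euler equation for the profile: m = x y' and m2 = y (x y' + x^2 y'').\<close>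

definition ode :: "real \<Rightarrow> bool" where
  "ode \<rho> \<longleftrightarrow> m2 \<rho> = Y \<rho> * (3 * m \<rho> - 2 * (Y \<rho> - 1))"

text \<open>The factor next to the defect in \<open>ode\<close> never vanishes, so this coefficient
  alone detects the equation.\<close>

lemma K0_eq:
  assumes "\<rho> \<in> J" "N > 0"
  shows "K0 N \<rho> = x \<rho> * (m2 \<rho> - Y \<rho> * (3 * m \<rho> - 2 * (Y \<rho> - 1))) / (Y \<rho> * \<rho>\<^sup>2 * ((N + 1) * (N + 2)))"
proof -
  have "\<rho> > 0" "x \<rho> > 0" "Y \<rho> > 0" "N + 1 > 0" "N + 2 > 0"
    using J_pos x_pos Y_ge_1[of \<rho>] assms by auto
  then show ?thesis
    unfolding K0_def \<sigma>_def P_def a_def A_def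
    by (simp add: divide_simps) (simp add: algebra_simps eval_nat_numeral)
qed

text \<open>The equation eliminates \<open>m2\<close>; what is left are identities between rational
  functions of \<rho>, \<open>x\<close>, \<open>Y\<close>, \<open>m\<close> and
  \<open>N\<close>.\<close>

lemma K1_K2_zero:
  assumes "\<rho> \<in> J" "N > 0" "ode \<rho>"
  shows "K1 N \<rho> = 0" "K2 N \<rho> = 0"
proof -
  have pos: "\<rho> > 0" "x \<rho> > 0" "Y \<rho> > 0" "N + 1 > 0" "N + 2 > 0"
    using J_pos x_pos Y_ge_1[of \<rho>] assms by auto
  note m2 = assms(3)[unfolded ode_def]
  show "K1 N \<rho> = 0"
    unfolding K1_def \<sigma>_def P_def Q_def a_def b_def A'_def m2 using pos
    by (simp add: divide_simps) (simp add: algebra_simps eval_nat_numeral)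
  show "K2 N \<rho> = 0"
    unfolding K2_def \<sigma>_def P_def Q_def a_def b_def A'_def B'_def m2 using pos
    by (simp add: divide_simps) (simp add: algebra_simps eval_nat_numeral)
qed

end


section \<open>The meridian\<close>

text \<open>Serves for \<open>t\<close>, its square and the square of the radius. Invariance of
  domain gives the open image and the continuity of the inverse that the inverse function rule asks
  for.\<close>

lemma inverse_of_increasing:
  fixes g g' :: "real \<Rightarrow> real"
  assumes I: "open I" "is_interval I"
    and g: "\<And>s. s \<in> I \<Longrightarrow> (g has_real_derivative g' s) (at s)"
    and pos: "\<And>s. s \<in> I \<Longrightarrow> g' s > 0"
  shows "inj_on g I" "open (g ` I)" "is_interval (g ` I)"
    and "\<And>s. s \<in> I \<Longrightarrow> (the_inv_into I g has_real_derivative inverse (g' s)) (at (g s))"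
proof -
  have less: "g s < g s'" if "s \<in> I" "s' \<in> I" "s < s'" for s s'
  proof (rule DERIV_pos_imp_increasing[OF that(3)])
    fix \<sigma> assume "s \<le> \<sigma>" "\<sigma> \<le> s'"
    then have "\<sigma> \<in> I" using I(2) that unfolding is_interval_1 by blast
    then show "\<exists>y. (g has_real_derivative y) (at \<sigma>) \<and> 0 < y" using g pos by blast
  qed
  show inj: "inj_on g I"
    by (rule inj_onI) (metis less linorder_less_linear less_irrefl)
  have cont: "continuous_on I g"
    using g by (intro continuous_at_imp_continuous_on) (auto intro: DERIV_isCont)
  show op: "open (g ` I)" by (rule invariance_of_domain[OF cont I(1) inj])
  show "is_interval (g ` I)"
    using connected_continuous_image[OF cont] I(2) by (simp add: is_interval_connected_1)
  fix s assume s: "s \<in> I"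
  have cinv: "continuous_on (g ` I) (the_inv_into I g)"
    by (rule continuous_on_inverse_open[OF I(1) cont]) (auto simp: the_inv_into_f_f[OF inj])
  obtain e where e: "e > 0" "ball (g s) e \<subseteq> g ` I"
    using op s open_contains_ball by blast
  show "(the_inv_into I g has_real_derivative inverse (g' s)) (at (g s))"
  proof (rule DERIV_inverse_function[where a = "g s - e" and b = "g s + e"])
    show "(g has_real_derivative g' s) (at (the_inv_into I g (g s)))"
      using g[OF s] by (simp add: the_inv_into_f_f[OF inj s])
    show "g' s \<noteq> 0" using pos[OF s] by simp
    show "g (the_inv_into I g y) = y" if "g s - e < y" "y < g s + e" for y
    proof -
      have "y \<in> g ` I" using e(2) that by (auto simp: subset_iff dist_real_def)
      then show ?thesis by (rule f_the_inv_into_f[OF inj])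
    qed
    show "isCont (the_inv_into I g) (g s)"
      using cinv op s by (simp add: continuous_on_eq_continuous_at)
  qed (use e in auto)
qed

lemma antiderivative_on_interval:
  fixes k :: "real \<Rightarrow> real"
  assumes I: "open I" "is_interval I" and k: "continuous_on I k"
  shows "\<exists>K. \<forall>s\<in>I. (K has_real_derivative k s) (at s)"
proof (cases "I = {}")
  case False
  then obtain c where c: "c \<in> I" by blast
  have "((\<lambda>u. LBINT y=c..u. k y) has_real_derivative k s) (at s)" if s: "s \<in> I" for s
  proof -
    \<comment> \<open>An interval [p, r] inside \<open>I\<close> with \<open>s\<close> in its
      interior turns the derivative within the interval into a two-sided one.\<close>
    have "min c s \<in> I" "max c s \<in> I" using c s by (auto simp: min_def max_def)
    then obtain d e where d: "d > 0" "cball (min c s) d \<subseteq> I" and e: "e > 0" "cball (max c s) e \<subseteq> I"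
      using I(1)[unfolded open_contains_cball] by blast
    define p where "p = min c s - d"
    define r where "r = max c s + e"
    have "p \<in> cball (min c s) d" "r \<in> cball (max c s) e"
      using d(1) e(1) by (auto simp: p_def r_def dist_real_def)
    then have pr: "p \<in> I" "r \<in> I" using d(2) e(2) by blast+
    have lt: "p < c" "p < s" "c < r" "s < r" using d(1) e(1) by (auto simp: p_def r_def)
    have "{p..r} \<subseteq> I" using I(2) pr unfolding is_interval_1 by (meson atLeastAtMost_iff subsetI)
    then have "continuous_on {p..r} k" using k continuous_on_subset by blast
    then have "((\<lambda>u. LBINT y=c..u. k y) has_vector_derivative k s) (at s within {p..r})"
      using lt by (intro interval_integral_FTC2) auto
    then have "((\<lambda>u. LBINT y=c..u. k y) has_vector_derivative k s) (at s)"
      using lt at_within_interior[of s "{p..r}"] by simp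
    then show ?thesis by (simp add: has_real_derivative_iff_has_vector_derivative)
  qed
  then show ?thesis by blast
qed auto

text \<open>Metrics are total functions, but the pulled back metric and its computed form agree only
  on the chart domain. Its openness makes the derivatives agree as well.\<close>

lemma levi_civita_cong:
  assumes "levi_civita U h \<Gamma>" and eq: "\<And>x u v. x \<in> U \<Longrightarrow> h' x u v = h x u v"
  shows "levi_civita U h' \<Gamma>"
proof -
  interpret levi_civita U h \<Gamma> by fact
  have h': "h' x = h x" if "x \<in> U" for x using eq[OF that] by blast
  have fd: "((\<lambda>y. h' y u v) has_derivative frechet_derivative (\<lambda>y. h y u v) (at x)) (at x)" if "x \<in> U" for x u v
    by (rule has_derivative_transform_within_open[OF _ open_U that])
      (use metric_differentiable[OF that, of u v, unfolded frechet_derivative_works] eq in auto)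
  then have fd': "frechet_derivative (\<lambda>y. h' y u v) (at x) = frechet_derivative (\<lambda>y. h y u v) (at x)" if "x \<in> U" for x u v
    using frechet_derivative_at[OF fd[OF that, of u v]] by simp
  show ?thesis
    by unfold_locales
      (use open_U bilinear_metric metric_sym metric_pos differentiableI[OF fd] bilinear_\<Gamma> \<Gamma>_differentiable koszul in
        \<open>auto simp: h' fd'\<close>)
qed

lemma levi_civita_cong_curvature:
  assumes "levi_civita U h \<Gamma>" and eq: "\<And>x u v. x \<in> U \<Longrightarrow> h' x u v = h x u v" and x: "x \<in> U"
  shows "curvature h' x = curvature h x" "ricci h' x = ricci h x" "scalar_curvature h' x = scalar_curvature h x"
proof -
  interpret levi_civita U h \<Gamma> by fact
  interpret h': levi_civita U h' \<Gamma> by (rule levi_civita_cong[OF assms(1,2)])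
  have h': "h' x = h x" using eq[OF x] by blast
  show c: "curvature h' x = curvature h x"
    by (intro ext) (simp add: curvature_def curvature_op_const[OF x] h'.curvature_op_const[OF x]
        h'.second_cov_deriv_def second_cov_deriv_def h')
  show r: "ricci h' x = ricci h x" by (intro ext) (simp add: ricci_def c h')
  show "scalar_curvature h' x = scalar_curvature h x" by (simp add: scalar_curvature_def r h')
qed

lemma bochner_form_cong:
  assumes "levi_civita U h \<Gamma>" and eq: "\<And>x u v. x \<in> U \<Longrightarrow> h' x u v = h x u v" and x: "x \<in> U"
  shows "bochner_form h' x = bochner_form h x"
proof -
  have "h' x = h x" using eq[OF x] by blast
  then show ?thesis
    by (intro ext) (simp add: bochner_form_def levi_civita_cong_curvature[OF assms])
qed

context radial_metric
begin

text \<open>Where the Bochner tensor vanishes, \<open>(m - (Y - 1)) / x\<^sup>2\<close> and then \<open>(Y - 1) / x - c\<^sub>1 x\<close> have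
  zero derivative.\<close>

lemma ode_solution:
  assumes conn: "is_interval J" and ode: "\<And>\<rho>. \<rho> \<in> J \<Longrightarrow> ode \<rho>"
  shows "\<exists>c\<^sub>1 c\<^sub>2. \<forall>\<rho>\<in>J. Y \<rho> = c\<^sub>1 * (x \<rho>)\<^sup>2 + c\<^sub>2 * x \<rho> + 1"
proof -
  have conv: "convex J" using conn is_interval_convex by blast
  \<comment> \<open>In the variable x the derivative of (x y' - (y - 1)) / x^2 is the left side of
    the Euler equation divided by x^3.\<close>
  have "((\<lambda>\<rho>. (m \<rho> - (Y \<rho> - 1)) / (x \<rho>)\<^sup>2) has_real_derivative 0) (at \<rho> within J)" if "\<rho> \<in> J" for \<rho>
  proof -
    have "((\<lambda>\<rho>. (m \<rho> - (Y \<rho> - 1)) / (x \<rho>)\<^sup>2) has_real_derivative 0) (at \<rho>)"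
      using J_pos[OF that] x_pos[OF that] ode[OF that, unfolded ode_def]
      by (auto intro!: derivative_eq_intros m_deriv Y_deriv x_deriv that simp: divide_simps)
        (simp add: algebra_simps power2_eq_square)
    then show ?thesis by (rule has_field_derivative_at_within)
  qed
  from has_field_derivative_zero_constant[OF conv this]
  obtain c\<^sub>1 where c1: "\<And>\<rho>. \<rho> \<in> J \<Longrightarrow> (m \<rho> - (Y \<rho> - 1)) / (x \<rho>)\<^sup>2 = c\<^sub>1" by blast
  then have c1': "m \<rho> = Y \<rho> - 1 + c\<^sub>1 * (x \<rho>)\<^sup>2" if "\<rho> \<in> J" for \<rho>
    using x_pos[OF that] that by (force simp: field_simps)
  have "((\<lambda>\<rho>. (Y \<rho> - 1) / x \<rho> - c\<^sub>1 * x \<rho>) has_real_derivative 0) (at \<rho> within J)" if "\<rho> \<in> J" for \<rho>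
  proof -
    have "((\<lambda>\<rho>. (Y \<rho> - 1) / x \<rho> - c\<^sub>1 * x \<rho>) has_real_derivative 0) (at \<rho>)"
      using J_pos[OF that] x_pos[OF that]
      by - (rule derivative_eq_intros Y_deriv x_deriv that refl
          | simp add: c1'[OF that] field_simps power2_eq_square)+
    then show ?thesis by (rule has_field_derivative_at_within)
  qed
  from has_field_derivative_zero_constant[OF conv this]
  obtain c\<^sub>2 where c2: "\<And>\<rho>. \<rho> \<in> J \<Longrightarrow> (Y \<rho> - 1) / x \<rho> - c\<^sub>1 * x \<rho> = c\<^sub>2" by blast
  have "Y \<rho> = c\<^sub>1 * (x \<rho>)\<^sup>2 + c\<^sub>2 * x \<rho> + 1" if "\<rho> \<in> J" for \<rho>
    using c2[OF that] x_pos[OF that] by (simp add: field_simps power2_eq_square)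
  then show ?thesis by blast
qed

end

section \<open>The radial metric of a meridian\<close>

locale meridian =
  fixes I :: "real set" and t q :: "real \<Rightarrow> real"
  assumes open_I: "open I" and interval_I: "is_interval I"
    and smooth_t: "smooth_on I t" and smooth_q: "smooth_on I q"
    and t_pos: "s \<in> I \<Longrightarrow> t s > 0"
    and natural: "s \<in> I \<Longrightarrow> (deriv t s)\<^sup>2 - (deriv q s)\<^sup>2 = 1"
    and t'_ge_1: "s \<in> I \<Longrightarrow> deriv t s \<ge> 1"
begin

lemma t_deriv: "s \<in> I \<Longrightarrow> (t has_real_derivative deriv t s) (at s)"
  by (rule smooth_on_has_deriv[OF smooth_t])

lemma q_deriv: "s \<in> I \<Longrightarrow> (q has_real_derivative deriv q s) (at s)"
  by (rule smooth_on_has_deriv[OF smooth_q])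

lemma t'_pos: "s \<in> I \<Longrightarrow> deriv t s > 0"
  using t'_ge_1 by fastforce

lemma smooth_t': "smooth_on I (deriv t)" by (rule smooth_on_deriv[OF open_I smooth_t])

lemma t_inverse:
  "inj_on t I" "open (t ` I)" "is_interval (t ` I)"
  "s \<in> I \<Longrightarrow> (the_inv_into I t has_real_derivative inverse (deriv t s)) (at (t s))"
  using inverse_of_increasing[OF open_I interval_I t_deriv t'_pos] by simp_all

text \<open>The exponential of an antiderivative of 1/t, hence positive.\<close>

lemma exists_radius: "\<exists>f. \<forall>s\<in>I. f s > 0 \<and> (f has_real_derivative f s / t s) (at s)"
proof -
  have "continuous_on I (\<lambda>s. 1 / t s)"
    using smooth_on_continuous_on[OF smooth_t] t_pos by (intro continuous_intros) fastforce+
  then obtain K where "\<And>s. s \<in> I \<Longrightarrow> (K has_real_derivative 1 / t s) (at s)"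
    using antiderivative_on_interval[OF open_I interval_I] by blast
  then have "((\<lambda>s. exp (K s)) has_real_derivative exp (K s) / t s) (at s)" if "s \<in> I" for s
    using that by (auto intro!: derivative_eq_intros)
  then show ?thesis by (intro exI[of _ "\<lambda>s. exp (K s)"]) auto
qed

text \<open>The point \<open>t(s) n + q(s) e\<close> gets the holomorphic coordinate \<open>f(s) n\<close>: compatibility with the
  complex structure amounts to \<open>f' = f / t\<close>.\<close>

definition f :: "real \<Rightarrow> real" where
  "f = (SOME f. \<forall>s\<in>I. f s > 0 \<and> (f has_real_derivative f s / t s) (at s))"

lemma f_pos: "s \<in> I \<Longrightarrow> f s > 0"
  and f_deriv: "s \<in> I \<Longrightarrow> (f has_real_derivative f s / t s) (at s)"
  using someI_ex[OF exists_radius] unfolding f_def by blast+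

lemma smooth_f: "smooth_on I f"
proof (rule smooth_on_linear_ode[OF open_I])
  show "smooth_on I (\<lambda>s. 1 / t s)"
    by (intro smooth_on_divide smooth_on_const open_I smooth_t) (use t_pos in force)
qed (use f_deriv in auto)

text \<open>Range of the radial variable \<rho>, the squared norm of f(s) n; \<open>S\<close> is the
  meridian parameter as a function of \<rho>.\<close>

definition J :: "real set" where "J = (\<lambda>s. (f s)\<^sup>2) ` I"
definition S :: "real \<Rightarrow> real" where "S = the_inv_into I (\<lambda>s. (f s)\<^sup>2)"

lemma f_square_deriv: "s \<in> I \<Longrightarrow> ((\<lambda>s. (f s)\<^sup>2) has_real_derivative 2 * (f s)\<^sup>2 / t s) (at s)"
  by (auto intro!: derivative_eq_intros f_deriv simp: power2_eq_square)

lemma f_square_deriv_pos: "s \<in> I \<Longrightarrow> 2 * (f s)\<^sup>2 / t s > 0"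
  using f_pos t_pos by (force intro!: divide_pos_pos)

lemma f_square_inverse:
  "inj_on (\<lambda>s. (f s)\<^sup>2) I" "open ((\<lambda>s. (f s)\<^sup>2) ` I)" "is_interval ((\<lambda>s. (f s)\<^sup>2) ` I)"
  "s \<in> I \<Longrightarrow> (the_inv_into I (\<lambda>s. (f s)\<^sup>2) has_real_derivative inverse (2 * (f s)\<^sup>2 / t s)) (at ((f s)\<^sup>2))"
  using inverse_of_increasing[OF open_I interval_I f_square_deriv f_square_deriv_pos] by simp_all

lemma S_f [simp]: "s \<in> I \<Longrightarrow> S ((f s)\<^sup>2) = s"
  unfolding S_def by (rule the_inv_into_f_f[OF f_square_inverse(1)])

lemma S_in: "\<rho> \<in> J \<Longrightarrow> S \<rho> \<in> I" and f_S: "\<rho> \<in> J \<Longrightarrow> (f (S \<rho>))\<^sup>2 = \<rho>"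
  by (auto simp: J_def)

lemma open_J: "open J" and interval_J: "is_interval J"
  using f_square_inverse(2,3) by (simp_all add: J_def)

lemma J_pos: "\<rho> \<in> J \<Longrightarrow> \<rho> > 0"
  using f_pos by (force simp: J_def)

lemma S_deriv: "\<rho> \<in> J \<Longrightarrow> (S has_real_derivative t (S \<rho>) / (2 * \<rho>)) (at \<rho>)"
  using f_square_inverse(4)[of "S \<rho>"] f_S[of \<rho>] S_in[of \<rho>] by (simp add: S_def[symmetric])

text \<open>Because \<rho> is the square of f(S), the derivative t(S) / (2 \<rho>) depends on S
  alone and the equation is autonomous.\<close>

lemma smooth_S: "smooth_on J S"
proof (rule smooth_on_autonomous_ode[OF open_J, where T = I])
  show "smooth_on I (\<lambda>s. t s / (2 * (f s)\<^sup>2))"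
    unfolding power2_eq_square
    by (intro smooth_on_divide smooth_on_mult smooth_on_const open_I smooth_t smooth_f) (use f_pos in force)
qed (use S_in S_deriv f_S in auto)

text \<open>This is x dy/dx for x = t^2 and y = t', expressed in the parameter
  \<open>s\<close>.\<close>

definition mu :: "real \<Rightarrow> real" where "mu s = deriv (deriv t) s * t s / (2 * deriv t s)"

lemma smooth_mu: "smooth_on I mu"
  unfolding mu_def[abs_def]
  by (intro smooth_on_divide smooth_on_mult smooth_on_const smooth_on_deriv open_I smooth_t smooth_t')
    (use t'_pos in force)

text \<open>Since dS/d\<rho> = t / (2 \<rho>), the operator \<rho> d/d\<rho> is (t/2) d/ds; this
  accounts for the last parameter.\<close>

sublocale radial_metric J "\<lambda>\<rho>. (t (S \<rho>))\<^sup>2" "\<lambda>\<rho>. deriv t (S \<rho>)" "\<lambda>\<rho>. mu (S \<rho>)"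
  "\<lambda>\<rho>. deriv mu (S \<rho>) * t (S \<rho>) / 2"
proof
  show "open J" by (rule open_J)
  fix \<rho> assume \<rho>: "\<rho> \<in> J"
  note s = S_in[OF \<rho>]
  have comp: "((\<lambda>\<rho>. g (S \<rho>)) has_real_derivative g' * (t (S \<rho>) / (2 * \<rho>))) (at \<rho>)"
    if "(g has_real_derivative g') (at (S \<rho>))" for g g'
    by (rule DERIV_chain2[OF that S_deriv[OF \<rho>]])
  show "\<rho> > 0" by (rule J_pos[OF \<rho>])
  show "(t (S \<rho>))\<^sup>2 > 0" using t_pos[OF s] by simp
  show "deriv t (S \<rho>) \<ge> 1" by (rule t'_ge_1[OF s])
  show "((\<lambda>\<rho>. (t (S \<rho>))\<^sup>2) has_real_derivative (t (S \<rho>))\<^sup>2 * deriv t (S \<rho>) / \<rho>) (at \<rho>)"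
    using J_pos[OF \<rho>] by (auto intro!: derivative_eq_intros comp t_deriv s simp: field_simps power2_eq_square)
  show "((\<lambda>\<rho>. deriv t (S \<rho>)) has_real_derivative mu (S \<rho>) * deriv t (S \<rho>) / \<rho>) (at \<rho>)"
    using comp[OF smooth_on_has_deriv[OF smooth_t' s]] t'_pos[OF s] by (simp add: mu_def)
  show "((\<lambda>\<rho>. mu (S \<rho>)) has_real_derivative deriv mu (S \<rho>) * t (S \<rho>) / 2 / \<rho>) (at \<rho>)"
    using comp[OF smooth_on_has_deriv[OF smooth_mu s]] by simp
qed

lemma ode_iff:
  "(\<forall>\<rho>\<in>J. ode \<rho>) \<longleftrightarrow> (\<exists>c\<^sub>1 c\<^sub>2. \<forall>s\<in>I. deriv t s = c\<^sub>1 * t s ^ 4 + c\<^sub>2 * (t s)\<^sup>2 + 1)"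
proof
  assume "\<forall>\<rho>\<in>J. ode \<rho>"
  then obtain c\<^sub>1 c\<^sub>2 where c: "\<forall>\<rho>\<in>J. deriv t (S \<rho>) = c\<^sub>1 * ((t (S \<rho>))\<^sup>2)\<^sup>2 + c\<^sub>2 * (t (S \<rho>))\<^sup>2 + 1"
    using ode_solution[OF interval_J] by blast
  have "deriv t s = c\<^sub>1 * t s ^ 4 + c\<^sub>2 * (t s)\<^sup>2 + 1" if "s \<in> I" for s
    using c[rule_format, of "(f s)\<^sup>2"] that by (simp add: J_def)
  then show "\<exists>c\<^sub>1 c\<^sub>2. \<forall>s\<in>I. deriv t s = c\<^sub>1 * t s ^ 4 + c\<^sub>2 * (t s)\<^sup>2 + 1" by blast
next
  assume "\<exists>c\<^sub>1 c\<^sub>2. \<forall>s\<in>I. deriv t s = c\<^sub>1 * t s ^ 4 + c\<^sub>2 * (t s)\<^sup>2 + 1"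
  then obtain c\<^sub>1 c\<^sub>2 where c: "\<And>s. s \<in> I \<Longrightarrow> deriv t s = c\<^sub>1 * t s ^ 4 + c\<^sub>2 * (t s)\<^sup>2 + 1" by blast
  \<comment> \<open>The formulas for t' and \<open>mu\<close> hold only on \<open>I\<close>, so they
    are differentiated through the openness of \<open>I\<close>.\<close>
  have deriv_eq: "deriv g s = g'" if "s \<in> I" "\<And>s. s \<in> I \<Longrightarrow> g s = k s" "(k has_real_derivative g') (at s)" for g k g' s
    using has_field_derivative_transform_within_open[OF that(3) open_I that(1), of g] that(2) DERIV_imp_deriv by metis
  have t'': "deriv (deriv t) s = (4 * c\<^sub>1 * t s ^ 3 + 2 * c\<^sub>2 * t s) * deriv t s" if "s \<in> I" for s
    by (rule deriv_eq[OF that c])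
      (auto intro!: derivative_eq_intros t_deriv that simp: algebra_simps)
  have mu: "mu s = 2 * c\<^sub>1 * t s ^ 4 + c\<^sub>2 * (t s)\<^sup>2" if "s \<in> I" for s
    using t'_pos[OF that] by (simp add: mu_def t''[OF that] field_simps eval_nat_numeral)
  have mu': "deriv mu s = (8 * c\<^sub>1 * t s ^ 3 + 2 * c\<^sub>2 * t s) * deriv t s" if "s \<in> I" for s
    by (rule deriv_eq[OF that mu])
      (auto intro!: derivative_eq_intros t_deriv that simp: algebra_simps)
  show "\<forall>\<rho>\<in>J. ode \<rho>"
  proof
    fix \<rho> assume "\<rho> \<in> J"
    note s = S_in[OF this]
    show "ode \<rho>"
      unfolding ode_def mu'[OF s] mu[OF s]
      \<comment> \<open>Only the t' in Y - 1 is replaced by the polynomial; the factor t' is common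
        to both sides.\<close>
      by (subst (3) c[OF s]) (simp add: algebra_simps eval_nat_numeral)
  qed
qed

end


section \<open>Holomorphic charts of the hypersurface\<close>

context radial_metric
begin

text \<open>In real terms the second summand lives on the directions y and i y, the counterparts of
  \<open>rot_xi\<close> and \<open>rot_xi_tilde\<close>. The form suits both smoothness and the
  comparison with \<open>rot_metric\<close>.\<close>

lemma metric_real:
  fixes y :: "complex ^ 'n::finite"
  shows "metric y u v = a (y \<bullet> y) * (u \<bullet> v)
    + b (y \<bullet> y) * ((y \<bullet> u) * (y \<bullet> v) + ((\<i> *s y) \<bullet> u) * ((\<i> *s y) \<bullet> v))"
  unfolding metric_def hC_def inner_eq_Re_hprod[of u] inner_eq_Re_hprod[of y u] inner_eq_Re_hprod[of y v]
    inner_eq_Re_hprod[of "\<i> *s y"] cnj_hprod[of y u, symmetric]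
  by simp

lemma smooth_metric:
  fixes F :: "'b::real_normed_vector \<Rightarrow> complex ^ 'n::finite"
  assumes "open U" "smooth_on U F" "smooth_on U G" "smooth_on U H" "\<And>x. x \<in> U \<Longrightarrow> F x \<in> dom"
    and ab: "smooth_on J a" "smooth_on J b"
  shows "smooth_on U (\<lambda>x. metric (F x) (G x) (H x))"
proof -
  have lin: "bounded_linear ((*s) \<i> :: complex ^ 'n \<Rightarrow> complex ^ 'n)"
    by (rule bounded_bilinear.bounded_linear_right[OF bounded_bilinear_cvec_scale])
  show ?thesis
    unfolding metric_real
    by (intro smooth_on_add smooth_on_mult smooth_on_inner smooth_on_linear[OF _ lin]
        smooth_on_compose_real[OF _ ab(1)] smooth_on_compose_real[OF _ ab(2)])
      (use assms in \<open>auto simp: dom_def\<close>)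
qed

lemma hC_rotate: "hC y (\<i> *s u) (\<i> *s v) = hC y u v"
  by (simp add: hC_def complex_eq_iff algebra_simps)

lemma conn_rotate: "conn y u (\<i> *s v) = \<i> *s conn y u v"
  by (simp add: conn_def vec_eq_iff algebra_simps)

end

section \<open>The global holomorphic chart\<close>

context meridian
begin

abbreviation (input) hypersurface :: "'n::finite ambient set" where
  "hypersurface \<equiv> rot_hypersurface I t q"

lemma smooth_compose_S: "smooth_on I g \<Longrightarrow> smooth_on J (\<lambda>\<rho>. g (S \<rho>))"
  by (rule smooth_on_compose_real[OF open_J _ smooth_S S_in])

lemma smooth_ab: "smooth_on J a" "smooth_on J b"
proof -
  have sq: "smooth_on J (\<lambda>\<rho>. \<rho>\<^sup>2)" "smooth_on J (\<lambda>\<rho>. (t (S \<rho>))\<^sup>2)"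
    unfolding power2_eq_square
    by (intro smooth_on_mult smooth_on_id smooth_compose_S open_J smooth_t)+
  show "smooth_on J a"
    unfolding a_def[abs_def]
    by (intro smooth_on_divide smooth_on_id sq open_J) (use J_pos in force)
  show "smooth_on J b"
    unfolding b_def[abs_def]
    by (intro smooth_on_divide smooth_on_mult smooth_on_diff smooth_on_const smooth_compose_S sq open_J smooth_t')
      (use J_pos in force)
qed

lemma rot_params_rot_point:
  assumes "s \<in> I" "norm n = 1"
  shows "rot_params I t q (rot_point t q s n) = (s, n)"
proof -
  have "inj_on (\<lambda>(s, n). rot_point t q s n) (I \<times> sphere 0 1)"
  proof (rule inj_onI, clarsimp simp: rot_point_def)
    fix s s' and n n' :: "complex ^ 'n"
    assume s: "s \<in> I" "s' \<in> I" and n: "norm n = 1" "norm n' = 1" and eq: "t s *\<^sub>R n = t s' *\<^sub>R n'"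
    have "norm (t s *\<^sub>R n) = norm (t s' *\<^sub>R n')" using eq by simp
    then have "t s = t s'" using s n t_pos[of s] t_pos[of s'] by simp
    then have "s = s'" using t_inverse(1) s by (auto dest: inj_onD)
    then show "s = s' \<and> n = n'" using eq t_pos[OF s(1)] by simp
  qed
  from the_inv_into_f_f[OF this, of "(s, n)"] show ?thesis
    using assms by (simp add: rot_params_def)
qed

definition chart :: "complex ^ 'n::finite \<Rightarrow> 'n ambient" where
  "chart y = ((t (S (y \<bullet> y)) / f (S (y \<bullet> y))) *\<^sub>R y, q (S (y \<bullet> y)))"

definition unit :: "complex ^ 'n::finite \<Rightarrow> complex ^ 'n" where
  "unit y = (1 / f (S (y \<bullet> y))) *\<^sub>R y"

text \<open>With n = \<open>unit y\<close>, it sends n and i n to t/f times \<open>rot_xi\<close>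
  and \<open>rot_xi_tilde\<close> and is multiplication by t/f on their complement. Hence it
  intertwines multiplication by i with \<open>rot_J\<close>.\<close>

definition chart' :: "complex ^ 'n::finite \<Rightarrow> complex ^ 'n \<Rightarrow> 'n ambient" where
  "chart' y v = (let s = S (y \<bullet> y) in
     ((t s / f s) *\<^sub>R (v + ((deriv t s - 1) * (unit y \<bullet> v)) *\<^sub>R unit y), t s / f s * deriv q s * (unit y \<bullet> v)))"

lemma dom_J: "y \<in> dom \<Longrightarrow> y \<bullet> y \<in> J"
  by (simp add: dom_def)

lemma dom_S: "y \<in> dom \<Longrightarrow> S (y \<bullet> y) \<in> I"
  by (rule S_in[OF dom_J])

lemma unit_self:
  assumes "y \<in> dom" shows "unit y \<bullet> unit y = 1" "norm (unit y) = 1"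
proof -
  show "unit y \<bullet> unit y = 1"
    using f_S[OF dom_J[OF assms]] J_pos[OF dom_J[OF assms]] by (simp add: unit_def power2_eq_square)
  then show "norm (unit y) = 1" by (simp add: norm_eq_sqrt_inner)
qed

lemma chart_eq: "y \<in> dom \<Longrightarrow> chart y = rot_point t q (S (y \<bullet> y)) (unit y)"
  by (simp add: chart_def rot_point_def unit_def)

lemma rot_params_chart: "y \<in> dom \<Longrightarrow> rot_params I t q (chart y) = (S (y \<bullet> y), unit y)"
  by (simp add: chart_eq rot_params_rot_point dom_S unit_self)

lemma chart_has_derivative:
  fixes y :: "complex ^ 'n::finite"
  assumes "y \<in> dom"
  shows "(chart has_derivative chart' y) (at y)"
proof -
  let ?r = "y \<bullet> y"
  let ?s = "S ?r"
  have r: "?r > 0" "(f ?s)\<^sup>2 = ?r" and s: "?s \<in> I" and f: "f ?s > 0" and ts: "t ?s > 0"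
    using J_pos f_S dom_J assms dom_S f_pos t_pos by blast+
  have "((\<lambda>\<rho>. t (S \<rho>) / f (S \<rho>)) has_real_derivative t ?s / f ?s * (deriv t ?s - 1) / (2 * ?r)) (at ?r)"
    using f ts r(1)
    by (auto intro!: derivative_eq_intros DERIV_chain2[OF t_deriv[OF s] S_deriv[OF dom_J[OF assms]]]
        DERIV_chain2[OF f_deriv[OF s] S_deriv[OF dom_J[OF assms]]] simp: field_simps)
  from has_derivative_norm_square_compose[OF this]
  have 1: "((\<lambda>y. (t (S (y \<bullet> y)) / f (S (y \<bullet> y))) *\<^sub>R y) has_derivative
    (\<lambda>d. (t ?s / f ?s) *\<^sub>R d + (t ?s / f ?s * (deriv t ?s - 1) / (2 * ?r) * (2 * (y \<bullet> d))) *\<^sub>R y)) (at y)"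
    by (rule has_derivative_scaleR[OF _ has_derivative_ident])
  have 2: "((\<lambda>y. q (S (y \<bullet> y))) has_derivative (\<lambda>d. deriv q ?s * (t ?s / (2 * ?r)) * (2 * (y \<bullet> d)))) (at y)"
    by (rule has_derivative_norm_square_compose[OF DERIV_chain2[OF q_deriv[OF s] S_deriv[OF dom_J[OF assms]]]])
  have "(chart has_derivative (\<lambda>d. ((t ?s / f ?s) *\<^sub>R d + (t ?s / f ?s * (deriv t ?s - 1) / (2 * ?r) * (2 * (y \<bullet> d))) *\<^sub>R y,
    deriv q ?s * (t ?s / (2 * ?r)) * (2 * (y \<bullet> d))))) (at y)"
    unfolding chart_def[abs_def] by (rule has_derivative_Pair[OF 1 2])
  moreover have "((t ?s / f ?s) *\<^sub>R d + (t ?s / f ?s * (deriv t ?s - 1) / (2 * ?r) * (2 * (y \<bullet> d))) *\<^sub>R y,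
    deriv q ?s * (t ?s / (2 * ?r)) * (2 * (y \<bullet> d))) = chart' y d" for d
  proof -
    \<comment> \<open>The square of f is \<rho>, so y / f can be written as the unit vector in both
      components.\<close>
    have 1: "l * p / (2 * \<rho>) * (2 * w) = l * (p * (w / F) / F)" if "F\<^sup>2 = \<rho>" "F > 0" for l p w F \<rho> :: real
      using that by (auto simp: field_simps power2_eq_square)
    have 2: "p * (\<tau> / (2 * \<rho>)) * (2 * w) = \<tau> / F * p * (w / F)" if "F\<^sup>2 = \<rho>" "F > 0" for \<tau> p w F \<rho> :: real
      using that by (auto simp: field_simps power2_eq_square)
    show ?thesis
      unfolding 1[OF r(2) f] 2[OF r(2) f] chart'_def Let_def unit_def by (simp add: scaleR_add_right)
  qed
  ultimately show ?thesis by simp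
qed

lemma frechet_chart: "y \<in> dom \<Longrightarrow> frechet_derivative chart (at y) = chart' y"
  by (rule frechet_derivative_at[OF chart_has_derivative, symmetric])

lemma rot_xi_chart:
  assumes "y \<in> dom"
  shows "rot_xi I t q (chart y) = (deriv t (S (y \<bullet> y)) *\<^sub>R unit y, deriv q (S (y \<bullet> y)))"
proof -
  have "((\<lambda>\<sigma>. (t \<sigma> *\<^sub>R unit y, q \<sigma>)) has_vector_derivative
    (deriv t (S (y \<bullet> y)) *\<^sub>R unit y, deriv q (S (y \<bullet> y)))) (at (S (y \<bullet> y)))"
    using has_vector_derivative_Pair[OF
        has_vector_derivative_scaleR[OF t_deriv[OF dom_S[OF assms]] has_vector_derivative_const]
        q_deriv[OF dom_S[OF assms], unfolded has_real_derivative_iff_has_vector_derivative]]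
    by simp
  then show ?thesis
    by (simp add: rot_xi_def rot_params_chart[OF assms] rot_point_def vector_derivative_at)
qed

lemma rot_xi_tilde_chart: "y \<in> dom \<Longrightarrow> rot_xi_tilde I t q (chart y) = (\<i> *s unit y, 0)"
  by (simp add: rot_xi_tilde_def rot_params_chart)

lemma inner_rotate: "(\<i> *s u) \<bullet> (\<i> *s v) = u \<bullet> v" "(\<i> *s u) \<bullet> u = 0" "u \<bullet> (\<i> *s v) = - ((\<i> *s u) \<bullet> v)"
  for u v :: "complex ^ 'n::finite"
proof -
  show "(\<i> *s u) \<bullet> u = 0"
    by (simp only: inner_eq_Re_hprod[of "\<i> *s u"] hprod_simps hprod_self) simp
qed (simp_all add: inner_eq_Re_hprod)

text \<open>The natural parameter enters as the unit length of \<open>rot_xi\<close>.\<close>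

lemma rot_eta_chart:
  assumes "y \<in> dom"
  shows "rot_eta I t q (chart y) (chart' y v) = t (S (y \<bullet> y)) / f (S (y \<bullet> y)) * (unit y \<bullet> v)"
proof -
  let ?s = "S (y \<bullet> y)"
  have "rot_eta I t q (chart y) (chart' y v)
    = ((deriv t ?s)\<^sup>2 - (deriv q ?s)\<^sup>2) * (t ?s / f ?s * (unit y \<bullet> v))"
    by (simp add: rot_eta_def rot_xi_chart[OF assms] chart'_def Let_def ambient_metric_def
        inner_add_right unit_self[OF assms] algebra_simps power2_eq_square)
  then show ?thesis using natural[OF dom_S[OF assms]] by simp
qed

lemma rot_eta_tilde_chart:
  assumes "y \<in> dom"
  shows "rot_eta_tilde I t q (chart y) (chart' y v) = t (S (y \<bullet> y)) / f (S (y \<bullet> y)) * ((\<i> *s unit y) \<bullet> v)"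
  by (simp add: rot_eta_tilde_def rot_xi_tilde_chart[OF assms] chart'_def Let_def ambient_metric_def
      inner_add_right inner_rotate)

text \<open>By the natural parameter 2 (t' - 1) + (t' - 1)^2 - q'^2 = 0, so the induced metric
  becomes (t/f)^2 times the Euclidean one, which is the summand with \<open>a\<close>. The
  correction with t' - 1 is the summand with \<open>b\<close>.\<close>

lemma rot_metric_chart:
  assumes "y \<in> dom"
  shows "rot_metric I t q (chart y) (chart' y u) (chart' y v) = metric y u v"
proof -
  let ?r = "y \<bullet> y"
  let ?s = "S ?r"
  let ?n = "unit y"
  have f: "f ?s > 0" and r: "(f ?s)\<^sup>2 = ?r" using f_pos dom_S[OF assms] f_S[OF dom_J[OF assms]] by auto
  have nq: "(deriv q ?s)\<^sup>2 = (deriv t ?s)\<^sup>2 - 1" using natural[OF dom_S[OF assms]] by simp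
  have amb: "ambient_metric (chart' y u) (chart' y v)
    = (t ?s / f ?s)\<^sup>2 * (u \<bullet> v + (2 * (deriv t ?s - 1) + (deriv t ?s - 1)\<^sup>2 - (deriv q ?s)\<^sup>2) * ((?n \<bullet> u) * (?n \<bullet> v)))"
    by (simp add: ambient_metric_def chart'_def Let_def inner_add_left inner_add_right unit_self[OF assms]
        inner_commute[of u] algebra_simps add_divide_distrib diff_divide_distrib power2_eq_square)
  have "rot_metric I t q (chart y) (chart' y u) (chart' y v)
    = (t ?s / f ?s)\<^sup>2 * (u \<bullet> v + (deriv t ?s - 1) * ((?n \<bullet> u) * (?n \<bullet> v) + ((\<i> *s ?n) \<bullet> u) * ((\<i> *s ?n) \<bullet> v)))"
    unfolding rot_metric_def amb nq rot_eta_chart[OF assms] rot_eta_tilde_chart[OF assms] rot_params_chart[OF assms]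
    by (simp add: algebra_simps add_divide_distrib diff_divide_distrib power2_eq_square)
  also have "\<dots> = metric y u v"
  proof -
    have rot: "\<i> *s (c *\<^sub>R y) = c *\<^sub>R (\<i> *s y)" for c by (simp add: vec_eq_iff)
    have b: "b ?r = a ?r * (deriv t ?s - 1) / (f ?s)\<^sup>2" unfolding a_def b_def r by (simp add: power2_eq_square)
    have a: "a ?r = (t ?s / f ?s)\<^sup>2" by (simp add: a_def r power_divide)
    show ?thesis
      unfolding metric_real b a unit_def rot using f
      by (simp add: algebra_simps add_divide_distrib diff_divide_distrib power2_eq_square)
  qed
  finally show ?thesis .
qed

lemma rot_J_chart:
  assumes "y \<in> dom"
  shows "rot_J I t q (chart y) (chart' y v) = chart' y (\<i> *s v)"
  unfolding rot_J_def rot_proj_D_def rot_eta_chart[OF assms] rot_eta_tilde_chart[OF assms]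
    rot_xi_chart[OF assms] rot_xi_tilde_chart[OF assms]
  unfolding chart'_def Let_def inner_rotate(3)
  by (simp add: prod_eq_iff vec_eq_iff scaleR_conv_of_real[where 'a = complex] algebra_simps)

text \<open>Up to t/f the component along \<open>unit y\<close> is multiplied by t', which is
  positive.\<close>

lemma inj_chart':
  assumes "y \<in> dom" shows "inj (chart' y)"
proof -
  let ?s = "S (y \<bullet> y)"
  have "linear (chart' y)" using chart_has_derivative[OF assms] has_derivative_linear by blast
  moreover have "v = 0" if "chart' y v = 0" for v
  proof -
    have "t ?s \<noteq> 0" "f ?s \<noteq> 0" using t_pos f_pos dom_S[OF assms] by force+
    then have v: "v + ((deriv t ?s - 1) * (unit y \<bullet> v)) *\<^sub>R unit y = 0"
      using that by (simp add: chart'_def Let_def prod_eq_iff)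
    then have "unit y \<bullet> (v + ((deriv t ?s - 1) * (unit y \<bullet> v)) *\<^sub>R unit y) = 0" by simp
    then have "deriv t ?s * (unit y \<bullet> v) = 0"
      by (simp add: inner_add_right unit_self[OF assms] algebra_simps)
    then have "unit y \<bullet> v = 0" using t'_pos[OF dom_S[OF assms]] by simp
    then show "v = 0" using v by simp
  qed
  ultimately show ?thesis using linear_injective_0 by blast
qed

lemma smooth_chart: "smooth_on dom (chart :: complex ^ 'n::finite \<Rightarrow> _)"
proof -
  have r: "smooth_on dom (\<lambda>y. y \<bullet> y :: real)"
    by (intro smooth_on_inner smooth_on_id open_dom)
  have "smooth_on I (\<lambda>s. t s / f s)"
    by (intro smooth_on_divide open_I smooth_t smooth_f) (use f_pos in force)
  from smooth_compose_S[OF this] show ?thesis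
    unfolding chart_def[abs_def]
    by (intro smooth_on_Pair smooth_on_scaleR smooth_on_id open_dom
        smooth_on_compose_real[OF open_dom _ r dom_J] smooth_compose_S[OF smooth_q])
qed

section \<open>The holomorphic coordinate on the hypersurface\<close>

definition T :: "real set" where "T = (\<lambda>s. (t s)\<^sup>2) ` I"
definition coord_scale :: "real \<Rightarrow> real" where
  "coord_scale c = f (the_inv_into I (\<lambda>s. (t s)\<^sup>2) c) / t (the_inv_into I (\<lambda>s. (t s)\<^sup>2) c)"

text \<open>The coordinate f n of t n + q e is f/t times the first entry. Reading f/t off the
  squared norm t^2 of that entry, instead of \<open>rot_params\<close>, makes smoothness along an
  arbitrary chart a matter of composition.\<close>

definition coord :: "'n::finite ambient \<Rightarrow> complex ^ 'n" where
  "coord Z = coord_scale (fst Z \<bullet> fst Z) *\<^sub>R fst Z"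

lemma t_square_deriv: "s \<in> I \<Longrightarrow> ((\<lambda>s. (t s)\<^sup>2) has_real_derivative 2 * t s * deriv t s) (at s)"
  by (auto intro!: derivative_eq_intros t_deriv)

lemma t_square_deriv_pos: "s \<in> I \<Longrightarrow> 2 * t s * deriv t s > 0"
  using t_pos t'_pos by simp

lemma t_square_inverse:
  "inj_on (\<lambda>s. (t s)\<^sup>2) I" "open ((\<lambda>s. (t s)\<^sup>2) ` I)" "is_interval ((\<lambda>s. (t s)\<^sup>2) ` I)"
  "s \<in> I \<Longrightarrow> (the_inv_into I (\<lambda>s. (t s)\<^sup>2) has_real_derivative inverse (2 * t s * deriv t s)) (at ((t s)\<^sup>2))"
  using inverse_of_increasing[OF open_I interval_I t_square_deriv t_square_deriv_pos] by simp_all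

lemma coord_scale_eq: "s \<in> I \<Longrightarrow> coord_scale ((t s)\<^sup>2) = f s / t s"
  unfolding coord_scale_def by (simp add: the_inv_into_f_f[OF t_square_inverse(1)])

text \<open>The inverse of t^2 has derivative 1 / (2 t t') at the corresponding parameter, again an
  autonomous equation.\<close>

lemma smooth_coord_scale: "smooth_on T coord_scale"
proof -
  let ?\<sigma> = "the_inv_into I (\<lambda>s. (t s)\<^sup>2)"
  have op: "open T" using t_square_inverse(2) by (simp add: T_def)
  have in_I: "?\<sigma> c \<in> I" if "c \<in> T" for c
    using that by (auto simp: T_def the_inv_into_f_f[OF t_square_inverse(1)])
  have "smooth_on T ?\<sigma>"
  proof (rule smooth_on_autonomous_ode[OF op _ in_I])
    show "smooth_on I (\<lambda>s. 1 / (2 * t s * deriv t s))"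
      by (intro smooth_on_divide smooth_on_mult smooth_on_const open_I smooth_t smooth_t')
        (use t_square_deriv_pos in force)
    show "(?\<sigma> has_real_derivative 1 / (2 * t (?\<sigma> c) * deriv t (?\<sigma> c))) (at c)" if c: "c \<in> T" for c
    proof -
      obtain s where s: "s \<in> I" "c = (t s)\<^sup>2" using c by (auto simp: T_def)
      show ?thesis
        using t_square_inverse(4)[OF s(1)]
        unfolding s(2) the_inv_into_f_f[OF t_square_inverse(1) s(1)] inverse_eq_divide .
    qed
  qed
  moreover have "smooth_on I (\<lambda>s. f s / t s)"
    by (intro smooth_on_divide open_I smooth_t smooth_f) (use t_pos in force)
  ultimately have "smooth_on T (\<lambda>c. f (?\<sigma> c) / t (?\<sigma> c))"
    using smooth_on_compose_real[OF op, where f = ?\<sigma> and g = "\<lambda>s. f s / t s" and T = I] in_I by blast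
  then show ?thesis unfolding coord_scale_def[abs_def] .
qed

lemma hypersurface_coord:
  assumes "Z \<in> hypersurface"
  shows "fst Z \<bullet> fst Z \<in> T" "coord Z \<in> dom" "chart (coord Z) = Z"
proof -
  obtain s n where s: "s \<in> I" "norm n = 1" and Z: "Z = rot_point t q s n"
    using assms by (auto simp: rot_hypersurface_def)
  have n: "n \<bullet> n = 1" using s(2) by (simp add: norm_eq_sqrt_inner)
  have zz: "fst Z \<bullet> fst Z = (t s)\<^sup>2" by (simp add: Z rot_point_def n power2_eq_square)
  then show "fst Z \<bullet> fst Z \<in> T" using s by (simp add: T_def)
  have c: "coord Z = f s *\<^sub>R n"
    using t_pos[OF s(1)] unfolding coord_def zz coord_scale_eq[OF s(1)] by (simp add: Z rot_point_def)
  then have cc: "coord Z \<bullet> coord Z = (f s)\<^sup>2" by (simp add: n power2_eq_square)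
  moreover have "(f s)\<^sup>2 \<in> J" using s by (simp add: J_def)
  ultimately show "coord Z \<in> dom" by (simp add: dom_def)
  show "chart (coord Z) = Z"
    using f_pos[OF s(1)] unfolding chart_def cc S_f[OF s(1)] unfolding c by (simp add: Z rot_point_def)
qed

lemma chart_in: "y \<in> dom \<Longrightarrow> chart y \<in> hypersurface"
  unfolding rot_hypersurface_def using chart_eq unit_self(2) dom_S by fastforce

lemma coord_chart:
  assumes "y \<in> dom" shows "coord (chart y) = y"
proof -
  let ?s = "S (y \<bullet> y)"
  have p: "t ?s > 0" "f ?s > 0" using t_pos f_pos dom_S[OF assms] by auto
  have "fst (chart y) \<bullet> fst (chart y) = (t ?s)\<^sup>2"
    unfolding chart_eq[OF assms] by (simp add: rot_point_def unit_self[OF assms] power2_eq_square)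
  then show ?thesis
    using p by (simp add: coord_def coord_scale_eq[OF dom_S[OF assms]]) (simp add: chart_def)
qed

lemma continuous_on_coord: "continuous_on hypersurface (coord :: 'n::finite ambient \<Rightarrow> _)"
  unfolding coord_def[abs_def]
  by (intro continuous_intros continuous_on_compose2[OF smooth_on_continuous_on[OF smooth_coord_scale]])
    (use hypersurface_coord(1) in auto)

text \<open>One chart covers the whole hypersurface, which settles the integrability of
  \<open>rot_J\<close>.\<close>

lemma hol_chart_chart: "hol_chart hypersurface (rot_J I t q) dom (chart :: complex ^ 'n::finite \<Rightarrow> _)"
proof -
  have im: "chart ` dom = (hypersurface :: 'n ambient set)"
    using chart_in by (auto intro: image_eqI[where f = chart, OF hypersurface_coord(3)[symmetric] hypersurface_coord(2)])
  have "homeomorphism dom hypersurface (chart :: complex ^ 'n \<Rightarrow> _) coord"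
    unfolding homeomorphism_def
    using im smooth_on_continuous_on[OF smooth_chart] continuous_on_coord coord_chart hypersurface_coord
    by (auto intro: image_eqI[where f = coord, OF coord_chart[symmetric] chart_in])
  then show ?thesis
    unfolding hol_chart_def im
    by (auto simp: open_dom smooth_chart inj_chart' rot_J_chart frechet_chart)
qed

lemma pullback_metric_chart:
  "y \<in> dom \<Longrightarrow> pullback_metric chart (rot_metric I t q) y u v = metric y u v"
  by (simp add: pullback_metric_def frechet_chart rot_metric_chart)

section \<open>Arbitrary holomorphic charts\<close>

text \<open>Every chart factors through \<open>chart\<close> by the map \<open>F\<close>. Since
  \<open>chart'\<close> is injective and intertwines the complex structures, the derivative of
  \<open>F\<close> inherits injectivity and complex linearity.\<close>

lemma hol_chart_transition:
  fixes \<phi> :: "complex ^ 'n::finite \<Rightarrow> 'n ambient"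
  assumes "hol_chart hypersurface (rot_J I t q) U \<phi>"
  defines "F \<equiv> \<lambda>x. coord (\<phi> x)"
  shows "levi_civita_pullback dom metric conn U F"
    and "x \<in> U \<Longrightarrow> frechet_derivative F (at x) (\<i> *s u) = \<i> *s frechet_derivative F (at x) u"
    and "x \<in> U \<Longrightarrow> pullback_metric \<phi> (rot_metric I t q) x u v = metric_pullback F metric x u v"
proof -
  have U: "open U" and sm: "smooth_on U \<phi>" and inM: "\<And>x. x \<in> U \<Longrightarrow> \<phi> x \<in> hypersurface"
    and inj: "\<And>x. x \<in> U \<Longrightarrow> inj (frechet_derivative \<phi> (at x))"
    and hol: "\<And>x v. x \<in> U \<Longrightarrow> frechet_derivative \<phi> (at x) (\<i> *s v)
      = rot_J I t q (\<phi> x) (frechet_derivative \<phi> (at x) v)"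
    using assms(1) openin_imp_subset unfolding hol_chart_def by blast+
  have fst: "smooth_on U (\<lambda>x. fst (\<phi> x))"
    by (rule smooth_on_linear[OF U bounded_linear_fst sm])
  have smF: "smooth_on U F"
    unfolding F_def coord_def
    by (intro smooth_on_scaleR smooth_on_compose_real[OF U smooth_coord_scale] smooth_on_inner U fst)
      (use hypersurface_coord(1)[OF inM] in auto)
  have Fdom: "F x \<in> dom" and \<phi>: "\<phi> x = chart (F x)" if "x \<in> U" for x
    using hypersurface_coord[OF inM[OF that]] by (auto simp: F_def)
  have D: "frechet_derivative \<phi> (at x) u = chart' (F x) (frechet_derivative F (at x) u)" if "x \<in> U" for x u
  proof -
    have "((\<lambda>x. chart (F x)) has_derivative (\<lambda>u. chart' (F x) (frechet_derivative F (at x) u))) (at x)"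
      by (rule has_derivative_compose[OF smooth_on_has_derivative[OF smF that] chart_has_derivative[OF Fdom[OF that]]])
    then have "(\<phi> has_derivative (\<lambda>u. chart' (F x) (frechet_derivative F (at x) u))) (at x)"
      by (rule has_derivative_transform_within_open[OF _ U that]) (simp add: \<phi>)
    from frechet_derivative_at[OF this] show ?thesis by (metis (no_types))
  qed
  have injF: "inj (frechet_derivative F (at x))" if "x \<in> U" for x
    using inj[OF that] D[OF that] unfolding inj_def by metis
  show "levi_civita_pullback dom metric conn U F"
    by unfold_locales (use U smF Fdom injF in auto)
  show "frechet_derivative F (at x) (\<i> *s u) = \<i> *s frechet_derivative F (at x) u" if "x \<in> U"
  proof -
    have "chart' (F x) (frechet_derivative F (at x) (\<i> *s u)) = chart' (F x) (\<i> *s frechet_derivative F (at x) u)"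
      using hol[OF that, of u] unfolding D[OF that] \<phi>[OF that] rot_J_chart[OF Fdom[OF that]] .
    then show ?thesis using inj_chart'[OF Fdom[OF that]] by (simp add: inj_eq)
  qed
  show "pullback_metric \<phi> (rot_metric I t q) x u v = metric_pullback F metric x u v" if "x \<in> U"
    unfolding pullback_metric_def metric_pullback_def D[OF that] \<phi>[OF that]
    by (rule rot_metric_chart[OF Fdom[OF that]])
qed

text \<open>For parallel J, \<open>conn\<close> is complex linear in its second argument, and so are
  \<open>F'\<close> and \<open>F''\<close>; injectivity of \<open>F'\<close> passes this on to
  \<open>\<Gamma>_pull\<close>.\<close>

lemma kaehler_in_coords_hol_chart:
  fixes \<phi> :: "complex ^ 'n::finite \<Rightarrow> 'n ambient"
  assumes "hol_chart hypersurface (rot_J I t q) U \<phi>"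
  shows "kaehler_in_coords U (pullback_metric \<phi> (rot_metric I t q))"
proof -
  define F where "F x = coord (\<phi> x)" for x
  note transition = hol_chart_transition[OF assms, folded F_def]
  interpret levi_civita_pullback dom metric conn U F by (rule transition(1))
  let ?h = "pullback_metric \<phi> (rot_metric I t q)"
  interpret h: levi_civita U ?h \<Gamma>_pull
    by (rule levi_civita_cong[OF pull.levi_civita_axioms transition(3)])
  have "smooth_on U (\<lambda>x. ?h x u v)" for u v
  proof -
    have "smooth_on U (\<lambda>x. metric (F x) (F' x u) (F' x v))"
      by (intro smooth_metric open_dom smooth_F smooth_on_frechet_derivative F_in smooth_ab)
    then show ?thesis
      by (subst smooth_on_cong[OF open_dom]) (auto simp: transition(3) metric_pullback_def)
  qed
  moreover have "?h x (\<i> *s u) (\<i> *s v) = ?h x u v" if "x \<in> U" for x u v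
    using that by (simp add: transition(2,3) metric_pullback_def metric_def hC_rotate)
  moreover have "cov_deriv ?h (\<lambda>_. u) (\<lambda>_. \<i> *s v) x = \<i> *s cov_deriv ?h (\<lambda>_. u) (\<lambda>_. v) x" if "x \<in> U" for x u v
  proof -
    have lin: "bounded_linear ((*s) \<i> :: complex ^ 'n \<Rightarrow> complex ^ 'n)"
      by (rule bounded_bilinear.bounded_linear_right[OF bounded_bilinear_cvec_scale])
    \<comment> \<open>\<open>F'\<close> is complex linear at every point of the open domain, so the
      identity may be differentiated.\<close>
    have "((\<lambda>y. F' y (\<i> *s v)) has_derivative (\<lambda>u. \<i> *s F'' x u v)) (at x)"
      by (rule has_derivative_transform_within_open[OF bounded_linear.has_derivative[OF lin F'_deriv[OF that]] open_dom that])
        (simp add: transition(2))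
    from has_derivative_unique[OF F'_deriv[OF that] this]
    have "F'' x u (\<i> *s v) = \<i> *s F'' x u v" by (rule fun_cong)
    then have "\<Gamma>F x u (\<i> *s v) = \<i> *s \<Gamma>F x u v"
      using that by (simp add: \<Gamma>F_def transition(2) conn_rotate vec_eq_iff algebra_simps)
    then have "F' x (\<Gamma>_pull x u (\<i> *s v)) = \<i> *s \<Gamma>F x u v"
      by (rule trans[OF F'_\<Gamma>_pull[OF that]])
    then have "F' x (\<Gamma>_pull x u (\<i> *s v)) = F' x (\<i> *s \<Gamma>_pull x u v)"
      unfolding transition(2)[OF that] F'_\<Gamma>_pull[OF that, of u v] .
    then have "\<Gamma>_pull x u (\<i> *s v) = \<i> *s \<Gamma>_pull x u v"
      using inj_F'[OF that] by (simp add: inj_eq)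
    then show ?thesis by (simp only: h.cov_deriv_const[OF that])
  qed
  ultimately show ?thesis
    unfolding kaehler_in_coords_def
    using h.bilinear_metric h.metric_sym h.metric_pos by blast
qed

lemma kaehler_hypersurface:
  "kaehler TYPE('n::finite) (hypersurface :: 'n ambient set) (rot_metric I t q) (rot_J I t q)"
  unfolding kaehler_def
  using hol_chart_chart kaehler_in_coords_hol_chart hypersurface_coord by (metis image_eqI)

lemma bochner_component_hol_chart:
  fixes \<phi> :: "complex ^ 'n::finite \<Rightarrow> 'n ambient"
  assumes "hol_chart hypersurface (rot_J I t q) U \<phi>" "x \<in> U" and ode: "\<And>\<rho>. \<rho> \<in> J \<Longrightarrow> ode \<rho>"
  shows "bochner_component (pullback_metric \<phi> (rot_metric I t q)) x \<alpha> \<beta> \<gamma> \<delta> = 0"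
proof -
  define F where "F x = coord (\<phi> x)" for x
  note transition = hol_chart_transition[OF assms(1), folded F_def]
  interpret levi_civita_pullback dom metric conn U F by (rule transition(1))
  note Fx = F_in[OF assms(2)]
  have N: "real CARD('n) > 0" by simp
  have 0: "K0 (real CARD('n)) (F x \<bullet> F x) = 0"
    using ode[OF dom_J[OF Fx]] unfolding K0_eq[OF dom_J[OF Fx] N] ode_def by simp
  have "bochner_form metric (F x) u v w z = 0" for u v w z
    unfolding bochner_form_metric[OF Fx] 0 K1_K2_zero[OF dom_J[OF Fx] N ode[OF dom_J[OF Fx]]] by simp
  moreover have "bochner_form (pullback_metric \<phi> (rot_metric I t q)) x = bochner_form (metric_pullback F metric) x"
    by (rule bochner_form_cong[OF pull.levi_civita_axioms _ assms(2)]) (rule transition(3))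
  ultimately show ?thesis
    unfolding bochner_component_eq by (simp add: bochner_form_pullback[OF transition(1) assms(2) transition(2)[OF assms(2)]])
qed

text \<open>Dimension at least 2 supplies a second axis \<beta> orthogonal to a point on the axis
  \<alpha>. With all four arguments along \<beta> every product with the point vanishes and only
  \<open>K0\<close> is left.\<close>

lemma ode_if_bochner_flat:
  assumes dim: "CARD('n::finite) \<ge> 2" and s: "s \<in> I"
    and flat: "\<And>y (\<alpha> :: 'n) \<beta> \<gamma> \<delta>. y \<in> dom \<Longrightarrow>
      bochner_component (pullback_metric chart (rot_metric I t q)) y \<alpha> \<beta> \<gamma> \<delta> = 0"
  shows "ode ((f s)\<^sup>2)"
proof -
  obtain \<alpha> \<beta> :: 'n where ne: "\<alpha> \<noteq> \<beta>"
    using dim card_2_iff' by (metis UNIV_I card_le_Suc0_iff_eq finite not_less_eq_eq numeral_2_eq_2)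
  define y where "y = axis \<alpha> (complex_of_real (f s))"
  have yy: "y \<bullet> y = (f s)\<^sup>2"
    by (simp add: y_def inner_axis_axis inner_complex_def power2_eq_square)
  moreover have J: "(f s)\<^sup>2 \<in> J" using s by (simp add: J_def)
  ultimately have y: "y \<in> dom" by (simp add: dom_def)
  have h: "hprod (axis \<beta> 1) y = 0" "hprod y (axis \<beta> 1) = 0" "hprod (axis \<beta> 1) (axis \<beta> 1) = 1"
    using ne by (simp_all add: y_def hprod_def axis_def if_distrib if_distribR cong: if_cong)
  have "bochner_form (pullback_metric chart (rot_metric I t q)) y = bochner_form metric y"
    by (rule bochner_form_cong[OF levi_civita_axioms _ y]) (rule pullback_metric_chart)
  then have "0 = bochner_form metric y (axis \<beta> 1) (axis \<beta> 1) (axis \<beta> 1) (axis \<beta> 1)"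
    using flat[OF y, of \<beta> \<beta> \<beta> \<beta>] unfolding bochner_component_eq by simp
  also have "\<dots> = - of_real (K0 (real CARD('n)) ((f s)\<^sup>2))"
    unfolding bochner_form_metric[OF y] yy h by simp
  finally have "K0 (real CARD('n)) ((f s)\<^sup>2) = 0" by simp
  then show ?thesis
    using K0_eq[OF J, of "real CARD('n)"] x_pos[OF J] J_pos[OF J] Y_ge_1[OF J] by (auto simp: ode_def)
qed

lemma bochner_kaehler_iff:
  assumes dim: "CARD('n::finite) \<ge> 2"
  shows "bochner_kaehler TYPE('n) (hypersurface :: 'n ambient set) (rot_metric I t q) (rot_J I t q)
    \<longleftrightarrow> (\<exists>c\<^sub>1 c\<^sub>2. \<forall>s\<in>I. deriv t s = c\<^sub>1 * t s ^ 4 + c\<^sub>2 * (t s)\<^sup>2 + 1)"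
  unfolding ode_iff[symmetric]
proof
  assume "bochner_kaehler TYPE('n) (hypersurface :: 'n ambient set) (rot_metric I t q) (rot_J I t q)"
  then have "bochner_component (pullback_metric chart (rot_metric I t q)) y \<alpha> \<beta> \<gamma> \<delta> = 0"
    if "y \<in> dom" for y and \<alpha> \<beta> \<gamma> \<delta> :: 'n
    using hol_chart_chart that unfolding bochner_kaehler_def by blast
  from ode_if_bochner_flat[OF dim _ this] show "\<forall>\<rho>\<in>J. ode \<rho>" by (auto simp: J_def)
next
  assume "\<forall>\<rho>\<in>J. ode \<rho>"
  then show "bochner_kaehler TYPE('n) (hypersurface :: 'n ambient set) (rot_metric I t q) (rot_J I t q)"
    unfolding bochner_kaehler_def using kaehler_hypersurface bochner_component_hol_chart by blast
qed

text \<open>The derivative of the inverse function is 1/t', and t' > 0 excludes zeros of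
  \<open>k\<close> on the range of \<open>t\<close>.\<close>

lemma inverse_ode_iff:
  "(\<forall>r\<in>t ` I. k r \<noteq> 0 \<and> (the_inv_into I t has_real_derivative 1 / k r) (at r))
    \<longleftrightarrow> (\<forall>s\<in>I. deriv t s = k (t s))"
proof -
  have "k (t s) \<noteq> 0 \<and> (the_inv_into I t has_real_derivative 1 / k (t s)) (at (t s)) \<longleftrightarrow> deriv t s = k (t s)"
    if "s \<in> I" for s
  proof
    assume "k (t s) \<noteq> 0 \<and> (the_inv_into I t has_real_derivative 1 / k (t s)) (at (t s))"
    then have "1 / k (t s) = inverse (deriv t s)" using DERIV_unique t_inverse(4)[OF that] by blast
    \<comment> \<open>\<open>inverse\<close> is an involution on all reals, so equal reciprocals
      suffice.\<close>
    then show "deriv t s = k (t s)" by (metis inverse_eq_divide inverse_inverse_eq)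
  next
    assume "deriv t s = k (t s)"
    then show "k (t s) \<noteq> 0 \<and> (the_inv_into I t has_real_derivative 1 / k (t s)) (at (t s))"
      using t_inverse(4)[OF that] t'_pos[OF that] by (simp add: inverse_eq_divide)
  qed
  then show ?thesis by auto
qed

end

theorem proposition6p8:
  fixes I :: "real set" and t q :: "real \<Rightarrow> real"
    and M :: "((complex ^ 'n::finite) \<times> real) set"
  assumes dim: "CARD('n) \<ge> 2"
    and interval: "open I" "is_interval I" "I \<noteq> {}"
    and smooth: "smooth_on I t" "smooth_on I q"
    and t_pos: "\<forall>s\<in>I. t s > 0"
    and natural_parameter: "\<forall>s\<in>I. (deriv t s)\<^sup>2 - (deriv q s)\<^sup>2 = 1"
    and M: "M = rot_hypersurface I t q"
    and type_II: "timelike_normals I t q M"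
    and t'_ge_1: "\<forall>s\<in>I. deriv t s \<ge> 1"
  shows "bochner_kaehler TYPE('n) M (rot_metric I t q) (rot_J I t q) \<longleftrightarrow>
    (\<exists>c\<^sub>1 c\<^sub>2 :: real. \<forall>r\<in>t ` I.
       c\<^sub>1 * r ^ 4 + c\<^sub>2 * r ^ 2 + 1 \<noteq> 0 \<and>
       (the_inv_into I t has_real_derivative 1 / (c\<^sub>1 * r ^ 4 + c\<^sub>2 * r ^ 2 + 1)) (at r))"
proof -
  interpret meridian I t q
    by unfold_locales (use interval smooth t_pos natural_parameter t'_ge_1 in auto)
  show ?thesis
    unfolding M bochner_kaehler_iff[OF dim] inverse_ode_iff ..
qed

end
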